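(* Let $\{\Phi_t\}_{t\in U}$ be a transversal family of non-autonomous conformal iterated function systems (TNCIFS) on a non-empty compact convex set $X\subset\mathbb{R}^m$, with parameter set a non-empty open set $U\subset\mathbb{R}^d$. For $t\in U$ let $J_t$ be the limit set of $\Phi_t$ and let $s(t)\in[0,\infty]$ be its Bowen dimension. Then (i) $\dim_H(J_t)=\min\{m,s(t)\}$ for $\mathcal{L}_d$-a.e. $t\in U$; (ii) $\mathcal{L}_m(J_t)>0$ for $\mathcal{L}_d$-a.e. $t\in\{t\in U : s(t)>m\}$.
   Context: $\mathbb{N}=\{1,2,\dots\}$; $|\cdot|$ is the Euclidean norm; $\mathcal{L}_d$ is $d$-dimensional Lebesgue measure on $\mathbb{R}^d$; $\dim_H$ is Hausdorff dimension. Setting. Let $m,d\in\mathbb{N}$, let $X\subset\mathbb{R}^m$ be a non-empty compact convex set, let $U\subset\mathbb{R}^d$ be a non-empty open set, and for each $j\in\mathbb{N}$ let $I^{(j)}$ be a finite set. For $n\le k$ in $\mathbb{N}$ put $I_n^k=\prod_{j=n}^k I^{(j)}$, $I_n^\infty=\prod_{j=n}^\infty I^{(j)}$ (product topology), $I^n=I_1^n$, $I^\infty=I_1^\infty$. For $t\in U$ let $\Phi_t=(\Phi_t^{(j)})_{j=1}^\infty$, where $\Phi_t^{(j)}=\{\phi_{i,t}^{(j)}:X\to X\}_{i\in I^{(j)}}$ is a collection of maps. For $\omega=\omega_n\cdots\omega_k\in I_n^k$ put $\phi_{\omega,t}=\phi_{\omega_n,t}^{(n)}\circ\cdots\circ\phi_{\omega_k,t}^{(k)}$.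 For $\omega=\omega_n\omega_{n+1}\cdots\in I_n^\infty$ and $j\in\mathbb{N}$ put $\omega|_j=\omega_n\cdots\omega_{n+j-1}\in I_n^{n+j-1}$. A diffeomorphism $\phi:V\to\phi(V)$ on an open $V\subset\mathbb{R}^m$ is conformal if for every $x\in V$, $D\phi(x)=c_xA_x$ with $c_x>0$ and $A_x$ orthogonal; then $|D\phi(x)|:=c_x$, and $\|D\phi\|_A:=\sup\{|D\phi(x)|:x\in A\}$ for $A\subset V$. $\{\Phi_t\}_{t\in U}$ is a TNCIFS if: 1. Conformality: there is an open connected set $V\supset X$ (independent of $i,j,t$) such that every $\phi_{i,t}^{(j)}$ extends to a $C^1$ conformal map on $V$ with $\phi_{i,t}^{(j)}(V)\subset V$. 2. Uniform contraction: there is $0<\gamma<1$ such that $|D\phi_{\omega|_j,t}(x)|\le\gamma^j$ for all $t\in U$, $n,j\in\mathbb{N}$, $\omega\in I_n^\infty$, $x\in V$. 3. Bounded distortion: there is a continuous function $K:U\to[1,\infty)$ such that $|D\phi_{\omega|_j,t}(x_1)|\le K(t)|D\phi_{\omega|_j,t}(x_2)|$ for all $t\in U$, $n,j\in\mathbb{N}$, $\omega\in I_n^\infty$, $x_1,x_2\in V$. 4. Distortion continuity: for every $\eta>0$ and $t_0\in U$ there is $\delta=\delta(\eta,t_0)>0$ such that for all $t\in U$ with $|t-t_0|\le\delta$, all $n,j\in\mathbb{N}$ and $\omega\in I_n^\infty$, $\exp(-j\eta)\le\|D\phi_{\omega|_j,t_0}\|_X/\|D\phi_{\omega|_j,t}\|_X\le\exp(j\eta)$.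 For $t\in U$, $n\in\mathbb{N}$, $\omega\in I_n^\infty$, the set $\bigcap_{j\ge1}\phi_{\omega|_j,t}(X)$ is a singleton; its unique point is denoted $\pi_{n,t}(\omega)$, defining the $n$-th address map $\pi_{n,t}:I_n^\infty\to X$. 5. Continuity: for each $n\in\mathbb{N}$, $U\times I_n^\infty\ni(t,\omega)\mapsto\pi_{n,t}(\omega)$ is continuous. 6. Transversality: for every compact $G\subset U$ there is a sequence $\{C_n\}_{n\ge1}$ of positive constants with $\lim_{n\to\infty}\frac{\log C_n}{n}=0$ such that for all $n\in\mathbb{N}$, all $\omega,\tau\in I_n^\infty$ with $\omega_n\ne\tau_n$ and all $r>0$, $\mathcal{L}_d(\{t\in G:|\pi_{n,t}(\omega)-\pi_{n,t}(\tau)|\le r\})\le C_nr^m$. Limit set: $J_t:=\pi_{1,t}(I^\infty)$. For $s\ge0$ and $n\in\mathbb{N}$ put $Z_{n,t}(s)=\sum_{\omega\in I^n}(\|D\phi_{\omega,t}\|_X)^s$ and $\underline{P}_t(s)=\liminf_{n\to\infty}\frac1n\log Z_{n,t}(s)\in[-\infty,\infty]$ (lower pressure function). The Bowen dimension is $s(t)=\sup\{s\ge0:\underline{P}_t(s)>0\}=\inf\{s\ge0:\underline{P}_t(s)<0\}$, with $\sup\emptyset=0$, $\inf\emptyset=\infty$. *)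

theory Defs
  imports "HOL-Analysis.Analysis"
begin

text \<open>Here \<open>0\<^sup>0 = 1\<close> for nonempty sets, whereas \<open>0 powr 0 = 0\<close>.\<close>

definition hausdorff_gauge :: "real \<Rightarrow> 'a::metric_space set \<Rightarrow> ennreal" where
  "hausdorff_gauge s A =
     (if A = {} then 0 else if s = 0 then 1 else ennreal (diameter A powr s))"

text \<open>Covering sets are required to be bounded because \<^const>\<open>diameter\<close> is a meaningless
  real number on unbounded sets.\<close>

definition hausdorff_premeasure :: "real \<Rightarrow> real \<Rightarrow> 'a::metric_space set \<Rightarrow> ennreal" where
  "hausdorff_premeasure \<delta> s A =
     (INF C\<in>{C :: nat \<Rightarrow> 'a set. A \<subseteq> (\<Union>i. C i) \<and> (\<forall>i. bounded (C i) \<and> diameter (C i) \<le> \<delta>)}.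
        \<Sum>i. hausdorff_gauge s (C i))"

definition hausdorff_measure :: "real \<Rightarrow> 'a::metric_space set \<Rightarrow> ennreal" where
  "hausdorff_measure s A = (SUP \<delta>\<in>{0<..}. hausdorff_premeasure \<delta> s A)"

definition hausdorff_dim :: "'a::metric_space set \<Rightarrow> ennreal" where
  "hausdorff_dim A = Inf (ennreal ` {s. 0 \<le> s \<and> hausdorff_measure s A = 0})"

definition C1_on :: "'a::euclidean_space set \<Rightarrow> ('a \<Rightarrow> 'a) \<Rightarrow> bool" where
  "C1_on V f \<longleftrightarrow>
     (\<exists>D :: 'a \<Rightarrow> 'a \<Rightarrow>\<^sub>L 'a.
        (\<forall>x\<in>V. (f has_derivative blinfun_apply (D x)) (at x)) \<and> continuous_on V D)"

definition C1_diffeomorphism_on :: "'a::euclidean_space set \<Rightarrow> ('a \<Rightarrow> 'a) \<Rightarrow> bool" where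
  "C1_diffeomorphism_on V f \<longleftrightarrow>
     open V \<and> open (f ` V) \<and> inj_on f V \<and> C1_on V f \<and> C1_on (f ` V) (inv_into V f)"

definition conformal_at_with :: "('a::euclidean_space \<Rightarrow> 'a) \<Rightarrow> 'a \<Rightarrow> real \<Rightarrow> bool" where
  "conformal_at_with f x c \<longleftrightarrow>
     c > 0 \<and> (\<exists>A. orthogonal_transformation A \<and> (f has_derivative (\<lambda>v. c *\<^sub>R A v)) (at x))"

definition conformal_on :: "'a::euclidean_space set \<Rightarrow> ('a \<Rightarrow> 'a) \<Rightarrow> bool" where
  "conformal_on V f \<longleftrightarrow> C1_diffeomorphism_on V f \<and> (\<forall>x\<in>V. \<exists>c. conformal_at_with f x c)"

definition conformal_factor :: "('a::euclidean_space \<Rightarrow> 'a) \<Rightarrow> 'a \<Rightarrow> real" where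
  "conformal_factor f x = (THE c. conformal_at_with f x c)"

definition conformal_sup :: "('a::euclidean_space \<Rightarrow> 'a) \<Rightarrow> 'a set \<Rightarrow> real" where
  "conformal_sup f A = (SUP x\<in>A. conformal_factor f x)"

lemma conformal_factor_eq:
  assumes "conformal_at_with f x c"
  shows "conformal_factor f x = c"
  unfolding conformal_factor_def
proof (rule the_equality)
  fix c' assume c': "conformal_at_with f x c'"
  obtain A where A: "c > 0" "orthogonal_transformation A"
      "(f has_derivative (\<lambda>v. c *\<^sub>R A v)) (at x)"
    using assms by (auto simp: conformal_at_with_def)
  obtain B where B: "c' > 0" "orthogonal_transformation B"
      "(f has_derivative (\<lambda>v. c' *\<^sub>R B v)) (at x)"
    using c' by (auto simp: conformal_at_with_def)
  obtain b :: 'a where b: "b \<in> Basis" by (meson nonempty_Basis ex_in_conv)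
  have "c' *\<^sub>R B b = c *\<^sub>R A b"
    using has_derivative_unique[OF A(3) B(3)] by metis
  then have "norm (c' *\<^sub>R B b) = norm (c *\<^sub>R A b)" by simp
  then show "c' = c"
    using A B b by (simp add: orthogonal_transformation_norm)
qed (rule assms)

text \<open>
  Levels are the natural numbers \<open>j \<ge> 1\<close>, and \<open>\<phi> j i t\<close> is the map with index \<open>i \<in> I j\<close>
  at level \<open>j\<close> and parameter \<open>t\<close>, already extended from \<open>X\<close> to \<open>V\<close>. The system carries its
  extension as data, since derivatives on \<open>X\<close> need not be determined by the map on \<open>X\<close> when
  \<open>X\<close> has empty interior.

  A word in $I_n^k$ or $I_n^\infty$ is a function on \<open>{n..k}\<close> or \<open>{n..}\<close>, so the first letter of
  \<open>\<omega>\<close> is \<open>\<omega> n\<close>.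
\<close>

type_synonym ('i, 'd, 'm) system = "nat \<Rightarrow> 'i \<Rightarrow> real^'d \<Rightarrow> real^'m \<Rightarrow> real^'m"

definition fin_words :: "(nat \<Rightarrow> 'i set) \<Rightarrow> nat \<Rightarrow> nat \<Rightarrow> (nat \<Rightarrow> 'i) set" where
  "fin_words I n k = (\<Pi>\<^sub>E j\<in>{n..k}. I j)"

definition inf_words :: "(nat \<Rightarrow> 'i set) \<Rightarrow> nat \<Rightarrow> (nat \<Rightarrow> 'i) set" where
  "inf_words I n = (\<Pi>\<^sub>E j\<in>{n..}. I j)"

definition inf_words_topology :: "(nat \<Rightarrow> 'i set) \<Rightarrow> nat \<Rightarrow> (nat \<Rightarrow> 'i) topology" where
  "inf_words_topology I n = product_topology (\<lambda>j. discrete_topology (I j)) {n..}"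

lemma topspace_inf_words_topology: "topspace (inf_words_topology I n) = inf_words I n"
  by (simp add: inf_words_topology_def inf_words_def)

text \<open>\<open>\<phi> n (\<omega> n) t \<circ> \<dots> \<circ> \<phi> k (\<omega> k) t\<close>; only the letters \<open>\<omega> n, \<dots>, \<omega> k\<close> matter.\<close>

definition word_map ::
    "('i, 'd, 'm) system \<Rightarrow> real^'d \<Rightarrow> nat \<Rightarrow> nat \<Rightarrow> (nat \<Rightarrow> 'i) \<Rightarrow> real^'m \<Rightarrow> real^'m" where
  "word_map \<phi> t n k \<omega> = foldr (\<circ>) (map (\<lambda>j. \<phi> j (\<omega> j) t) [n..<Suc k]) id"

text \<open>The map of the length-\<open>j\<close> prefix of \<open>\<omega>\<close>, where \<open>j \<ge> 1\<close> and \<open>\<omega>\<close> starts at level \<open>n\<close>.\<close>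

definition prefix_map ::
    "('i, 'd, 'm) system \<Rightarrow> real^'d \<Rightarrow> nat \<Rightarrow> nat \<Rightarrow> (nat \<Rightarrow> 'i) \<Rightarrow> real^'m \<Rightarrow> real^'m" where
  "prefix_map \<phi> t n j \<omega> = word_map \<phi> t n (n + j - 1) \<omega>"

definition address_map ::
    "(real^'m) set \<Rightarrow> ('i, 'd, 'm) system \<Rightarrow> nat \<Rightarrow> real^'d \<Rightarrow> (nat \<Rightarrow> 'i) \<Rightarrow> real^'m" where
  "address_map X \<phi> n t \<omega> = (THE x. (\<Inter>j\<in>{1..}. prefix_map \<phi> t n j \<omega> ` X) = {x})"

definition limit_set ::
    "(real^'m) set \<Rightarrow> (nat \<Rightarrow> 'i set) \<Rightarrow> ('i, 'd, 'm) system \<Rightarrow> real^'d \<Rightarrow> (real^'m) set" where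
  "limit_set X I \<phi> t = address_map X \<phi> 1 t ` inf_words I 1"

definition partition_sum ::
    "(real^'m) set \<Rightarrow> (nat \<Rightarrow> 'i set) \<Rightarrow> ('i, 'd, 'm) system \<Rightarrow> nat \<Rightarrow> real^'d \<Rightarrow> real \<Rightarrow> real" where
  "partition_sum X I \<phi> n t s =
     (\<Sum>\<omega>\<in>fin_words I 1 n. conformal_sup (word_map \<phi> t 1 n \<omega>) X powr s)"

text \<open>The logarithm of a nonnegative real number, with \<open>log 0 = -\<infinity>\<close> (whereas \<open>ln 0 = 0\<close>);
  the value \<open>0\<close> occurs for partition sums when some \<open>I j\<close> is empty.\<close>

definition ext_ln :: "real \<Rightarrow> ereal" where
  "ext_ln x = (if x = 0 then -\<infinity> else ereal (ln x))"

definition lower_pressure ::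
    "(real^'m) set \<Rightarrow> (nat \<Rightarrow> 'i set) \<Rightarrow> ('i, 'd, 'm) system \<Rightarrow> real^'d \<Rightarrow> real \<Rightarrow> ereal" where
  "lower_pressure X I \<phi> t s =
     liminf (\<lambda>n. ereal (1 / real n) * ext_ln (partition_sum X I \<phi> n t s))"

text \<open>In \<^typ>\<open>ennreal\<close> the supremum of the empty set is \<open>0\<close>.  Under uniform contraction the pressure
  is strictly decreasing wherever it is finite, so this is also the infimum of the \<open>s \<ge> 0\<close> with
  negative pressure.\<close>

definition bowen_dim ::
    "(real^'m) set \<Rightarrow> (nat \<Rightarrow> 'i set) \<Rightarrow> ('i, 'd, 'm) system \<Rightarrow> real^'d \<Rightarrow> ennreal" where
  "bowen_dim X I \<phi> t = Sup (ennreal ` {s. 0 \<le> s \<and> lower_pressure X I \<phi> t s > 0})"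

definition conformality ::
    "(real^'m) set \<Rightarrow> (real^'d) set \<Rightarrow> (nat \<Rightarrow> 'i set) \<Rightarrow> (real^'m) set \<Rightarrow> ('i, 'd, 'm) system \<Rightarrow> bool"
  where
  "conformality X U I V \<phi> \<longleftrightarrow>
     open V \<and> connected V \<and> X \<subseteq> V \<and>
     (\<forall>t\<in>U. \<forall>j\<ge>1. \<forall>i\<in>I j. conformal_on V (\<phi> j i t) \<and> \<phi> j i t ` V \<subseteq> V)"

definition uniform_contraction ::
    "(real^'d) set \<Rightarrow> (nat \<Rightarrow> 'i set) \<Rightarrow> (real^'m) set \<Rightarrow> ('i, 'd, 'm) system \<Rightarrow> bool" where
  "uniform_contraction U I V \<phi> \<longleftrightarrow>
     (\<exists>\<gamma>::real. 0 < \<gamma> \<and> \<gamma> < 1 \<and>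
        (\<forall>t\<in>U. \<forall>n\<ge>1. \<forall>j\<ge>1. \<forall>\<omega>\<in>inf_words I n. \<forall>x\<in>V.
           conformal_factor (prefix_map \<phi> t n j \<omega>) x \<le> \<gamma> ^ j))"

definition bounded_distortion ::
    "(real^'d) set \<Rightarrow> (nat \<Rightarrow> 'i set) \<Rightarrow> (real^'m) set \<Rightarrow> ('i, 'd, 'm) system \<Rightarrow> bool" where
  "bounded_distortion U I V \<phi> \<longleftrightarrow>
     (\<exists>K :: real^'d \<Rightarrow> real. continuous_on U K \<and> (\<forall>t\<in>U. 1 \<le> K t) \<and>
        (\<forall>t\<in>U. \<forall>n\<ge>1. \<forall>j\<ge>1. \<forall>\<omega>\<in>inf_words I n. \<forall>x1\<in>V. \<forall>x2\<in>V.
           conformal_factor (prefix_map \<phi> t n j \<omega>) x1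
             \<le> K t * conformal_factor (prefix_map \<phi> t n j \<omega>) x2))"

definition distortion_continuity ::
    "(real^'m) set \<Rightarrow> (real^'d) set \<Rightarrow> (nat \<Rightarrow> 'i set) \<Rightarrow> ('i, 'd, 'm) system \<Rightarrow> bool" where
  "distortion_continuity X U I \<phi> \<longleftrightarrow>
     (\<forall>\<eta>>0. \<forall>t0\<in>U. \<exists>\<delta>>0. \<forall>t\<in>U. norm (t - t0) \<le> \<delta> \<longrightarrow>
        (\<forall>n\<ge>1. \<forall>j\<ge>1. \<forall>\<omega>\<in>inf_words I n.
           exp (- real j * \<eta>)
             \<le> conformal_sup (prefix_map \<phi> t0 n j \<omega>) X / conformal_sup (prefix_map \<phi> t n j \<omega>) X \<and>
           conformal_sup (prefix_map \<phi> t0 n j \<omega>) X / conformal_sup (prefix_map \<phi> t n j \<omega>) X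
             \<le> exp (real j * \<eta>)))"

definition address_continuity ::
    "(real^'m) set \<Rightarrow> (real^'d) set \<Rightarrow> (nat \<Rightarrow> 'i set) \<Rightarrow> ('i, 'd, 'm) system \<Rightarrow> bool" where
  "address_continuity X U I \<phi> \<longleftrightarrow>
     (\<forall>n\<ge>1. continuous_map (prod_topology (top_of_set U) (inf_words_topology I n)) euclidean
        (\<lambda>(t, \<omega>). address_map X \<phi> n t \<omega>))"

definition transversality ::
    "(real^'m) set \<Rightarrow> (real^'d) set \<Rightarrow> (nat \<Rightarrow> 'i set) \<Rightarrow> ('i, 'd, 'm) system \<Rightarrow> bool" where
  "transversality X U I \<phi> \<longleftrightarrow>
     (\<forall>G. compact G \<and> G \<subseteq> U \<longrightarrow>
        (\<exists>C :: nat \<Rightarrow> real. (\<forall>n\<ge>1. 0 < C n) \<and> (\<lambda>n. ln (C n) / real n) \<longlonglongrightarrow> 0 \<and>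
           (\<forall>n\<ge>1. \<forall>\<omega>\<in>inf_words I n. \<forall>\<tau>\<in>inf_words I n. \<omega> n \<noteq> \<tau> n \<longrightarrow>
              (\<forall>r>0. emeasure lebesgue
                   {t\<in>G. norm (address_map X \<phi> n t \<omega> - address_map X \<phi> n t \<tau>) \<le> r}
                 \<le> ennreal (C n * r ^ CARD('m))))))"

definition TNCIFS ::
    "(real^'m) set \<Rightarrow> (real^'d) set \<Rightarrow> (nat \<Rightarrow> 'i set) \<Rightarrow> (real^'m) set \<Rightarrow> ('i, 'd, 'm) system \<Rightarrow> bool"
  where
  "TNCIFS X U I V \<phi> \<longleftrightarrow>
     X \<noteq> {} \<and> compact X \<and> convex X \<and> U \<noteq> {} \<and> open U \<and>
     (\<forall>j\<ge>1. finite (I j)) \<and>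
     (\<forall>t\<in>U. \<forall>j\<ge>1. \<forall>i\<in>I j. \<phi> j i t ` X \<subseteq> X) \<and>
     conformality X U I V \<phi> \<and>
     uniform_contraction U I V \<phi> \<and>
     bounded_distortion U I V \<phi> \<and>
     distortion_continuity X U I \<phi> \<and>
     address_continuity X U I \<phi> \<and>
     transversality X U I \<phi>"

end

theory Submission
  imports Defs
begin

text \<open>
  The upper bound \<open>dim J\<^sub>t \<le> min m (s t)\<close> holds for every \<open>t\<close>, by covering with the images
  \<open>\<phi>\<^sub>u X\<close> of words \<open>u\<close> of length \<open>n\<close>, along lengths where the partition sum is small.

  For the lower bounds fix \<open>t\<^sub>0\<close> and \<open>s \<le> m\<close> with positive pressure at \<open>t\<^sub>0\<close>. No measure on the
  space of infinite words is needed: give the words \<open>u\<close> of length \<open>N\<close> the weights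
  proportional to \<open>\<parallel>D\<phi>\<^sub>u\<parallel>\<^sup>s\<close> at \<open>t\<^sub>0\<close>. By bounded distortion a cylinder \<open>v\<close> of length \<open>n \<le> N\<close> has
  weight at most \<open>K\<^sup>s \<parallel>D\<phi>\<^sub>v\<parallel>\<^sup>s / Z\<^sub>n\<close>, and \<open>Z\<^sub>n\<close> grows exponentially. Transversality and distortion
  continuity bound the measure of the parameters near \<open>t\<^sub>0\<close> at which the points of two words that
  split at level \<open>n\<close> are \<open>r\<close>-close. Summing over \<open>n\<close>, the correlation sum at scale \<open>r\<close>, integrated
  over \<open>t\<close>, is \<open>O(r\<^sup>s)\<close> uniformly in \<open>N\<close> and \<open>r \<ge> \<gamma>\<^sup>N\<close>. By Fatou's lemma almost every \<open>t\<close> near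
  \<open>t\<^sub>0\<close> has correlation sums bounded along infinitely many \<open>N\<close>, which together with compactness of
  \<open>J\<^sub>t\<close> gives positive Hausdorff measure in every exponent below \<open>s\<close>, and positive Lebesgue measure
  if \<open>s = m\<close>. Since \<open>t\<^sub>0\<close> is arbitrary, the Lindelof property replaces any measurability or
  continuity of the Bowen dimension.
\<close>

subsection \<open>Distances under conformal maps\<close>

lemma conformal_at_with_id: "conformal_at_with id x 1"
  unfolding conformal_at_with_def
  by (auto intro!: exI[of _ id] simp: id_def)

lemma conformal_at_with_compose:
  assumes g: "conformal_at_with g x c" and f: "conformal_at_with f (g x) d"
  shows "conformal_at_with (f \<circ> g) x (d * c)"
proof -
  obtain A where A: "c > 0" "orthogonal_transformation A"
      "(g has_derivative (\<lambda>v. c *\<^sub>R A v)) (at x)"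
    using g by (auto simp: conformal_at_with_def)
  obtain B where B: "d > 0" "orthogonal_transformation B"
      "(f has_derivative (\<lambda>v. d *\<^sub>R B v)) (at (g x))"
    using f by (auto simp: conformal_at_with_def)
  have "((f \<circ> g) has_derivative (\<lambda>v. d *\<^sub>R B v) \<circ> (\<lambda>v. c *\<^sub>R A v)) (at x)"
    by (rule diff_chain_at[OF A(3) B(3)])
  moreover have "(\<lambda>v. d *\<^sub>R B v) \<circ> (\<lambda>v. c *\<^sub>R A v) = (\<lambda>v. (d * c) *\<^sub>R (B \<circ> A) v)"
    using orthogonal_transformation_linear[OF B(2)] by (auto simp: linear_cmul)
  moreover have "orthogonal_transformation (B \<circ> A)"
    by (rule orthogonal_transformation_compose[OF B(2) A(2)])
  ultimately show ?thesis
    unfolding conformal_at_with_def using A(1) B(1) by (metis mult_pos_pos)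
qed

text \<open>Mean value inequality on the convex set \<open>S\<close>: an orthogonal map preserves
  norms, so a derivative with conformal factor \<open>c\<close> has operator norm at most
  \<open>c\<close>.\<close>

lemma conformal_dist_le:
  fixes f :: "'a::euclidean_space \<Rightarrow> 'a"
  assumes "convex S" and f: "\<And>x. x \<in> S \<Longrightarrow> \<exists>c\<le>B. conformal_at_with f x c"
    and "x \<in> S" "y \<in> S"
  shows "dist (f x) (f y) \<le> B * dist x y"
proof -
  have "\<exists>D. \<forall>x\<in>S. (f has_derivative D x) (at x within S) \<and> onorm (D x) \<le> B"
  proof (rule bchoice, rule ballI)
    fix x assume "x \<in> S"
    then obtain c A where c: "c \<le> B" "c > 0" "orthogonal_transformation A"
        "(f has_derivative (\<lambda>v. c *\<^sub>R A v)) (at x)"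
      using f unfolding conformal_at_with_def by blast
    have "onorm (\<lambda>v. c *\<^sub>R A v) \<le> B"
    proof (rule onorm_le)
      fix v show "norm (c *\<^sub>R A v) \<le> B * norm v"
        using c by (simp add: orthogonal_transformation_norm mult_right_mono)
    qed
    then show "\<exists>D. (f has_derivative D) (at x within S) \<and> onorm D \<le> B"
      using c(4) has_derivative_at_withinI by blast
  qed
  then obtain D where "\<And>x. x \<in> S \<Longrightarrow> (f has_derivative D x) (at x within S)"
    "\<And>x. x \<in> S \<Longrightarrow> onorm (D x) \<le> B" by blast
  from differentiable_bound[OF assms(1) this assms(4,3)] show ?thesis
    by (simp add: dist_norm norm_minus_commute)
qed

text \<open>\<open>A\<close> is orthogonal, hence onto, so some unit vector \<open>v\<close> is sent
  to the direction pointing from \<open>f y\<close> straight at \<open>z\<close>. A step of length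
  \<open>h\<close> along \<open>v\<close> shortens the distance to \<open>z\<close> by
  \<open>c * h\<close> up to the linearisation error, and this beats \<open>l * h\<close> because
  \<open>l < c\<close>.\<close>

lemma conformal_at_with_descent:
  fixes f :: "'a::euclidean_space \<Rightarrow> 'a"
  assumes f: "conformal_at_with f y c" and "l < c" "f y \<noteq> z" "0 \<le> l" "0 < e"
  obtains y' where "dist y' y < e" "dist (f y') z + l * dist y' y < dist (f y) z"
proof -
  obtain A where A: "c > 0" "orthogonal_transformation A"
      "(f has_derivative (\<lambda>v. c *\<^sub>R A v)) (at y)"
    using f by (auto simp: conformal_at_with_def)
  define d where "d = norm (f y - z)"
  have d: "d > 0" using assms by (simp add: d_def)
  have "surj A" by (rule orthogonal_transformation_surj[OF A(2)])
  then obtain v where v: "A v = - (1 / d) *\<^sub>R (f y - z)" by (metis surjD)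
  have nv: "norm v = 1"
    using d v orthogonal_transformation_norm[OF A(2), of v] by (simp add: d_def)
  \<comment> \<open>Half of the gap \<open>c - l\<close> is spent on the linearisation error; the
    gain left over is \<open>(c - l - q) * h > 0\<close>.\<close>
  define q where "q = (c - l) / 2"
  have q: "q > 0" using assms by (simp add: q_def)
  from A(3) obtain \<delta> where \<delta>: "\<delta> > 0"
    "\<And>y'. norm (y' - y) < \<delta> \<Longrightarrow> norm (f y' - f y - c *\<^sub>R A (y' - y)) \<le> q * norm (y' - y)"
    unfolding has_derivative_at_alt using q by blast
  \<comment> \<open>The three bounds keep the step within the range of the derivative estimate,
    within the \<open>e\<close>-ball, and too short to overshoot \<open>z\<close>, so that
    \<open>1 - c * h / d\<close> is nonnegative.\<close>
  define h where "h = min (\<delta> / 2) (min (e / 2) (d / (2 * c)))"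
  have "h \<le> d / (2 * c)" by (simp add: h_def)
  then have "c * h \<le> d / 2" using A(1) by (simp add: field_simps)
  moreover have "h > 0" "h \<le> \<delta> / 2" "h \<le> e / 2"
    using \<delta>(1) \<open>0 < e\<close> d A(1) by (simp_all add: h_def)
  ultimately have h: "h > 0" "h < \<delta>" "h < e" "c * h \<le> d / 2"
    using \<delta>(1) \<open>0 < e\<close> by simp_all
  let ?y = "y + h *\<^sub>R v"
  have "norm (f ?y - z) = norm ((f ?y - f y - c *\<^sub>R A (?y - y)) + ((f y - z) + c *\<^sub>R A (h *\<^sub>R v)))"
    by simp
  also have "\<dots> \<le> norm (f ?y - f y - c *\<^sub>R A (?y - y)) + norm ((f y - z) + c *\<^sub>R A (h *\<^sub>R v))"
    by (rule norm_triangle_ineq)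
  also have "norm (f ?y - f y - c *\<^sub>R A (?y - y)) \<le> q * h"
    using \<delta>(2)[of ?y] h nv by simp
  also have "(f y - z) + c *\<^sub>R A (h *\<^sub>R v) = (1 - c * h / d) *\<^sub>R (f y - z)"
    using orthogonal_transformation_linear[OF A(2)]
    by (simp add: linear_cmul v scaleR_left_diff_distrib)
  also have "norm \<dots> = d - c * h"
  proof -
    have "c * h / d \<le> 1" using h d by (simp add: field_simps)
    then have "norm ((1 - c * h / d) *\<^sub>R (f y - z)) = (1 - c * h / d) * d"
      by (simp only: norm_scaleR d_def)
    moreover have "(1 - c * h / d) * d = d - c * h" using d by (simp add: field_simps)
    ultimately show ?thesis by (simp only:)
  qed
  finally have "norm (f ?y - z) + l * h \<le> d - (c - l - q) * h" by (simp add: algebra_simps)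
  moreover have "(c - l - q) * h > 0" using h q by (simp add: q_def)
  ultimately have "norm (f ?y - z) + l * h < d" by linarith
  then have "dist (f ?y) z + l * dist ?y y < dist (f y) z"
    using h nv by (simp add: dist_norm d_def)
  moreover have "dist ?y y < e" using h nv by (simp add: dist_norm)
  ultimately show ?thesis using that by blast
qed

text \<open>A minimiser of \<open>y \<mapsto> dist (f y) z + l * dist y x\<close> on the ball is an interior point,
  where the derivative of \<open>f\<close> would allow a further decrease unless \<open>f y = z\<close>.\<close>

lemma conformal_covers_ball:
  fixes f :: "'a::euclidean_space \<Rightarrow> 'a"
  assumes f: "\<And>y. y \<in> cball x R \<Longrightarrow> \<exists>c>l. conformal_at_with f y c"
    and l: "0 < l" and z: "dist (f x) z < l * R"
  obtains y where "y \<in> cball x R" "f y = z" "l * dist y x \<le> dist (f x) z"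
proof -
  have R: "R > 0" using z l by (smt (verit) mult_nonneg_nonpos zero_le_dist)
  have "continuous_on (cball x R) f"
    using f unfolding conformal_at_with_def
    by (meson continuous_at_imp_continuous_on has_derivative_continuous)
  then have "continuous_on (cball x R) (\<lambda>y. dist (f y) z + l * dist y x)"
    by (intro continuous_intros)
  from continuous_attains_inf[OF compact_cball _ this] obtain y where
    y: "y \<in> cball x R"
    and min: "\<And>y'. y' \<in> cball x R \<Longrightarrow> dist (f y) z + l * dist y x \<le> dist (f y') z + l * dist y' x"
    using R by fastforce
  have le: "dist (f y) z + l * dist y x \<le> dist (f x) z" using min[of x] R by simp
  have "l * dist y x < l * R" using le z by (smt (verit) zero_le_dist)
  then have lt: "dist y x < R" using l by simp
  have "f y = z"
  proof (rule ccontr)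
    assume ne: "f y \<noteq> z"
    obtain c where c: "l < c" "conformal_at_with f y c" using f y by blast
    obtain y' where y': "dist y' y < R - dist y x"
        "dist (f y') z + l * dist y' y < dist (f y) z"
      using conformal_at_with_descent[OF c(2,1) ne] l lt by (metis diff_gt_0_iff_gt less_imp_le)
    have "y' \<in> cball x R"
      using y'(1) dist_triangle[of y' x y] by (simp add: dist_commute)
    then have "dist (f y) z + l * dist y x \<le> dist (f y') z + l * dist y' x" by (rule min)
    also have "l * dist y' x \<le> l * dist y' y + l * dist y x"
      using l dist_triangle[of y' x y] by (simp flip: distrib_left)
    finally show False using y'(2) by linarith
  qed
  then show ?thesis using that y le by auto
qed

text \<open>The segment from \<open>f x\<close> to \<open>f y\<close> may leave the image of
  \<open>V\<close>, so the mean value inequality cannot simply be applied to the inverse. Instead,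
  if \<open>f y\<close> is close to \<open>f x\<close>, the covering lemma finds a preimage near
  \<open>x\<close>, which injectivity identifies with \<open>y\<close>. Otherwise the distance is at
  least \<open>L / 2 * R\<close>, and \<open>dist x y \<le> D\<close> explains the factor
  \<open>R / (2 * D)\<close>.\<close>

lemma conformal_dist_ge:
  fixes f :: "'a::euclidean_space \<Rightarrow> 'a"
  assumes inj: "inj_on f V" and f: "\<And>y. y \<in> V \<Longrightarrow> \<exists>c\<ge>L. conformal_at_with f y c"
    and V: "\<And>x. x \<in> S \<Longrightarrow> cball x R \<subseteq> V" and D: "\<And>x y. x \<in> S \<Longrightarrow> y \<in> S \<Longrightarrow> dist x y \<le> D"
    and "0 < R" "R \<le> D" "0 < L" "x \<in> S" "y \<in> S"
  shows "L * (R / (2 * D)) * dist x y \<le> dist (f x) (f y)"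
proof (cases "dist (f x) (f y) < L / 2 * R")
  case True
  have xy: "y \<in> V" using V \<open>y \<in> S\<close> \<open>0 < R\<close> by (metis centre_in_cball less_imp_le subsetD)
  \<comment> \<open>The covering lemma asks for factors strictly above its constant, hence
    \<open>L / 2\<close> instead of \<open>L\<close>.\<close>
  have "\<And>y. y \<in> cball x R \<Longrightarrow> \<exists>c>L/2. conformal_at_with f y c"
    using f V[OF \<open>x \<in> S\<close>] \<open>0 < L\<close> by (smt (verit) field_sum_of_halves subsetD)
  then obtain w where w: "w \<in> cball x R" "f w = f y" "L / 2 * dist w x \<le> dist (f x) (f y)"
    using conformal_covers_ball[of x R "L/2" f "f y"] True \<open>0 < L\<close> by auto
  then have "w = y" using inj V[OF \<open>x \<in> S\<close>] xy by (meson inj_onD subsetD)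
  then have "L / 2 * dist x y \<le> dist (f x) (f y)" using w by (simp add: dist_commute)
  moreover have "L * (R / (2 * D)) * dist x y \<le> L / 2 * dist x y"
    using assms by (intro mult_right_mono) (auto simp: field_simps)
  ultimately show ?thesis by linarith
next
  case False
  have "L * (R / (2 * D)) * dist x y \<le> L * (R / (2 * D)) * D"
    using assms by (intro mult_left_mono) auto
  also have "\<dots> = L / 2 * R" using assms by (simp add: field_simps)
  finally show ?thesis using False by linarith
qed

subsection \<open>Hausdorff measure and dimension\<close>

text \<open>The form used for upper bounds: finite covers over any index type, with
  \<open>d i\<close> any upper bound for the diameter. One number \<open>e\<close> controls both the
  mesh and the sum.\<close>

lemma hausdorff_measure_eq_0I:
  fixes A :: "'a::metric_space set"
  assumes s: "0 < s"
    and cov: "\<And>e. 0 < e \<Longrightarrow> \<exists>(T::'b set) C d. finite T \<and> A \<subseteq> (\<Union>i\<in>T. C i) \<and>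
      (\<forall>i\<in>T. bounded (C i) \<and> diameter (C i) \<le> d i \<and> d i \<le> e) \<and> (\<Sum>i\<in>T. d i powr s) \<le> e"
  shows "hausdorff_measure s A = 0"
proof -
  have "hausdorff_premeasure \<delta> s A \<le> 0" if "0 < \<delta>" for \<delta>
  proof (rule ennreal_le_epsilon)
    fix e :: real assume "0 < e"
    then have "0 < min e \<delta>" using that by simp
    from cov[OF this] obtain T :: "'b set" and C d where T: "finite T" "A \<subseteq> (\<Union>i\<in>T. C i)"
      "\<And>i. i \<in> T \<Longrightarrow> bounded (C i) \<and> diameter (C i) \<le> d i \<and> d i \<le> min e \<delta>"
      "(\<Sum>i\<in>T. d i powr s) \<le> min e \<delta>" by blast
    obtain g where g: "bij_betw g {0..<card T} T"
      using ex_bij_betw_nat_finite[OF T(1)] by blast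
    \<comment> \<open>Padding the finite cover to a sequence is free, because
      \<open>hausdorff_gauge\<close> vanishes on \<open>{}\<close>.\<close>
    define C' where "C' n = (if n < card T then C (g n) else {})" for n
    have gT: "g n \<in> T" if "n < card T" for n using g that by (auto simp: bij_betw_def)
    have "hausdorff_premeasure \<delta> s A \<le> (\<Sum>n. hausdorff_gauge s (C' n))"
      unfolding hausdorff_premeasure_def
    proof (rule INF_lower, safe)
      fix x assume "x \<in> A"
      then obtain i where i: "i \<in> T" "x \<in> C i" using T(2) by blast
      then obtain n where "n < card T" "g n = i" using g by (force simp: bij_betw_def)
      then show "x \<in> (\<Union>n. C' n)" using i by (auto simp: C'_def)
    next
      fix n show "bounded (C' n)" "diameter (C' n) \<le> \<delta>"
        using T(3)[OF gT, of n] \<open>0 < \<delta>\<close> by (cases "n < card T"; force simp: C'_def)+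
    qed
    also have "\<dots> = (\<Sum>n<card T. hausdorff_gauge s (C' n))"
      by (rule suminf_finite) (auto simp: C'_def hausdorff_gauge_def)
    also have "\<dots> \<le> (\<Sum>n<card T. ennreal (d (g n) powr s))"
    proof (rule sum_mono)
      fix n assume "n \<in> {..<card T}"
      then have n: "bounded (C (g n))" "diameter (C (g n)) \<le> d (g n)" "n < card T"
        using T(3)[OF gT] by auto
      have "diameter (C (g n)) powr s \<le> d (g n) powr s"
        using n s diameter_ge_0[OF n(1)] by (intro powr_mono2) auto
      then show "hausdorff_gauge s (C' n) \<le> ennreal (d (g n) powr s)"
        using n s by (auto simp: C'_def hausdorff_gauge_def intro: ennreal_leI)
    qed
    also have "\<dots> = ennreal (\<Sum>n<card T. d (g n) powr s)" by (rule sum_ennreal) auto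
    also have "(\<Sum>n<card T. d (g n) powr s) = (\<Sum>i\<in>T. d i powr s)"
      using sum.reindex_bij_betw[OF g] by (simp add: atLeast0LessThan)
    also have "\<dots> \<le> e" using T(4) by simp
    finally show "hausdorff_premeasure \<delta> s A \<le> 0 + ennreal e" by (simp add: ennreal_leI)
  qed
  then show ?thesis
    unfolding hausdorff_measure_def by (auto simp: SUP_eq_iff intro!: antisym SUP_least)
qed

lemma hausdorff_premeasure_le_measure:
  "0 < \<delta> \<Longrightarrow> hausdorff_premeasure \<delta> s A \<le> hausdorff_measure s A"
  unfolding hausdorff_measure_def by (rule SUP_upper) simp

text \<open>A power of a diameter decreases in the exponent only for diameters up to 1, hence
  \<open>\<delta> \<le> 1\<close>.\<close>

lemma hausdorff_premeasure_mono_exponent: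
  assumes "0 \<le> s" "s < s'" "\<delta> \<le> 1"
  shows "hausdorff_premeasure \<delta> s' A \<le> hausdorff_premeasure \<delta> s A"
  unfolding hausdorff_premeasure_def
proof (rule INF_mono)
  fix C :: "nat \<Rightarrow> 'a set"
  assume C: "C \<in> {C. A \<subseteq> (\<Union>i. C i) \<and> (\<forall>i. bounded (C i) \<and> diameter (C i) \<le> \<delta>)}"
  have "hausdorff_gauge s' (C i) \<le> hausdorff_gauge s (C i)" for i
  proof -
    have d: "0 \<le> diameter (C i)" "diameter (C i) \<le> 1"
      using C assms diameter_ge_0[of "C i"] by (auto intro: order_trans)
    show ?thesis
    \<comment> \<open>At exponent 0 the gauge of a nonempty set is 1 by definition, also for a
      single point, where \<open>powr\<close> would give 0.\<close>
    proof (cases "s = 0")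
      case True
      have "diameter (C i) powr s' \<le> 1"
        using d assms by (intro powr_le1) auto
      then show ?thesis using True assms by (auto simp: hausdorff_gauge_def ennreal_le_1)
    next
      case False
      have "diameter (C i) powr s' \<le> diameter (C i) powr s"
        using d assms by (intro powr_mono') auto
      then show ?thesis using False assms by (auto simp: hausdorff_gauge_def intro: ennreal_leI)
    qed
  qed
  then have "(\<Sum>i. hausdorff_gauge s' (C i)) \<le> (\<Sum>i. hausdorff_gauge s (C i))"
    by (intro suminf_le) auto
  with C show "\<exists>D\<in>{C. A \<subseteq> (\<Union>i. C i) \<and> (\<forall>i. bounded (C i) \<and> diameter (C i) \<le> \<delta>)}.
      (\<Sum>i. hausdorff_gauge s' (D i)) \<le> (\<Sum>i. hausdorff_gauge s (C i))"
    by blast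
qed

lemma hausdorff_premeasure_antimono:
  "\<delta> \<le> \<delta>' \<Longrightarrow> hausdorff_premeasure \<delta>' s A \<le> hausdorff_premeasure \<delta> s A"
  unfolding hausdorff_premeasure_def by (rule INF_superset_mono) (auto intro: order_trans)

lemma hausdorff_measure_eq_0_mono:
  assumes "hausdorff_measure s A = 0" "0 \<le> s" "s < s'"
  shows "hausdorff_measure s' A = 0"
proof -
  have "hausdorff_premeasure \<delta> s' A \<le> 0" if "0 < \<delta>" for \<delta>
  proof -
    have "hausdorff_premeasure \<delta> s' A \<le> hausdorff_premeasure (min \<delta> 1) s' A"
      by (rule hausdorff_premeasure_antimono) simp
    also have "\<dots> \<le> hausdorff_premeasure (min \<delta> 1) s A"
      using assms by (intro hausdorff_premeasure_mono_exponent) auto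
    also have "\<dots> \<le> hausdorff_measure s A"
      using that by (intro hausdorff_premeasure_le_measure) auto
    finally show ?thesis using assms by simp
  qed
  then have "hausdorff_measure s' A \<le> 0"
    unfolding hausdorff_measure_def by (intro SUP_least) auto
  then show ?thesis by simp
qed

text \<open>Rational exponents suffice, because they are dense and vanishing of the measure passes
  to larger exponents. Their countability later allows the exceptional null sets to be united over
  \<open>q\<close>.\<close>

lemma le_hausdorff_dimI:
  assumes pos: "\<And>q. q \<in> \<rat> \<Longrightarrow> 0 < q \<Longrightarrow> ennreal q < b \<Longrightarrow> hausdorff_measure q A > 0"
  shows "b \<le> hausdorff_dim A"
proof (rule ccontr)
  assume "\<not> ?thesis"
  then obtain s where s: "0 \<le> s" "hausdorff_measure s A = 0" "ennreal s < b"
    unfolding hausdorff_dim_def not_le Inf_less_iff by blast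
  obtain c where c: "ennreal s < c" "c < b" using s(3) by (meson dense)
  then obtain r where r: "c = ennreal r" "0 \<le> r" by (cases c) auto
  have "s < r" using c(1) r s(1) by (simp add: ennreal_less_iff)
  then obtain q where q: "q \<in> \<rat>" "s < q" "q < r" using Rats_dense_in_real by blast
  have "ennreal q < b" using q(3) r c(2) by (metis ennreal_leI less_imp_le order_le_less_trans)
  then have "hausdorff_measure q A > 0" using pos q s(1) by auto
  then show False using hausdorff_measure_eq_0_mono[OF s(2,1) q(2)] by simp
qed

lemma hausdorff_dim_leI:
  assumes "\<And>s. b < ennreal s \<Longrightarrow> 0 < s \<Longrightarrow> hausdorff_measure s A = 0"
  shows "hausdorff_dim A \<le> b"
proof (rule ccontr)
  assume "\<not> ?thesis"
  then obtain c where c: "b < c" "c < hausdorff_dim A" by (meson dense not_le)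
  then obtain s where s: "c = ennreal s" "0 \<le> s" by (cases c) auto
  have "0 < c" using c(1) by (metis gr_zeroI not_less_zero)
  then have "0 < s" using s by simp
  then have "hausdorff_measure s A = 0" using assms c s by blast
  then have "hausdorff_dim A \<le> ennreal s"
    unfolding hausdorff_dim_def using s by (intro Inf_lower) auto
  then show False using c s by simp
qed

text \<open>A grid of \<open>N ^ ?m\<close> cells of diameter at most \<open>c / N\<close> has an
  \<open>s\<close>-sum of order \<open>N powr (?m - s)\<close>, which tends to 0.\<close>

lemma hausdorff_measure_bounded_eq_0:
  fixes A :: "(real^'n) set"
  assumes A: "bounded A" and s: "real CARD('n) < s"
  shows "hausdorff_measure s A = 0"
proof (rule hausdorff_measure_eq_0I)
  show "0 < s" using s by (smt (verit) of_nat_0_le_iff)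
  fix e :: real assume e: "0 < e"
  let ?m = "CARD('n)"
  obtain L where L: "L > 0" "\<And>x. x \<in> A \<Longrightarrow> norm x \<le> L"
    using A by (metis bounded_pos)
  \<comment> \<open>Cells have side \<open>4 * L / N\<close>, and the norm is at most the sum of the
    \<open>?m\<close> absolute coordinates. The factor 4 in place of 2 puts the scaled coordinates
    strictly below \<open>N\<close>, so that every index is less than \<open>N\<close>.\<close>
  define c where "c = real ?m * (4 * L)"
  have c: "c > 0" using L by (simp add: c_def)
  have lim: "(\<lambda>N. c powr s * real (Suc N) powr (real ?m - s)) \<longlonglongrightarrow> 0"
    using s by (intro tendsto_mult_right_zero tendsto_neg_powr
        filterlim_compose[OF filterlim_real_sequentially filterlim_Suc]) auto
  have lim2: "(\<lambda>N. c * inverse (real (Suc N))) \<longlonglongrightarrow> 0"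
    by (intro tendsto_mult_right_zero LIMSEQ_inverse_real_of_nat)
  obtain N' where N': "c powr s * real (Suc N') powr (real ?m - s) < e"
      "c * inverse (real (Suc N')) < e"
    using eventually_happens[OF eventually_conj[OF order_tendstoD(2)[OF lim e] order_tendstoD(2)[OF lim2 e]]]
    by auto
  define N where "N = Suc N'"
  have N: "N > 0" "c powr s * real N powr (real ?m - s) < e" "c / real N < e"
    using N' by (auto simp: N_def divide_inverse)
  define T :: "('n \<Rightarrow> nat) set" where "T = (\<Pi>\<^sub>E i\<in>UNIV. {..<N})"
  define C where "C f = {x::real^'n. \<forall>i. real (f i) \<le> (x $ i + L) * N / (4 * L) \<and>
      (x $ i + L) * N / (4 * L) < real (f i) + 1}" for f
  have "finite T" unfolding T_def by (intro finite_PiE) auto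
  moreover have "A \<subseteq> (\<Union>f\<in>T. C f)"
  proof
    fix x assume "x \<in> A"
    then have x: "\<bar>x $ i\<bar> \<le> L" for i
      using L(2) component_le_norm_cart[of x i] by (meson order_trans)
    define f where "f i = nat \<lfloor>(x $ i + L) * N / (4 * L)\<rfloor>" for i
    have nn: "0 \<le> (x $ i + L) * N / (4 * L)" for i
      using x[of i] L(1) by (intro divide_nonneg_pos mult_nonneg_nonneg) auto
    have le: "(x $ i + L) * N / (4 * L) < N" for i
    proof -
      have "(x $ i + L) * N < (4 * L) * N"
        using x[of i] L(1) N(1) by (intro mult_strict_right_mono) auto
      then show ?thesis using L(1) by (simp add: field_simps)
    qed
    have eq: "real (f i) = of_int \<lfloor>(x $ i + L) * N / (4 * L)\<rfloor>" for i
      using nn[of i] by (simp add: f_def)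
    have fl: "real (f i) \<le> (x $ i + L) * N / (4 * L)" "(x $ i + L) * N / (4 * L) < real (f i) + 1" for i
      unfolding eq by linarith+
    have "f i < N" for i using fl(1)[of i] le[of i] by simp
    then have "f \<in> T" by (auto simp: T_def)
    moreover have "x \<in> C f" using fl by (auto simp: C_def)
    ultimately show "x \<in> (\<Union>f\<in>T. C f)" by blast
  qed
  moreover have diam: "dist x y \<le> c / N" if "x \<in> C f" "y \<in> C f" for f x y
  proof -
    have "\<bar>(x - y) $ i\<bar> \<le> 4 * L / N" for i
    proof -
      have "real (f i) \<le> (x $ i + L) * N / (4 * L)" "(x $ i + L) * N / (4 * L) < real (f i) + 1"
        "real (f i) \<le> (y $ i + L) * N / (4 * L)" "(y $ i + L) * N / (4 * L) < real (f i) + 1"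
        using that by (auto simp: C_def)
      then have "\<bar>(x $ i + L) * N / (4 * L) - (y $ i + L) * N / (4 * L)\<bar> \<le> 1" by linarith
      also have "(x $ i + L) * N / (4 * L) - (y $ i + L) * N / (4 * L) = (x - y) $ i * (N / (4 * L))"
        using L(1) by (simp add: field_simps)
      finally have "\<bar>(x - y) $ i\<bar> * (N / (4 * L)) \<le> 1"
        using L(1) by (simp only: abs_mult) simp
      then show ?thesis using L(1) N(1) by (simp add: field_simps del: vector_minus_component)
    qed
    then have "(\<Sum>i\<in>UNIV. \<bar>(x - y) $ i\<bar>) \<le> (\<Sum>i\<in>(UNIV::'n set). 4 * L / N)" by (intro sum_mono) auto
    then show ?thesis using norm_le_l1_cart[of "x - y"] by (simp add: dist_norm c_def)
  qed
  moreover have "bounded (C f)" for f using diam bounded_two_points by blast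
  moreover have "diameter (C f) \<le> c / N" for f
    using diam c by (intro diameter_le) (auto simp: dist_norm)
  moreover have "(\<Sum>f\<in>T. (c / N) powr s) \<le> e"
  proof -
    have "(\<Sum>f\<in>T. (c / N) powr s) = real N ^ ?m * (c / N) powr s"
      by (simp add: T_def card_PiE)
    also have "\<dots> = c powr s * real N powr (real ?m - s)"
      using c N(1) by (simp add: powr_divide powr_diff powr_realpow)
    finally show ?thesis using N by simp
  qed
  ultimately show "\<exists>(T::('n \<Rightarrow> nat) set) C d. finite T \<and> A \<subseteq> (\<Union>i\<in>T. C i) \<and>
      (\<forall>i\<in>T. bounded (C i) \<and> diameter (C i) \<le> d i \<and> d i \<le> e) \<and> (\<Sum>i\<in>T. d i powr s) \<le> e"
    using N by (intro exI[of _ T] exI[of _ C] exI[of _ "\<lambda>_. c / N"]) auto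
qed

subsection \<open>Finite weighted configurations\<close>

text \<open>A mass distribution principle for finitely many weighted points. By Markov's inequality
  half of the mass sits at points of potential at most \<open>2 * M\<close>. Around such a point the
  ball of radius \<open>\<gamma> ^ k\<close> has mass at most
  \<open>2 * M * (\<gamma> ^ k) powr s\<close> for \<open>k \<le> N\<close>, and a covering set
  meeting these points lies in a ball of comparable radius. The condition
  \<open>\<gamma> ^ N < d i\<close> makes that radius one of the available scales.\<close>

lemma finite_energy_cover_bound:
  fixes x :: "'w \<Rightarrow> 'a::metric_space" and \<mu> :: "'w \<Rightarrow> real"
  assumes s: "0 < s" and g: "0 < \<gamma>" "\<gamma> < 1" and M: "0 < M"
    and W: "finite W" "\<And>u. u \<in> W \<Longrightarrow> 0 \<le> \<mu> u" "sum \<mu> W = 1"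
    and E: "(\<Sum>k\<le>N. (\<gamma> ^ k) powr (- s) * (\<Sum>u\<in>W. \<Sum>v\<in>W. \<mu> u * \<mu> v * of_bool (dist (x u) (x v) \<le> \<gamma> ^ k))) \<le> M"
    and D: "finite D" "x ` W \<subseteq> (\<Union>i\<in>D. B i)" "\<And>i. i \<in> D \<Longrightarrow> \<gamma> ^ N < d i"
    and d: "\<And>i y z. i \<in> D \<Longrightarrow> y \<in> B i \<Longrightarrow> z \<in> B i \<Longrightarrow> dist y z \<le> d i"
  shows "1 / 2 \<le> max 1 (2 * M * \<gamma> powr (- s)) * (\<Sum>i\<in>D. d i powr s)"
proof -
  \<comment> \<open>The value 1 serves sets with \<open>d i \<ge> 1\<close>, where total mass 1
    suffices; the factor \<open>\<gamma> powr (- s)\<close> is the loss from rounding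
    \<open>d i\<close> up to a power of \<open>\<gamma>\<close>.\<close>
  define L where "L = max 1 (2 * M * \<gamma> powr (- s))"
  \<comment> \<open>\<open>m k u\<close> is the mass within distance \<open>\<gamma> ^ k\<close> of
    \<open>x u\<close>, and \<open>P u\<close> is a discrete potential truncated at scale
    \<open>\<gamma> ^ N\<close>.\<close>
  define m where "m k u = (\<Sum>v\<in>W. \<mu> v * of_bool (dist (x u) (x v) \<le> \<gamma> ^ k))" for k u
  define P where "P u = (\<Sum>k\<le>N. (\<gamma> ^ k) powr (- s) * m k u)" for u
  have m_nonneg: "0 \<le> m k u" for k u unfolding m_def using W by (intro sum_nonneg) auto
  have P_nonneg: "0 \<le> P u" for u unfolding P_def using m_nonneg by (intro sum_nonneg) auto
  have "(\<Sum>u\<in>W. \<mu> u * P u) =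
      (\<Sum>u\<in>W. \<Sum>k\<le>N. (\<gamma> ^ k) powr (- s) * (\<mu> u * m k u))"
    by (simp add: P_def sum_distrib_left mult_ac)
  also have "\<dots> = (\<Sum>k\<le>N. (\<gamma> ^ k) powr (- s) * (\<Sum>u\<in>W. \<mu> u * m k u))"
    by (subst sum.swap) (simp add: sum_distrib_left)
  also have "\<dots> \<le> M" using E by (simp add: m_def sum_distrib_left mult_ac)
  finally have PM: "(\<Sum>u\<in>W. \<mu> u * P u) \<le> M" .
  define A where "A = {u\<in>W. P u \<le> 2 * M}"
  have "2 * M * sum \<mu> (W - A) \<le> (\<Sum>u\<in>W - A. \<mu> u * P u)"
    unfolding sum_distrib_left
  proof (rule sum_mono)
    fix u assume "u \<in> W - A"
    then have "\<mu> u * (2 * M) \<le> \<mu> u * P u" using W by (intro mult_left_mono) (auto simp: A_def)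
    then show "2 * M * \<mu> u \<le> \<mu> u * P u" by (simp add: mult_ac)
  qed
  also have "\<dots> \<le> (\<Sum>u\<in>W. \<mu> u * P u)"
    using W P_nonneg by (intro sum_mono2) auto
  finally have "M * (2 * sum \<mu> (W - A)) \<le> M * 1" using PM by simp
  then have "sum \<mu> (W - A) \<le> 1 / 2" using M by (subst (asm) mult_le_cancel_left_pos) auto
  moreover have "sum \<mu> W = sum \<mu> A + sum \<mu> (W - A)"
    using W(1) by (subst sum.subset_diff[of A]) (auto simp: A_def)
  ultimately have "1 / 2 \<le> sum \<mu> A" using W(3) by simp
  also have "\<dots> \<le> (\<Sum>u\<in>A. \<Sum>i\<in>D. \<mu> u * of_bool (x u \<in> B i))"
  proof (rule sum_mono)
    fix u assume "u \<in> A"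
    then have u: "u \<in> W" by (simp add: A_def)
    then obtain i where i: "i \<in> D" "x u \<in> B i" using D(2) by blast
    have "\<mu> u = (\<Sum>j\<in>{i}. \<mu> u * of_bool (x u \<in> B j))" using i by simp
    also have "\<dots> \<le> (\<Sum>i\<in>D. \<mu> u * of_bool (x u \<in> B i))"
      using i D(1) W(2)[OF u] by (intro sum_mono2) auto
    finally show "\<mu> u \<le> (\<Sum>i\<in>D. \<mu> u * of_bool (x u \<in> B i))" .
  qed
  also have "\<dots> = (\<Sum>i\<in>D. \<Sum>u\<in>A. \<mu> u * of_bool (x u \<in> B i))" by (rule sum.swap)
  also have "\<dots> \<le> (\<Sum>i\<in>D. L * d i powr s)"
  proof (rule sum_mono)
    fix i assume i: "i \<in> D"
    show "(\<Sum>u\<in>A. \<mu> u * of_bool (x u \<in> B i)) \<le> L * d i powr s"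
    proof (cases "\<exists>u\<in>A. x u \<in> B i")
      case False
      then have "(\<Sum>u\<in>A. \<mu> u * of_bool (x u \<in> B i)) = 0" by (intro sum.neutral) auto
      then show ?thesis by (simp add: L_def)
    next
      case True
      then obtain u0 where u0: "u0 \<in> A" "x u0 \<in> B i" by blast
      show ?thesis
      proof (cases "1 \<le> d i")
        case True
        have "(\<Sum>u\<in>A. \<mu> u * of_bool (x u \<in> B i)) \<le> sum \<mu> A"
          using W(2) by (intro sum_mono) (auto simp: A_def)
        also have "\<dots> \<le> sum \<mu> W" using W by (intro sum_mono2) (auto simp: A_def)
        also have "\<dots> \<le> d i powr s" using W(3) True s by (simp add: ge_one_powr_ge_zero)
        also have "\<dots> \<le> L * d i powr s" by (simp add: L_def mult_le_cancel_right1)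
        finally show ?thesis .
      next
        case False
        \<comment> \<open>The first scale below \<open>d i\<close>, so
          \<open>\<gamma> ^ j < d i \<le> \<gamma> ^ (j - 1)\<close>; here \<open>j > 0\<close>
          because \<open>d i < 1\<close>.\<close>
        define j where "j = (LEAST j. \<gamma> ^ j < d i)"
        have j: "\<gamma> ^ j < d i" "j \<le> N"
          unfolding j_def using D(3)[OF i] by (auto intro: LeastI Least_le)
        have "j \<noteq> 0" using j(1) False by (intro notI) simp
        then obtain k where k: "j = Suc k" by (cases j) auto
        have dk: "d i \<le> \<gamma> ^ k"
          using not_less_Least[of k "\<lambda>j. \<gamma> ^ j < d i"] k by (simp add: j_def)
        have "(\<Sum>u\<in>A. \<mu> u * of_bool (x u \<in> B i)) \<le> (\<Sum>u\<in>A. \<mu> u * of_bool (dist (x u0) (x u) \<le> \<gamma> ^ k))"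
        proof (rule sum_mono)
          fix u assume "u \<in> A"
          then show "\<mu> u * of_bool (x u \<in> B i) \<le> \<mu> u * of_bool (dist (x u0) (x u) \<le> \<gamma> ^ k)"
            using W(2) d[OF i u0(2), of "x u"] dk by (auto simp: A_def)
        qed
        also have "\<dots> \<le> m k u0"
          unfolding m_def using W by (intro sum_mono2) (auto simp: A_def)
        also have "\<dots> = (\<gamma> ^ k) powr s * ((\<gamma> ^ k) powr (- s) * m k u0)"
          using g by (simp add: powr_minus)
        also have "\<dots> \<le> (\<gamma> ^ k) powr s * (2 * M)"
        proof (rule mult_left_mono)
          have "(\<gamma> ^ k) powr (- s) * m k u0 \<le> P u0"
            unfolding P_def using j k m_nonneg by (intro member_le_sum) auto
          then show "(\<gamma> ^ k) powr (- s) * m k u0 \<le> 2 * M" using u0 by (simp add: A_def)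
        qed simp
        also have "(\<gamma> ^ k) powr s * (2 * M) = 2 * M * \<gamma> powr (- s) * (\<gamma> ^ j) powr s"
          using g by (simp add: k powr_mult powr_minus)
        also have "\<dots> \<le> L * (\<gamma> ^ j) powr s"
          by (intro mult_right_mono) (auto simp: L_def)
        also have "\<dots> \<le> L * d i powr s"
          using j g s by (intro mult_left_mono powr_mono2) (auto simp: L_def)
        finally show ?thesis by simp
      qed
    qed
  qed
  finally show ?thesis by (simp add: L_def sum_distrib_left)
qed

text \<open>Finite configurations only see scales down to \<open>\<gamma> ^ N\<close>, while a
  countable cover may contain arbitrarily small sets. Enlarging the sets slightly to open ones and
  using compactness of \<open>J\<close> leaves finitely many, whose sizes exceed
  \<open>\<gamma> ^ N\<close> for large \<open>N\<close>.\<close>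

lemma hausdorff_measure_pos_if_finite_energies:
  fixes J :: "'a::metric_space set"
  assumes J: "compact J" and s: "0 < s" and g: "0 < \<gamma>" "\<gamma> < 1" and M: "0 < M"
    and conf: "\<And>N0. \<exists>N\<ge>N0. \<exists>(W::'w set) \<mu> x. finite W \<and> (\<forall>u\<in>W. 0 \<le> \<mu> u) \<and> sum \<mu> W = 1 \<and> x ` W \<subseteq> J \<and>
      (\<Sum>k\<le>N. (\<gamma> ^ k) powr (- s) * (\<Sum>u\<in>W. \<Sum>v\<in>W. \<mu> u * \<mu> v * of_bool (dist (x u) (x v) \<le> \<gamma> ^ k))) \<le> M"
  shows "0 < hausdorff_measure s J"
proof -
  define L where "L = max 1 (2 * M * \<gamma> powr (- s))"
  have L: "L > 0" by (simp add: L_def)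
  have "ennreal (1 / (4 * L)) \<le> hausdorff_premeasure 1 s J"
    unfolding hausdorff_premeasure_def
  proof (rule INF_greatest, rule ccontr)
    fix C :: "nat \<Rightarrow> 'a set"
    assume C: "C \<in> {C. J \<subseteq> (\<Union>i. C i) \<and> (\<forall>i. bounded (C i) \<and> diameter (C i) \<le> 1)}"
      and "\<not> ennreal (1 / (4 * L)) \<le> (\<Sum>i. hausdorff_gauge s (C i))"
    then have small: "(\<Sum>i. hausdorff_gauge s (C i)) < ennreal (1 / (4 * L))" by simp
    have gauge: "hausdorff_gauge s (C i) = ennreal (diameter (C i) powr s)" for i
      using s by (auto simp: hausdorff_gauge_def)
    have diam: "0 \<le> diameter (C i)" for i using C diameter_ge_0 by blast
    \<comment> \<open>The enlargements cost \<open>1 / (8 * L)\<close> in total, so the covering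
      bound would give \<open>1 / 2 \<le> L * (1 / (4 * L) + 1 / (8 * L)) = 3 / 8\<close>.\<close>
    define e where "e i = 1 / (8 * L) * (1 / 2) ^ Suc i" for i
    have e: "e i > 0" for i using L by (simp add: e_def)
    \<comment> \<open>Chosen so that \<open>d i powr s\<close> exceeds the gauge by exactly
      \<open>e i\<close>; thus \<open>d i\<close> is strictly above the diameter even when that is
      0.\<close>
    define d where "d i = (diameter (C i) powr s + e i) powr (1 / s)" for i
    have ds: "d i powr s = diameter (C i) powr s + e i" for i
      using s e[of i] by (simp add: d_def powr_powr add_nonneg_pos less_imp_le)
    have dpos: "0 < d i" for i unfolding d_def using e[of i] powr_ge_zero[of "diameter (C i)" s]
      by (smt (verit) powr_gt_zero)
    have dd: "diameter (C i) < d i" for i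
      using ds[of i] e[of i] dpos[of i] diam[of i] s
      by (smt (verit) powr_mono2)
    define B where "B i = (\<Union>y\<in>C i. ball y ((d i - diameter (C i)) / 2))" for i
    have dB: "dist y z \<le> d i" if yz: "y \<in> B i" "z \<in> B i" for i y z
    proof -
      obtain y' z' where *: "y' \<in> C i" "dist y' y < (d i - diameter (C i)) / 2"
        "z' \<in> C i" "dist z' z < (d i - diameter (C i)) / 2"
        using yz by (auto simp: B_def)
      have "dist y' z' \<le> diameter (C i)" using C * by (intro diameter_bounded_bound) auto
      moreover have "dist y z \<le> dist y' y + dist y' z' + dist z' z"
        by (smt (verit) dist_commute dist_triangle)
      ultimately show ?thesis using * by (simp add: field_simps)
    qed
    have "J \<subseteq> (\<Union>i\<in>UNIV. B i)"
    proof
      fix y assume "y \<in> J"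
      then obtain i where "y \<in> C i" using C by blast
      then have "y \<in> B i" using dd[of i] by (force simp: B_def)
      then show "y \<in> (\<Union>i\<in>UNIV. B i)" by blast
    qed
    moreover have "open (B i)" for i by (auto simp: B_def)
    ultimately obtain D where D: "finite D" "J \<subseteq> (\<Union>i\<in>D. B i)"
      using compactE_image[OF J, of UNIV B] by (metis subset_UNIV)
    \<comment> \<open>The inserted 1 keeps \<open>Min\<close> meaningful if \<open>D\<close> is
      empty.\<close>
    define dm where "dm = Min (insert 1 (d ` D))"
    have dm: "dm > 0" "\<And>i. i \<in> D \<Longrightarrow> dm \<le> d i" using D(1) dpos by (auto simp: dm_def)
    obtain N0 where N0: "\<gamma> ^ N0 < dm" using real_arch_pow_inv[OF dm(1) g(2)] by blast
    from conf[of N0] obtain N and W :: "'w set" and \<mu> x where N: "N \<ge> N0" and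
      W: "finite W" "\<And>u. u \<in> W \<Longrightarrow> 0 \<le> \<mu> u" "sum \<mu> W = 1" "x ` W \<subseteq> J" and
      E: "(\<Sum>k\<le>N. (\<gamma> ^ k) powr (- s) * (\<Sum>u\<in>W. \<Sum>v\<in>W. \<mu> u * \<mu> v * of_bool (dist (x u) (x v) \<le> \<gamma> ^ k))) \<le> M"
      by blast
    have "\<gamma> ^ N < d i" if "i \<in> D" for i
      using power_decreasing[OF N, of \<gamma>] g N0 dm(2)[OF that] by linarith
    then have "1 / 2 \<le> L * (\<Sum>i\<in>D. d i powr s)"
      unfolding L_def using W D E dB by (intro finite_energy_cover_bound[OF s g M W(1-3) E D(1)]) auto
    also have "(\<Sum>i\<in>D. d i powr s) = (\<Sum>i\<in>D. diameter (C i) powr s) + sum e D"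
      by (simp add: ds sum.distrib)
    also have "(\<Sum>i\<in>D. diameter (C i) powr s) \<le> 1 / (4 * L)"
    proof -
      have "ennreal (\<Sum>i\<in>D. diameter (C i) powr s) = (\<Sum>i\<in>D. hausdorff_gauge s (C i))"
        by (simp add: gauge sum_ennreal)
      also have "\<dots> \<le> (\<Sum>i. hausdorff_gauge s (C i))" using D(1) by (intro sum_le_suminf) auto
      also have "\<dots> \<le> ennreal (1 / (4 * L))" using small by (rule less_imp_le)
      finally show ?thesis using L by (subst (asm) ennreal_le_iff) auto
    qed
    also have "sum e D \<le> (\<Sum>i. e i)"
      using D(1) e unfolding e_def
      by (intro sum_le_suminf) (auto intro!: summable_mult power_half_series[THEN sums_summable] simp: e_def less_imp_le simp del: power_Suc)
    also have "(\<Sum>i. e i) = 1 / (8 * L)"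
      unfolding e_def using power_half_series by (subst suminf_mult) (auto dest: sums_unique sums_summable simp del: power_Suc)
    finally show False using L by (simp add: field_simps)
  qed
  also have "\<dots> \<le> hausdorff_measure s J" unfolding hausdorff_measure_def by (rule SUP_upper) simp
  finally show ?thesis using L by (smt (verit) divide_pos_pos ennreal_less_zero_iff order_less_le_trans mult_pos_pos)
qed

text \<open>With \<open>f = (\<Sum>u\<in>W. \<mu> u * indicator (ball (x u) (r / 2)))\<close>, supported in a small
  neighbourhood \<open>T\<close> of \<open>J\<close>, the bound comes from integrating \<open>0 \<le> (f - M r\<^sup>n)\<^sup>2\<close> over \<open>T\<close>.\<close>

lemma emeasure_pos_if_finite_energies:
  fixes J :: "'a::euclidean_space set"
  assumes J: "compact J" and M: "0 < M"
    and conf: "\<And>e. 0 < e \<Longrightarrow> \<exists>r>0. r < e \<and> (\<exists>(W::'w set) \<mu> x. finite W \<and> (\<forall>u\<in>W. 0 \<le> \<mu> u) \<and> sum \<mu> W = 1 \<and> x ` W \<subseteq> J \<and>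
      (\<Sum>u\<in>W. \<Sum>v\<in>W. \<mu> u * \<mu> v * of_bool (dist (x u) (x v) \<le> r)) \<le> M * r ^ DIM('a))"
  shows "0 < emeasure lebesgue J"
proof (rule ccontr)
  assume "\<not> ?thesis"
  moreover have Jm: "J \<in> lmeasurable" using J by (rule lmeasurable_compact)
  ultimately have J0: "measure lebesgue J = 0" by (simp add: measure_def)
  let ?n = "DIM('a)"
  \<comment> \<open>A ball of radius \<open>r / 2\<close> has volume
    \<open>c * r ^ ?n\<close>.\<close>
  define c where "c = unit_ball_vol (real ?n) / 2 ^ ?n"
  have c: "c > 0" by (simp add: c_def)
  \<comment> \<open>If \<open>J\<close> were null, it would have an open neighbourhood of measure
    below \<open>c / M\<close>, whereas the integral inequality ends in
    \<open>c \<le> M * measure lebesgue T\<close>.\<close>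
  obtain T where T: "open T" "J \<subseteq> T" "T \<in> lmeasurable" "measure lebesgue T < c / M"
  proof -
    obtain T where T: "open T" "J \<subseteq> T" "T - J \<in> lmeasurable" "emeasure lebesgue (T - J) < ennreal (c / M)"
      using sets_lebesgue_outer_open[of J "c / M"] Jm c M by auto
    have eq: "T = J \<union> (T - J)" using T(2) by blast
    have "T \<in> lmeasurable" by (subst eq) (intro fmeasurable.Un Jm T(3))
    moreover have "measure lebesgue T \<le> measure lebesgue J + measure lebesgue (T - J)"
      using Jm T(3) by (subst eq, intro measure_Un_le) auto
    moreover have "measure lebesgue (T - J) < c / M"
      using T(3,4) c M by (simp add: emeasure_eq_measure2 ennreal_less_iff)
    ultimately show ?thesis using that T(1,2) J0 by simp
  qed
  obtain e where e: "e > 0" "(\<Union>x\<in>J. ball x e) \<subseteq> T"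
    using compact_subset_open_imp_ball_epsilon_subset[OF J T(1,2)] by blast
  from conf[OF e(1)] obtain r and W :: "'w set" and \<mu> x where r: "0 < r" "r < e" and
    W: "finite W" "\<And>u. u \<in> W \<Longrightarrow> 0 \<le> \<mu> u" "sum \<mu> W = 1" "x ` W \<subseteq> J" and
    E: "(\<Sum>u\<in>W. \<Sum>v\<in>W. \<mu> u * \<mu> v * of_bool (dist (x u) (x v) \<le> r)) \<le> M * r ^ ?n"
    by blast
  define B where "B u = ball (x u) (r / 2)" for u
  have B: "B u \<in> lmeasurable" "measure lebesgue (B u) = c * r ^ ?n" for u
    using r content_ball[of "r / 2" "x u"] by (simp_all add: B_def c_def power_divide)
  have BT: "B u \<subseteq> T" if "u \<in> W" for u
    using e(2) r W(4) that by (fastforce simp: B_def)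
  define f where "f y = (\<Sum>u\<in>W. \<mu> u * indicat_real (B u) y)" for y
  define l where "l = M * r ^ ?n"
  have l: "l > 0" using M r by (simp add: l_def)
  have ind: "has_bochner_integral lebesgue (indicat_real A) (measure lebesgue A)"
    if "A \<in> lmeasurable" for A :: "'a set"
    using that unfolding fmeasurable_def by (blast intro: has_bochner_integral_real_indicator)
  have lhs: "has_bochner_integral lebesgue (\<lambda>y. 2 * l * f y) (2 * l * (\<Sum>u\<in>W. \<mu> u * measure lebesgue (B u)))"
    unfolding f_def by (intro has_bochner_integral_mult_right has_bochner_integral_sum ind B)
  have rhs: "has_bochner_integral lebesgue (\<lambda>y. (\<Sum>u\<in>W. \<Sum>v\<in>W. \<mu> u * \<mu> v * indicat_real (B u \<inter> B v) y) + l\<^sup>2 * indicat_real T y)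
      ((\<Sum>u\<in>W. \<Sum>v\<in>W. \<mu> u * \<mu> v * measure lebesgue (B u \<inter> B v)) + l\<^sup>2 * measure lebesgue T)"
    by (intro has_bochner_integral_add has_bochner_integral_mult_right has_bochner_integral_sum
        ind fmeasurable.Int B T(3))
  have "2 * l * f y \<le> (\<Sum>u\<in>W. \<Sum>v\<in>W. \<mu> u * \<mu> v * indicat_real (B u \<inter> B v) y) + l\<^sup>2 * indicat_real T y" for y
  proof -
    have sq: "(\<Sum>u\<in>W. \<Sum>v\<in>W. \<mu> u * \<mu> v * indicat_real (B u \<inter> B v) y) = (f y)\<^sup>2"
      unfolding f_def power2_eq_square sum_product by (simp add: indicator_inter_arith mult_ac)
    show ?thesis
    proof (cases "y \<in> T")
      case True
      then show ?thesis unfolding sq using sum_squares_bound[of l "f y"] by simp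
    next
      case False
      then have "f y = 0" unfolding f_def using BT by (intro sum.neutral) (auto simp: indicator_def)
      then show ?thesis unfolding sq using False by simp
    qed
  qed
  then have "2 * l * (\<Sum>u\<in>W. \<mu> u * measure lebesgue (B u)) \<le>
      (\<Sum>u\<in>W. \<Sum>v\<in>W. \<mu> u * \<mu> v * measure lebesgue (B u \<inter> B v)) + l\<^sup>2 * measure lebesgue T"
    using integral_mono[of lebesgue "\<lambda>y. 2 * l * f y"] lhs[unfolded has_bochner_integral_iff]
      rhs[unfolded has_bochner_integral_iff] by (metis (no_types, lifting))
  also have "(\<Sum>u\<in>W. \<mu> u * measure lebesgue (B u)) = c * r ^ ?n"
    by (simp add: B(2) flip: sum_distrib_right) (simp add: W(3))
  also have "(\<Sum>u\<in>W. \<Sum>v\<in>W. \<mu> u * \<mu> v * measure lebesgue (B u \<inter> B v)) \<le>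
      (\<Sum>u\<in>W. \<Sum>v\<in>W. \<mu> u * \<mu> v * of_bool (dist (x u) (x v) \<le> r) * (c * r ^ ?n))"
  proof (intro sum_mono)
    fix u v assume uv: "u \<in> W" "v \<in> W"
    \<comment> \<open>Balls of radius \<open>r / 2\<close> meet only if their centres are within
      \<open>r\<close>, so the integral of \<open>f\<close> squared is controlled by the correlation
      sum.\<close>
    have "measure lebesgue (B u \<inter> B v) \<le> of_bool (dist (x u) (x v) \<le> r) * (c * r ^ ?n)"
    proof (cases "dist (x u) (x v) \<le> r")
      case True
      have "measure lebesgue (B u \<inter> B v) \<le> measure lebesgue (B u)"
        using B by (intro measure_mono_fmeasurable) auto
      then show ?thesis using True B(2) by simp
    next
      case False
      have "B u \<inter> B v = {}"
      proof (rule ccontr)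
        assume "B u \<inter> B v \<noteq> {}"
        then obtain y where "dist (x u) y < r / 2" "dist (x v) y < r / 2" by (auto simp: B_def)
        then show False using False dist_triangle2[of "x u" "x v" y] by simp
      qed
      then show ?thesis using False by simp
    qed
    then have "\<mu> u * \<mu> v * measure lebesgue (B u \<inter> B v) \<le> \<mu> u * \<mu> v * (of_bool (dist (x u) (x v) \<le> r) * (c * r ^ ?n))"
      using W(2) uv by (intro mult_left_mono) auto
    then show "\<mu> u * \<mu> v * measure lebesgue (B u \<inter> B v) \<le> \<mu> u * \<mu> v * of_bool (dist (x u) (x v) \<le> r) * (c * r ^ ?n)"
      by (simp only: mult.assoc)
  qed
  also have "\<dots> = (\<Sum>u\<in>W. \<Sum>v\<in>W. \<mu> u * \<mu> v * of_bool (dist (x u) (x v) \<le> r)) * (c * r ^ ?n)"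
    by (simp only: sum_distrib_right)
  also have "\<dots> \<le> l * (c * r ^ ?n)" using E c r by (intro mult_right_mono) (auto simp: l_def)
  finally have "l * (c * r ^ ?n) \<le> l * (l * measure lebesgue T)" by (simp add: power2_eq_square mult_ac)
  then have "c * r ^ ?n \<le> l * measure lebesgue T" by (subst (asm) mult_le_cancel_left_pos[OF l])
  then have "c * r ^ ?n \<le> (M * measure lebesgue T) * r ^ ?n" by (simp add: l_def mult_ac)
  then have "c \<le> M * measure lebesgue T" using r by simp
  then show False using T(4) M by (simp add: field_simps)
qed

section \<open>From integral bounds and local statements to almost every parameter\<close>

text \<open>By Fatou's lemma the lower limit has finite integral, so it is finite almost everywhere.
  The bound \<open>C\<close> and the good indices \<open>N\<close> may depend on
  \<open>x\<close>.\<close>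

lemma AE_frequently_bounded:
  fixes f :: "nat \<Rightarrow> 'a \<Rightarrow> real"
  assumes int: "\<And>n. integrable M (f n)" and nn: "\<And>n x. 0 \<le> f n x" and B: "\<And>n. integral\<^sup>L M (f n) \<le> B"
  shows "AE x in M. \<exists>C>0. \<forall>N0. \<exists>N\<ge>N0. f N x \<le> C"
proof -
  let ?g = "\<lambda>x. liminf (\<lambda>n. ennreal (f n x))"
  have m: "(\<lambda>x. ennreal (f n x)) \<in> borel_measurable M" for n using int by measurable
  have "(\<integral>\<^sup>+x. ?g x \<partial>M) \<le> liminf (\<lambda>n. \<integral>\<^sup>+x. ennreal (f n x) \<partial>M)"
    by (rule nn_integral_liminf[OF m])
  also have "\<dots> \<le> liminf (\<lambda>n. ennreal B)"
  proof (intro Liminf_mono always_eventually allI)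
    fix n show "(\<integral>\<^sup>+x. ennreal (f n x) \<partial>M) \<le> ennreal B"
      using B[of n] by (subst nn_integral_eq_integral[OF int]) (auto simp: nn intro: ennreal_leI)
  qed
  also have "\<dots> < \<infinity>" by (simp add: Liminf_const)
  finally have "AE x in M. ?g x \<noteq> \<infinity>" using m by (intro nn_integral_PInf_AE) auto
  then show ?thesis
  proof (rule AE_mp, intro AE_I2 impI)
    fix x assume "?g x \<noteq> \<infinity>"
    then obtain q where q: "?g x = ennreal q" "0 \<le> q" by (cases "?g x") auto
    \<comment> \<open>Strictly above the lower limit: values approaching \<open>q\<close> from above
      need never be at most \<open>q\<close>.\<close>
    define C where "C = q + 1"
    have C: "?g x < ennreal C" "C > 0" using q by (auto simp: C_def ennreal_less_iff)
    have "\<exists>N\<ge>N0. f N x \<le> C" for N0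
    proof (rule ccontr)
      assume "\<not> ?thesis"
      then have "eventually (\<lambda>n. ennreal C \<le> ennreal (f n x)) sequentially"
        using eventually_sequentially by (metis ennreal_leI linear)
      then have "ennreal C \<le> ?g x" by (rule Liminf_bounded)
      then show False using C by simp
    qed
    then show "\<exists>C>0. \<forall>N0. \<exists>N\<ge>N0. f N x \<le> C" using C by blast
  qed
qed

text \<open>The Lindelof property leaves countably many balls, hence countably many null sets.
  \<open>A\<close> may be an arbitrary set, which matters for sets defined through
  \<open>bowen_dim\<close>.\<close>

lemma AE_lebesgue_locally:
  fixes A :: "'a::euclidean_space set"
  assumes "\<And>a. a \<in> A \<Longrightarrow> \<exists>d>0. AE t in lebesgue. t \<in> ball a d \<longrightarrow> Q t"
  shows "AE t in lebesgue. t \<in> A \<longrightarrow> Q t"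
proof -
  obtain d where d: "\<And>a. a \<in> A \<Longrightarrow> 0 < d a \<and> (AE t in lebesgue. t \<in> ball a (d a) \<longrightarrow> Q t)"
    using assms by metis
  obtain F where F: "F \<subseteq> (\<lambda>a. ball a (d a)) ` A" "countable F" "\<Union>F = (\<Union>a\<in>A. ball a (d a))"
    using Lindelof[of "(\<lambda>a. ball a (d a)) ` A"] by auto
  have "AE t in lebesgue. \<forall>S\<in>F. t \<in> S \<longrightarrow> Q t"
    using F(1) d by (intro AE_ball_countable[THEN iffD2, OF F(2)]) blast
  then show ?thesis
  proof (rule AE_mp, intro AE_I2 impI)
    fix t assume *: "\<forall>S\<in>F. t \<in> S \<longrightarrow> Q t" "t \<in> A"
    then have "t \<in> \<Union>F" using d unfolding F(3) by force
    then show "Q t" using * by blast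
  qed
qed

subsection \<open>Word maps and address maps\<close>

lemma word_map_cong:
  "(\<And>j. j \<in> {n..k} \<Longrightarrow> \<omega> j = \<omega>' j) \<Longrightarrow> word_map \<phi> t n k \<omega> = word_map \<phi> t n k \<omega>'"
proof -
  assume "\<And>j. j \<in> {n..k} \<Longrightarrow> \<omega> j = \<omega>' j"
  then have "map (\<lambda>j. \<phi> j (\<omega> j) t) [n..<Suc k] = map (\<lambda>j. \<phi> j (\<omega>' j) t) [n..<Suc k]"
    by (intro map_cong refl) (auto simp del: upt_Suc)
  then show ?thesis by (simp only: word_map_def)
qed

lemma word_map_empty [simp]: "k < n \<Longrightarrow> word_map \<phi> t n k \<omega> = id"
  by (simp add: word_map_def)

lemma foldr_comp_append: "foldr (\<circ>) (xs @ ys) id = foldr (\<circ>) xs id \<circ> foldr (\<circ>) ys id"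
  by (induction xs) auto

text \<open>Both \<open>Suc p = n\<close> and \<open>p = k\<close> are allowed; the empty word acts
  as the identity.\<close>

lemma word_map_split:
  assumes "n \<le> Suc p" "p \<le> k"
  shows "word_map \<phi> t n k \<omega> = word_map \<phi> t n p \<omega> \<circ> word_map \<phi> t (Suc p) k \<omega>"
proof -
  have "[n..<Suc k] = [n..<Suc p] @ [Suc p..<Suc k]"
    using upt_add_eq_append[OF assms(1), of "k - p"] assms(2) by (simp del: upt_Suc)
  then show ?thesis by (simp only: word_map_def map_append foldr_comp_append)
qed

lemma fin_words_mem: "u \<in> fin_words I n k \<Longrightarrow> j \<in> {n..k} \<Longrightarrow> u j \<in> I j"
  by (auto simp: fin_words_def)

lemma inf_words_restrict: "\<omega> \<in> inf_words I n \<Longrightarrow> n \<le> k \<Longrightarrow> restrict \<omega> {k..} \<in> inf_words I k"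
  by (auto simp: inf_words_def)

text \<open>The witnesses \<open>\<gamma>\<close> and \<open>K\<close> are fixed once for all
  lemmas. Nonempty alphabets are required so that every finite word extends to an infinite one; an
  empty alphabet is dealt with separately at the end.\<close>

locale tncifs =
  fixes X V :: "(real^'m) set" and U :: "(real^'d) set"
    and I :: "nat \<Rightarrow> 'i set" and \<phi> :: "('i, 'd, 'm) system"
    and \<gamma> :: real and K :: "real^'d \<Rightarrow> real"
  assumes X: "X \<noteq> {}" "compact X" "convex X" and U: "open U"
    and finite_I: "1 \<le> j \<Longrightarrow> finite (I j)" and nonempty_I: "1 \<le> j \<Longrightarrow> I j \<noteq> {}"
    and self_map: "t \<in> U \<Longrightarrow> 1 \<le> j \<Longrightarrow> i \<in> I j \<Longrightarrow> \<phi> j i t ` X \<subseteq> X"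
    and V: "open V" "X \<subseteq> V"
    and conformal: "t \<in> U \<Longrightarrow> 1 \<le> j \<Longrightarrow> i \<in> I j \<Longrightarrow> conformal_on V (\<phi> j i t) \<and> \<phi> j i t ` V \<subseteq> V"
    and \<gamma>: "0 < \<gamma>" "\<gamma> < 1"
    and contraction: "t \<in> U \<Longrightarrow> 1 \<le> n \<Longrightarrow> 1 \<le> j \<Longrightarrow> \<omega> \<in> inf_words I n \<Longrightarrow> x \<in> V \<Longrightarrow>
           conformal_factor (prefix_map \<phi> t n j \<omega>) x \<le> \<gamma> ^ j"
    and K: "continuous_on U K" "t \<in> U \<Longrightarrow> 1 \<le> K t"
    and distortion: "t \<in> U \<Longrightarrow> 1 \<le> n \<Longrightarrow> 1 \<le> j \<Longrightarrow> \<omega> \<in> inf_words I n \<Longrightarrow> x1 \<in> V \<Longrightarrow> x2 \<in> V \<Longrightarrow>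
           conformal_factor (prefix_map \<phi> t n j \<omega>) x1
             \<le> K t * conformal_factor (prefix_map \<phi> t n j \<omega>) x2"
    and distortion_cont: "distortion_continuity X U I \<phi>"
    and address_cont: "address_continuity X U I \<phi>"
    and transversal: "transversality X U I \<phi>"
begin

text \<open>Only the letters at levels \<open>n\<close> to \<open>k\<close> are constrained, so
  finite and infinite words are covered alike; \<open>n = Suc k\<close> is the empty word.\<close>

definition admissible :: "nat \<Rightarrow> nat \<Rightarrow> (nat \<Rightarrow> 'i) \<Rightarrow> bool" where
  "admissible n k \<omega> \<longleftrightarrow> 1 \<le> n \<and> n \<le> Suc k \<and> (\<forall>j\<in>{n..k}. \<omega> j \<in> I j)"

text \<open>The contraction and distortion hypotheses, like the address map, concern infinite words.
  A finite word enters them through an arbitrary continuation.\<close>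

definition extend :: "nat \<Rightarrow> nat \<Rightarrow> (nat \<Rightarrow> 'i) \<Rightarrow> nat \<Rightarrow> 'i" where
  "extend n k \<omega> = restrict (\<lambda>j. if j \<le> k then \<omega> j else SOME i. i \<in> I j) {n..}"

lemma extend_eq: "j \<in> {n..k} \<Longrightarrow> extend n k \<omega> j = \<omega> j"
  by (simp add: extend_def)

lemma extend_inf_words: "admissible n k \<omega> \<Longrightarrow> extend n k \<omega> \<in> inf_words I n"
  using nonempty_I unfolding extend_def inf_words_def admissible_def
  by (intro restrict_PiE_iff[THEN iffD2] ballI) (simp add: some_in_eq)

lemma admissible_mono: "admissible n k \<omega> \<Longrightarrow> n \<le> n' \<Longrightarrow> k' \<le> k \<Longrightarrow> n' \<le> Suc k' \<Longrightarrow> admissible n' k' \<omega>"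
  by (auto simp: admissible_def)

lemma admissible_fin_words: "u \<in> fin_words I n k \<Longrightarrow> 1 \<le> n \<Longrightarrow> n \<le> Suc k \<Longrightarrow> admissible n k u"
  by (auto simp: admissible_def fin_words_def)

lemma admissible_inf_words: "\<omega> \<in> inf_words I n \<Longrightarrow> 1 \<le> n \<Longrightarrow> n \<le> n' \<Longrightarrow> n' \<le> Suc k \<Longrightarrow> admissible n' k \<omega>"
  by (auto simp: admissible_def inf_words_def)

section \<open>Conformality, contraction and distortion of word maps\<close>

lemma foldr_conformal:
  assumes t: "t \<in> U" and "\<forall>j\<in>set js. 1 \<le> j \<and> \<omega> j \<in> I j"
  defines "f \<equiv> foldr (\<circ>) (map (\<lambda>j. \<phi> j (\<omega> j) t) js) id"
  shows "f ` X \<subseteq> X \<and> f ` V \<subseteq> V \<and> inj_on f V \<and> (\<forall>x\<in>V. \<exists>c. conformal_at_with f x c)"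
  using assms(2) unfolding f_def
proof (induction js)
  case Nil
  have "\<forall>x\<in>V. \<exists>c. conformal_at_with id x c" using conformal_at_with_id by blast
  then show ?case by (auto simp: id_def)
next
  case (Cons j js)
  let ?g = "foldr (\<circ>) (map (\<lambda>j. \<phi> j (\<omega> j) t) js) id"
  have "\<forall>j\<in>set js. 1 \<le> j \<and> \<omega> j \<in> I j" using Cons.prems by simp
  note IH = Cons.IH[OF this]
  have g: "?g ` X \<subseteq> X" "?g ` V \<subseteq> V" "inj_on ?g V" "\<And>x. x \<in> V \<Longrightarrow> \<exists>c. conformal_at_with ?g x c"
    using IH by blast+
  have j: "1 \<le> j" "\<omega> j \<in> I j" using Cons.prems by auto
  have h: "\<phi> j (\<omega> j) t ` X \<subseteq> X" "\<phi> j (\<omega> j) t ` V \<subseteq> V" "inj_on (\<phi> j (\<omega> j) t) V"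
      "\<And>x. x \<in> V \<Longrightarrow> \<exists>c. conformal_at_with (\<phi> j (\<omega> j) t) x c"
    using self_map[OF t j] conformal[OF t j] by (auto simp: conformal_on_def C1_diffeomorphism_on_def)
  have "inj_on (\<phi> j (\<omega> j) t \<circ> ?g) V"
    by (rule comp_inj_on[OF g(3) inj_on_subset[OF h(3) g(2)]])
  moreover have "\<forall>x\<in>V. \<exists>c. conformal_at_with (\<phi> j (\<omega> j) t \<circ> ?g) x c"
  proof
    fix x assume x: "x \<in> V"
    then obtain c where c: "conformal_at_with ?g x c" using g by blast
    obtain d where "conformal_at_with (\<phi> j (\<omega> j) t) (?g x) d" using h(4) g(2) x by blast
    from conformal_at_with_compose[OF c this]
    show "\<exists>c. conformal_at_with (\<phi> j (\<omega> j) t \<circ> ?g) x c" by blast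
  qed
  moreover have "(\<phi> j (\<omega> j) t \<circ> ?g) ` X \<subseteq> X" "(\<phi> j (\<omega> j) t \<circ> ?g) ` V \<subseteq> V"
    unfolding image_comp[symmetric] using g(1,2) h(1,2) by (meson image_mono order_trans)+
  ultimately show ?case unfolding list.map foldr_Cons comp_apply by blast
qed

context
  fixes t n k \<omega> assumes t: "t \<in> U" and \<omega>: "admissible n k \<omega>"
begin

lemma word_map_conformal:
  "word_map \<phi> t n k \<omega> ` X \<subseteq> X" "word_map \<phi> t n k \<omega> ` V \<subseteq> V" "inj_on (word_map \<phi> t n k \<omega>) V"
  "x \<in> V \<Longrightarrow> conformal_at_with (word_map \<phi> t n k \<omega>) x (conformal_factor (word_map \<phi> t n k \<omega>) x)"
proof -
  have "\<forall>j\<in>set [n..<Suc k]. 1 \<le> j \<and> \<omega> j \<in> I j" using \<omega> by (auto simp: admissible_def)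
  note * = foldr_conformal[OF t this, folded word_map_def]
  show "word_map \<phi> t n k \<omega> ` X \<subseteq> X" "word_map \<phi> t n k \<omega> ` V \<subseteq> V" "inj_on (word_map \<phi> t n k \<omega>) V"
    by (rule *[THEN conjunct1], rule *[THEN conjunct2, THEN conjunct1],
        rule *[THEN conjunct2, THEN conjunct2, THEN conjunct1])
  show "conformal_at_with (word_map \<phi> t n k \<omega>) x (conformal_factor (word_map \<phi> t n k \<omega>) x)" if x: "x \<in> V"
  proof -
    obtain c where "conformal_at_with (word_map \<phi> t n k \<omega>) x c"
      using bspec[OF *[THEN conjunct2, THEN conjunct2, THEN conjunct2] x] by blast
    then show ?thesis by (simp only: conformal_factor_eq)
  qed
qed

lemma conformal_factor_pos: "x \<in> V \<Longrightarrow> 0 < conformal_factor (word_map \<phi> t n k \<omega>) x"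
  using word_map_conformal(4)[of x] unfolding conformal_at_with_def by blast

text \<open>A nonempty word is a prefix of its extension, to which the hypotheses apply; the empty
  word is the identity with factor 1. The exponent \<open>Suc k - n\<close> is the length of the
  word.\<close>

lemma conformal_factor_bounds:
  assumes x: "x \<in> V"
  shows "conformal_factor (word_map \<phi> t n k \<omega>) x \<le> \<gamma> ^ (Suc k - n) \<and>
    (y \<in> V \<longrightarrow> conformal_factor (word_map \<phi> t n k \<omega>) x \<le> K t * conformal_factor (word_map \<phi> t n k \<omega>) y)"
proof (cases "n \<le> k")
  case True
  have "word_map \<phi> t n k \<omega> = word_map \<phi> t n k (extend n k \<omega>)"
    by (rule word_map_cong) (simp add: extend_eq)
  also have "\<dots> = prefix_map \<phi> t n (Suc k - n) (extend n k \<omega>)"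
    using True by (simp add: prefix_map_def)
  finally have eq: "word_map \<phi> t n k \<omega> = prefix_map \<phi> t n (Suc k - n) (extend n k \<omega>)" .
  have n: "1 \<le> n" "1 \<le> Suc k - n" using \<omega> True by (auto simp: admissible_def)
  have ext: "extend n k \<omega> \<in> inf_words I n" by (rule extend_inf_words[OF \<omega>])
  show ?thesis unfolding eq
    by (intro conjI impI contraction[OF t n ext x] distortion[OF t n ext x])
next
  case False
  have "conformal_factor id z = 1" for z :: "real^'m"
    by (rule conformal_factor_eq[OF conformal_at_with_id])
  then show ?thesis using False \<omega> K(2)[OF t] by (simp add: admissible_def)
qed
lemmas conformal_factor_le = conformal_factor_bounds[THEN conjunct1]
lemmas conformal_factor_distortion = conformal_factor_bounds[THEN conjunct2, rule_format]

lemma bdd_above_conformal_factor: "bdd_above (conformal_factor (word_map \<phi> t n k \<omega>) ` X)"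
proof (rule bdd_aboveI2)
  fix x assume "x \<in> X"
  then have "x \<in> V" using V(2) by (rule rev_subsetD)
  then show "conformal_factor (word_map \<phi> t n k \<omega>) x \<le> \<gamma> ^ (Suc k - n)" by (rule conformal_factor_le)
qed

lemma conformal_factor_le_sup:
  "x \<in> X \<Longrightarrow> conformal_factor (word_map \<phi> t n k \<omega>) x \<le> conformal_sup (word_map \<phi> t n k \<omega>) X"
  unfolding conformal_sup_def by (rule cSUP_upper[OF _ bdd_above_conformal_factor])

lemma conformal_sup_pos: "0 < conformal_sup (word_map \<phi> t n k \<omega>) X"
proof -
  obtain x where x: "x \<in> X" using X(1) by blast
  show ?thesis
    using conformal_factor_pos[OF subsetD[OF V(2) x]] conformal_factor_le_sup[OF x] by linarith
qed

lemma conformal_sup_le: "conformal_sup (word_map \<phi> t n k \<omega>) X \<le> \<gamma> ^ (Suc k - n)"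
  unfolding conformal_sup_def
proof (rule cSUP_least[OF X(1)])
  fix x assume "x \<in> X"
  then have "x \<in> V" using V(2) by (rule rev_subsetD)
  then show "conformal_factor (word_map \<phi> t n k \<omega>) x \<le> \<gamma> ^ (Suc k - n)" by (rule conformal_factor_le)
qed

lemma conformal_sup_le_factor:
  "x \<in> V \<Longrightarrow> conformal_sup (word_map \<phi> t n k \<omega>) X \<le> K t * conformal_factor (word_map \<phi> t n k \<omega>) x"
  unfolding conformal_sup_def
proof (rule cSUP_least[OF X(1)])
  fix y assume x: "x \<in> V" and "y \<in> X"
  then have "y \<in> V" using V(2) by blast
  then show "conformal_factor (word_map \<phi> t n k \<omega>) y \<le> K t * conformal_factor (word_map \<phi> t n k \<omega>) x"
    using x by (rule conformal_factor_distortion)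
qed

lemma word_map_dist_le:
  assumes "x \<in> X" "y \<in> X"
  shows "dist (word_map \<phi> t n k \<omega> x) (word_map \<phi> t n k \<omega> y)
    \<le> conformal_sup (word_map \<phi> t n k \<omega>) X * dist x y"
proof (rule conformal_dist_le[OF X(3) _ assms])
  fix z assume z: "z \<in> X"
  show "\<exists>c\<le>conformal_sup (word_map \<phi> t n k \<omega>) X. conformal_at_with (word_map \<phi> t n k \<omega>) z c"
    using word_map_conformal(4)[OF subsetD[OF V(2) z]] conformal_factor_le_sup[OF z] by blast
qed

lemma word_map_dist_le':
  assumes "x \<in> X" "y \<in> X"
  shows "dist (word_map \<phi> t n k \<omega> x) (word_map \<phi> t n k \<omega> y)
    \<le> conformal_sup (word_map \<phi> t n k \<omega>) X * diameter X"
proof -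
  have "dist x y \<le> diameter X"
    using assms X(2) by (intro diameter_bounded_bound compact_imp_bounded) auto
  then have "conformal_sup (word_map \<phi> t n k \<omega>) X * dist x y \<le> conformal_sup (word_map \<phi> t n k \<omega>) X * diameter X"
    using conformal_sup_pos by (intro mult_left_mono) auto
  then show ?thesis using word_map_dist_le[OF assms] by linarith
qed

end

lemma conformal_factor_split:
  assumes t: "t \<in> U" and \<omega>: "admissible n k \<omega>" and p: "n \<le> Suc p" "p \<le> k" and x: "x \<in> V"
  shows "conformal_factor (word_map \<phi> t n k \<omega>) x =
    conformal_factor (word_map \<phi> t n p \<omega>) (word_map \<phi> t (Suc p) k \<omega> x) *
    conformal_factor (word_map \<phi> t (Suc p) k \<omega>) x"
proof -
  have adm: "admissible n p \<omega>" "admissible (Suc p) k \<omega>"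
    using admissible_mono[OF \<omega>] p by auto
  have "word_map \<phi> t (Suc p) k \<omega> x \<in> V" using word_map_conformal(2)[OF t adm(2)] x by blast
  from conformal_at_with_compose[OF word_map_conformal(4)[OF t adm(2) x] word_map_conformal(4)[OF t adm(1) this]]
  show ?thesis unfolding word_map_split[OF p] by (rule conformal_factor_eq)
qed

lemma conformal_sup_submult:
  assumes t: "t \<in> U" and \<omega>: "admissible n k \<omega>" and p: "n \<le> Suc p" "p \<le> k"
  shows "conformal_sup (word_map \<phi> t n k \<omega>) X
    \<le> conformal_sup (word_map \<phi> t n p \<omega>) X * conformal_sup (word_map \<phi> t (Suc p) k \<omega>) X"
proof -
  have adm: "admissible n p \<omega>" "admissible (Suc p) k \<omega>"
    using admissible_mono[OF \<omega>] p by auto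
  show ?thesis
    unfolding conformal_sup_def[of "word_map \<phi> t n k \<omega>"]
  proof (rule cSUP_least[OF X(1)])
    fix x assume x: "x \<in> X"
    then have y: "word_map \<phi> t (Suc p) k \<omega> x \<in> X" using word_map_conformal(1)[OF t adm(2)] by blast
    show "conformal_factor (word_map \<phi> t n k \<omega>) x
        \<le> conformal_sup (word_map \<phi> t n p \<omega>) X * conformal_sup (word_map \<phi> t (Suc p) k \<omega>) X"
      unfolding conformal_factor_split[OF t \<omega> p subsetD[OF V(2) x]]
      by (intro mult_mono conformal_factor_le_sup[OF t adm(1) y] conformal_factor_le_sup[OF t adm(2) x]
          conformal_sup_pos[OF t adm(1)] conformal_factor_pos[OF t adm(2)] less_imp_le subsetD[OF V(2) x])
  qed
qed

text \<open>In the chain rule the outer factor is evaluated at a point dictated by the inner map.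
  Bounded distortion compares it there with its supremum, at the cost of \<open>K t\<close>.\<close>

lemma conformal_sup_supermult:
  assumes t: "t \<in> U" and \<omega>: "admissible n k \<omega>" and p: "n \<le> Suc p" "p \<le> k"
  shows "conformal_sup (word_map \<phi> t n p \<omega>) X * conformal_sup (word_map \<phi> t (Suc p) k \<omega>) X
    \<le> K t * conformal_sup (word_map \<phi> t n k \<omega>) X"
proof -
  have adm: "admissible n p \<omega>" "admissible (Suc p) k \<omega>"
    using admissible_mono[OF \<omega>] p by auto
  let ?a = "conformal_sup (word_map \<phi> t n p \<omega>) X"
  have a: "?a > 0" by (rule conformal_sup_pos[OF t adm(1)])
  have "conformal_sup (word_map \<phi> t (Suc p) k \<omega>) X \<le> K t * conformal_sup (word_map \<phi> t n k \<omega>) X / ?a"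
    unfolding conformal_sup_def[of "word_map \<phi> t (Suc p) k \<omega>"]
  proof (rule cSUP_least[OF X(1)])
    fix x assume x: "x \<in> X"
    then have xV: "x \<in> V" using V(2) by blast
    have y: "word_map \<phi> t (Suc p) k \<omega> x \<in> V" using word_map_conformal(2)[OF t adm(2)] xV by blast
    have "?a * conformal_factor (word_map \<phi> t (Suc p) k \<omega>) x
        \<le> K t * conformal_factor (word_map \<phi> t n p \<omega>) (word_map \<phi> t (Suc p) k \<omega> x) *
          conformal_factor (word_map \<phi> t (Suc p) k \<omega>) x"
      using conformal_sup_le_factor[OF t adm(1) y] conformal_factor_pos[OF t adm(2) xV]
      by (intro mult_right_mono) auto
    also have "\<dots> = K t * conformal_factor (word_map \<phi> t n k \<omega>) x"
      by (simp add: conformal_factor_split[OF t \<omega> p xV])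
    also have "\<dots> \<le> K t * conformal_sup (word_map \<phi> t n k \<omega>) X"
      using conformal_factor_le_sup[OF t \<omega> x] K(2)[OF t] by (intro mult_left_mono) auto
    finally show "conformal_factor (word_map \<phi> t (Suc p) k \<omega>) x \<le> K t * conformal_sup (word_map \<phi> t n k \<omega>) X / ?a"
      using a by (simp add: field_simps)
  qed
  then show ?thesis using a by (simp add: field_simps)
qed

text \<open>The constant \<open>b\<close> depends only on \<open>X\<close> and \<open>V\<close>:
  compactness gives a radius \<open>R\<close> such that the closed \<open>R\<close>-balls around
  points of \<open>X\<close> stay in \<open>V\<close>. Bounded distortion makes
  \<open>conformal_sup\<close> divided by \<open>K t\<close> a lower bound for the factor on all of
  \<open>V\<close>.\<close>

lemma word_map_dist_ge:
  "\<exists>b>0. \<forall>t n k \<omega> x y. t \<in> U \<longrightarrow> admissible n k \<omega> \<longrightarrow> x \<in> X \<longrightarrow> y \<in> X \<longrightarrow>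
      conformal_sup (word_map \<phi> t n k \<omega>) X / K t * b * dist x y
        \<le> dist (word_map \<phi> t n k \<omega> x) (word_map \<phi> t n k \<omega> y)"
proof -
  obtain e where e: "e > 0" "(\<Union>x\<in>X. ball x e) \<subseteq> V"
    by (rule compact_subset_open_imp_ball_epsilon_subset[OF X(2) V])
  define R where "R = e / 2"
  have R: "R > 0" using e by (simp add: R_def)
  have RV: "cball x R \<subseteq> V" if "x \<in> X" for x
  proof -
    have "cball x R \<subseteq> ball x e" using e(1) by (auto simp: R_def)
    also have "\<dots> \<subseteq> V" using e(2) that by blast
    finally show ?thesis .
  qed
  \<comment> \<open>The maximum gives \<open>R \<le> D\<close> and keeps \<open>D\<close> positive
    when \<open>X\<close> is a single point.\<close>
  define D where "D = max R (diameter X)"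
  have D: "R \<le> D" "\<And>x y. x \<in> X \<Longrightarrow> y \<in> X \<Longrightarrow> dist x y \<le> D"
    using diameter_bounded_bound[OF compact_imp_bounded[OF X(2)]] by (auto simp: D_def le_max_iff_disj)
  show ?thesis
  proof (intro exI[of _ "R / (2 * D)"] conjI allI impI)
    show "0 < R / (2 * D)" using R D by simp
  next
    fix t n k \<omega> x y assume *: "t \<in> U" "admissible n k \<omega>" "x \<in> X" "y \<in> X"
    have K1: "K t > 0" using K(2)[OF *(1)] by simp
    show "conformal_sup (word_map \<phi> t n k \<omega>) X / K t * (R / (2 * D)) * dist x y
        \<le> dist (word_map \<phi> t n k \<omega> x) (word_map \<phi> t n k \<omega> y)"
    proof (rule conformal_dist_ge[OF word_map_conformal(3)[OF *(1,2)] _ RV D(2) R D(1) _ *(3,4)])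
      fix z assume z: "z \<in> V"
      have "conformal_sup (word_map \<phi> t n k \<omega>) X / K t \<le> conformal_factor (word_map \<phi> t n k \<omega>) z"
        using conformal_sup_le_factor[OF *(1,2) z] K1 by (simp add: field_simps)
      then show "\<exists>c\<ge>conformal_sup (word_map \<phi> t n k \<omega>) X / K t. conformal_at_with (word_map \<phi> t n k \<omega>) z c"
        using word_map_conformal(4)[OF *(1,2) z] by blast
    next
      show "0 < conformal_sup (word_map \<phi> t n k \<omega>) X / K t"
        using conformal_sup_pos[OF *(1,2)] K1 by simp
    qed
  qed
qed

section \<open>Address maps and compactness of the limit set\<close>

lemma word_image_antimono:
  assumes "t \<in> U" "admissible n k \<omega>" "n \<le> Suc p" "p \<le> k"
  shows "word_map \<phi> t n k \<omega> ` X \<subseteq> word_map \<phi> t n p \<omega> ` X"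
proof -
  have "admissible (Suc p) k \<omega>" using assms(3,4) by (intro admissible_mono[OF assms(2)]) auto
  then show ?thesis
    unfolding word_map_split[OF assms(3,4)] image_comp[symmetric]
    by (intro image_mono word_map_conformal(1)[OF assms(1)])
qed

text \<open>The images are nested nonempty compact sets with diameters tending to 0, so they meet in
  one point and the definite description in \<open>address_map\<close> is legitimate.\<close>

lemma address_map_eq:
  assumes t: "t \<in> U" and n: "1 \<le> n" and \<omega>: "\<omega> \<in> inf_words I n"
  shows "(\<Inter>k\<in>{n..}. word_map \<phi> t n k \<omega> ` X) = {address_map X \<phi> n t \<omega>}"
proof -
  define S where "S i = word_map \<phi> t n (n + i) \<omega> ` X" for i
  have adm: "admissible n (n + i) \<omega>" for i by (rule admissible_inf_words[OF \<omega> n]) auto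
  have "\<exists>a. (\<Inter>(range S)) = {a}"
  proof (rule decreasing_closed_nest_sing)
    fix i
    have "continuous_on X (word_map \<phi> t n (n + i) \<omega>)"
      using word_map_conformal(4)[OF t adm] V(2) unfolding conformal_at_with_def
      by (meson continuous_at_imp_continuous_on has_derivative_continuous subsetD)
    then show "closed (S i)" unfolding S_def by (intro compact_imp_closed compact_continuous_image X(2))
    show "S i \<noteq> {}" using X(1) by (simp add: S_def)
  next
    fix i j :: nat assume "i \<le> j"
    then show "S j \<subseteq> S i" unfolding S_def by (intro word_image_antimono[OF t adm]) auto
  next
    fix e :: real assume e: "e > 0"
    have "(\<lambda>i. \<gamma> ^ i * diameter X) \<longlonglongrightarrow> 0"
      using \<gamma> by (intro tendsto_mult_left_zero LIMSEQ_realpow_zero) auto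
    then obtain i where i: "\<gamma> ^ i * diameter X < e"
      using eventually_happens[OF order_tendstoD(2)[OF _ e]] by (metis trivial_limit_sequentially)
    have "dist x y < e" if xy: "x \<in> S i" "y \<in> S i" for x y
    proof -
      obtain x' y' where *: "x' \<in> X" "y' \<in> X" "x = word_map \<phi> t n (n + i) \<omega> x'" "y = word_map \<phi> t n (n + i) \<omega> y'"
        using xy by (auto simp: S_def)
      have "dist x y \<le> conformal_sup (word_map \<phi> t n (n + i) \<omega>) X * diameter X"
        unfolding * by (rule word_map_dist_le'[OF t adm *(1,2)])
      also have "\<dots> \<le> \<gamma> ^ i * diameter X"
      proof (rule mult_right_mono)
        have "conformal_sup (word_map \<phi> t n (n + i) \<omega>) X \<le> \<gamma> ^ Suc i"
          using conformal_sup_le[OF t adm, of i] by (simp add: Suc_diff_le)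
        also have "\<dots> \<le> \<gamma> ^ i" using \<gamma> by (intro power_decreasing) auto
        finally show "conformal_sup (word_map \<phi> t n (n + i) \<omega>) X \<le> \<gamma> ^ i" .
        show "0 \<le> diameter X" by (intro diameter_ge_0 compact_imp_bounded X)
      qed
      finally show ?thesis using i by linarith
    qed
    then show "\<exists>i. \<forall>x\<in>S i. \<forall>y\<in>S i. dist x y < e" by blast
  qed
  then obtain a where a: "(\<Inter>i. S i) = {a}" by blast
  \<comment> \<open>A prefix of length \<open>Suc i\<close> starting at level \<open>n\<close> ends
    at level \<open>n + i\<close>.\<close>
  have "(\<Inter>j\<in>{1..}. prefix_map \<phi> t n j \<omega> ` X) = (\<Inter>i. S i)"
  proof -
    have "{1..} = range Suc" by (auto simp: image_iff Suc_le_eq gr0_conv_Suc)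
    then show ?thesis by (simp add: S_def prefix_map_def image_image)
  qed
  then have "address_map X \<phi> n t \<omega> = a" unfolding address_map_def a by simp
  moreover have "{n..} = range ((+) n)" by (auto simp: image_iff nat_le_iff_add)
  then have "(\<Inter>k\<in>{n..}. word_map \<phi> t n k \<omega> ` X) = (\<Inter>i. S i)"
    by (simp add: S_def image_image)
  ultimately show ?thesis using a by simp
qed

lemma address_map_mem:
  assumes "t \<in> U" "1 \<le> n" "\<omega> \<in> inf_words I n" "n \<le> k"
  shows "address_map X \<phi> n t \<omega> \<in> word_map \<phi> t n k \<omega> ` X"
  using address_map_eq[OF assms(1-3)] assms(4) by blast

lemma address_map_mem_X:
  assumes "t \<in> U" "1 \<le> n" "\<omega> \<in> inf_words I n"
  shows "address_map X \<phi> n t \<omega> \<in> X"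
  using address_map_mem[OF assms order_refl]
    word_map_conformal(1)[OF assms(1) admissible_inf_words[OF assms(3,2) order_refl, of n]] by auto

text \<open>The point on the right lies in every nested image: for \<open>k \<le> n\<close> because
  the images decrease, for \<open>k > n\<close> by splitting the word after level \<open>n\<close>.
  The tail must be restricted because words are extensional functions.\<close>

lemma address_map_shift:
  assumes t: "t \<in> U" and \<omega>: "\<omega> \<in> inf_words I 1"
  shows "address_map X \<phi> 1 t \<omega> = word_map \<phi> t 1 n \<omega> (address_map X \<phi> (Suc n) t (restrict \<omega> {Suc n..}))"
proof -
  let ?y = "address_map X \<phi> (Suc n) t (restrict \<omega> {Suc n..})"
  have r: "restrict \<omega> {Suc n..} \<in> inf_words I (Suc n)" by (rule inf_words_restrict[OF \<omega>]) auto
  have "word_map \<phi> t 1 n \<omega> ?y \<in> word_map \<phi> t 1 k \<omega> ` X" if k: "1 \<le> k" for k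
  proof (cases "k \<le> n")
    case True
    have "word_map \<phi> t 1 n \<omega> ?y \<in> word_map \<phi> t 1 n \<omega> ` X"
      by (intro imageI address_map_mem_X t r) auto
    then show ?thesis
      using word_image_antimono[OF t admissible_inf_words[OF \<omega>], of 1 n k] True by auto
  next
    case False
    have "?y \<in> word_map \<phi> t (Suc n) k (restrict \<omega> {Suc n..}) ` X"
      using False by (intro address_map_mem t r) auto
    also have "word_map \<phi> t (Suc n) k (restrict \<omega> {Suc n..}) = word_map \<phi> t (Suc n) k \<omega>"
      by (rule word_map_cong) auto
    finally have y: "?y \<in> word_map \<phi> t (Suc n) k \<omega> ` X" .
    have "1 \<le> Suc n" "n \<le> k" using False by auto
    then have "word_map \<phi> t 1 k \<omega> = word_map \<phi> t 1 n \<omega> \<circ> word_map \<phi> t (Suc n) k \<omega>" by (rule word_map_split)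
    then show ?thesis using imageI[OF y, of "word_map \<phi> t 1 n \<omega>"] by (simp only: image_comp)
  qed
  then have "word_map \<phi> t 1 n \<omega> ?y \<in> (\<Inter>k\<in>{1..}. word_map \<phi> t 1 k \<omega> ` X)"
    by (intro INT_I) simp
  then show ?thesis unfolding address_map_eq[OF t order_refl \<omega>] by simp
qed

lemma continuous_address_map:
  assumes "1 \<le> n" "\<omega> \<in> inf_words I n"
  shows "continuous_on U (\<lambda>t. address_map X \<phi> n t \<omega>)"
proof -
  have "continuous_map (prod_topology (top_of_set U) (inf_words_topology I n)) euclidean (\<lambda>(t, \<omega>). address_map X \<phi> n t \<omega>)"
    using address_cont assms(1) by (auto simp: address_continuity_def)
  moreover have "continuous_map (top_of_set U) (prod_topology (top_of_set U) (inf_words_topology I n)) (\<lambda>t. (t, \<omega>))"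
    using assms by (simp add: continuous_map_pairedI topspace_inf_words_topology)
  ultimately have "continuous_map (top_of_set U) euclidean ((\<lambda>(t, \<omega>). address_map X \<phi> n t \<omega>) \<circ> (\<lambda>t. (t, \<omega>)))"
    by (rule continuous_map_compose[rotated])
  then show ?thesis by (simp add: comp_def)
qed

text \<open>By Tychonoff's theorem the words form a compact space, and \<open>J_t\<close> is its
  continuous image.\<close>

lemma compact_limit_set:
  assumes t: "t \<in> U"
  shows "compact (limit_set X I \<phi> t)"
proof -
  have "continuous_map (prod_topology (top_of_set U) (inf_words_topology I 1)) euclidean (\<lambda>(t, \<omega>). address_map X \<phi> 1 t \<omega>)"
    using address_cont by (auto simp: address_continuity_def)
  moreover have "continuous_map (inf_words_topology I 1) (prod_topology (top_of_set U) (inf_words_topology I 1)) (\<lambda>\<omega>. (t, \<omega>))"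
    using t by (simp add: continuous_map_pairedI)
  ultimately have "continuous_map (inf_words_topology I 1) euclidean ((\<lambda>(t, \<omega>). address_map X \<phi> 1 t \<omega>) \<circ> (\<lambda>\<omega>. (t, \<omega>)))"
    by (rule continuous_map_compose[rotated])
  moreover have "compact_space (inf_words_topology I 1)"
    unfolding inf_words_topology_def using finite_I
    by (simp add: compact_space_product_topology compact_space_discrete_topology)
  ultimately have "compactin euclidean (((\<lambda>(t, \<omega>). address_map X \<phi> 1 t \<omega>) \<circ> (\<lambda>\<omega>. (t, \<omega>))) ` inf_words I 1)"
    by (metis compact_space_def image_compactin topspace_inf_words_topology)
  then show ?thesis by (simp add: limit_set_def comp_def)
qed

subsection \<open>Transversality and cylinder weights\<close>

lemma address_separation:
  "\<exists>b>0. \<forall>t n \<omega> \<tau>. t \<in> U \<longrightarrow> \<omega> \<in> inf_words I 1 \<longrightarrow> \<tau> \<in> inf_words I 1 \<longrightarrow> (\<forall>j\<in>{1..n}. \<omega> j = \<tau> j) \<longrightarrow>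
      conformal_sup (word_map \<phi> t 1 n \<omega>) X / K t * b *
        dist (address_map X \<phi> (Suc n) t (restrict \<omega> {Suc n..})) (address_map X \<phi> (Suc n) t (restrict \<tau> {Suc n..}))
        \<le> dist (address_map X \<phi> 1 t \<omega>) (address_map X \<phi> 1 t \<tau>)"
proof -
  from word_map_dist_ge obtain b where b: "0 < b"
    "\<forall>t n k \<omega> x y. t \<in> U \<longrightarrow> admissible n k \<omega> \<longrightarrow> x \<in> X \<longrightarrow> y \<in> X \<longrightarrow>
      conformal_sup (word_map \<phi> t n k \<omega>) X / K t * b * dist x y
        \<le> dist (word_map \<phi> t n k \<omega> x) (word_map \<phi> t n k \<omega> y)"
    by (elim exE conjE)
  show ?thesis
  proof (intro exI[of _ b] conjI b(1) allI impI)
    fix t n and \<omega> \<tau> :: "nat \<Rightarrow> 'i"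
    assume t: "t \<in> U" and \<omega>: "\<omega> \<in> inf_words I 1" and \<tau>: "\<tau> \<in> inf_words I 1"
      and eq: "\<forall>j\<in>{1..n}. \<omega> j = \<tau> j"
    have same: "word_map \<phi> t 1 n \<tau> = word_map \<phi> t 1 n \<omega>"
      using eq by (intro word_map_cong) auto
    have mem: "address_map X \<phi> (Suc n) t (restrict \<rho> {Suc n..}) \<in> X" if "\<rho> \<in> inf_words I 1" for \<rho>
      using that by (intro address_map_mem_X t inf_words_restrict) auto
    show "conformal_sup (word_map \<phi> t 1 n \<omega>) X / K t * b *
        dist (address_map X \<phi> (Suc n) t (restrict \<omega> {Suc n..})) (address_map X \<phi> (Suc n) t (restrict \<tau> {Suc n..}))
        \<le> dist (address_map X \<phi> 1 t \<omega>) (address_map X \<phi> 1 t \<tau>)"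
      unfolding address_map_shift[OF t \<omega>, of n] address_map_shift[OF t \<tau>, of n] same
      by (intro b(2)[rule_format] t mem \<omega> \<tau> admissible_inf_words[OF \<omega>]) auto
  qed
qed

text \<open>Provides measurability of the parameter sets to which transversality is applied.\<close>

lemma compact_coincidence_set:
  assumes "cball t0 d \<subseteq> U" "1 \<le> n" "\<omega> \<in> inf_words I n" "\<tau> \<in> inf_words I n"
  shows "compact {t\<in>cball t0 d. dist (address_map X \<phi> n t \<omega>) (address_map X \<phi> n t \<tau>) \<le> r}"
proof -
  have "closed {t\<in>cball t0 d. dist (address_map X \<phi> n t \<omega>) (address_map X \<phi> n t \<tau>) \<le> r}"
    using assms continuous_address_map[OF assms(2)]
    by (intro continuous_on_closed_Collect_le continuous_intros) (auto intro: continuous_on_subset)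
  moreover have "bounded {t\<in>cball t0 d. dist (address_map X \<phi> n t \<omega>) (address_map X \<phi> n t \<tau>) \<le> r}"
    by (rule bounded_subset[OF bounded_cball]) auto
  ultimately show ?thesis by (simp add: compact_eq_bounded_closed)
qed

text \<open>If the addresses of two words with common prefix of length \<open>n\<close> are
  \<open>r\<close>-close, pulling back through the prefix map makes the tail addresses
  \<open>r'\<close>-close. The tails differ in their first letter, at level \<open>Suc n\<close>, so
  transversality applies with \<open>C (Suc n)\<close>. Distortion continuity replaces the norm at
  \<open>t\<close> by that at \<open>t0\<close>, at the price
  \<open>exp (real n * \<eta>)\<close>.\<close>

lemma transversal_measure_bound:
  assumes t0: "t0 \<in> U" and \<eta>: "0 < \<eta>"
  obtains d \<kappa> C where "0 < d" "cball t0 d \<subseteq> U" "0 < \<kappa>" "\<And>n. 1 \<le> n \<Longrightarrow> 0 < C n"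
    "(\<lambda>n. ln (C n) / real n) \<longlonglongrightarrow> 0"
    "\<And>n \<omega> \<tau> r. \<omega> \<in> inf_words I 1 \<Longrightarrow> \<tau> \<in> inf_words I 1 \<Longrightarrow> (\<And>j. j \<in> {1..n} \<Longrightarrow> \<omega> j = \<tau> j) \<Longrightarrow>
      \<omega> (Suc n) \<noteq> \<tau> (Suc n) \<Longrightarrow> 0 < r \<Longrightarrow>
      measure lebesgue {t\<in>cball t0 d. dist (address_map X \<phi> 1 t \<omega>) (address_map X \<phi> 1 t \<tau>) \<le> r}
        \<le> C (Suc n) * (\<kappa> * r * exp (real n * \<eta>) / conformal_sup (word_map \<phi> t0 1 n \<omega>) X) ^ CARD('m)"
proof -
  obtain d1 where d1: "d1 > 0"
    and dc: "\<And>t n j \<omega>. t \<in> U \<Longrightarrow> norm (t - t0) \<le> d1 \<Longrightarrow> 1 \<le> n \<Longrightarrow> 1 \<le> j \<Longrightarrow> \<omega> \<in> inf_words I n \<Longrightarrow>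
        conformal_sup (prefix_map \<phi> t0 n j \<omega>) X / conformal_sup (prefix_map \<phi> t n j \<omega>) X \<le> exp (real j * \<eta>)"
    using distortion_cont \<eta> t0 unfolding distortion_continuity_def by metis
  obtain d2 where d2: "d2 > 0" "cball t0 d2 \<subseteq> U" using U t0 open_contains_cball by metis
  define d where "d = min d1 d2"
  have d: "d > 0" "d \<le> d1" "cball t0 d \<subseteq> U" using d1 d2 by (auto simp: d_def)
  let ?G = "cball t0 d"
  have "continuous_on ?G K" by (rule continuous_on_subset[OF K(1) d(3)])
  from continuous_attains_sup[OF compact_cball _ this] obtain tm where tm: "tm \<in> ?G" "\<And>t. t \<in> ?G \<Longrightarrow> K t \<le> K tm"
    using d(1) by (metis centre_in_cball empty_iff less_imp_le)
  have Km: "K tm \<ge> 1" using tm(1) d(3) K(2) by blast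
  from address_separation obtain b where b: "0 < b"
    "\<forall>t n \<omega> \<tau>. t \<in> U \<longrightarrow> \<omega> \<in> inf_words I 1 \<longrightarrow> \<tau> \<in> inf_words I 1 \<longrightarrow> (\<forall>j\<in>{1..n}. \<omega> j = \<tau> j) \<longrightarrow>
      conformal_sup (word_map \<phi> t 1 n \<omega>) X / K t * b *
        dist (address_map X \<phi> (Suc n) t (restrict \<omega> {Suc n..})) (address_map X \<phi> (Suc n) t (restrict \<tau> {Suc n..}))
        \<le> dist (address_map X \<phi> 1 t \<omega>) (address_map X \<phi> 1 t \<tau>)"
    by (elim exE conjE)
  \<comment> \<open>Collects the constants lost in the pull-back: the maximum \<open>K tm\<close> of
    \<open>K\<close> on the closed ball and the separation constant \<open>b\<close>.\<close>
  define \<kappa> where "\<kappa> = K tm / b"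
  have \<kappa>: "\<kappa> > 0" using b Km by (simp add: \<kappa>_def)
  have "compact ?G \<and> ?G \<subseteq> U" using d(3) by simp
  from transversal[unfolded transversality_def, rule_format, OF this] obtain C where
    C0: "\<forall>n\<ge>1. 0 < C n" and C2: "(\<lambda>n. ln (C n) / real n) \<longlonglongrightarrow> 0" and
    C3: "\<forall>n\<ge>1. \<forall>\<omega>\<in>inf_words I n. \<forall>\<tau>\<in>inf_words I n. \<omega> n \<noteq> \<tau> n \<longrightarrow>
      (\<forall>r>0. emeasure lebesgue {t\<in>?G. norm (address_map X \<phi> n t \<omega> - address_map X \<phi> n t \<tau>) \<le> r}
         \<le> ennreal (C n * r ^ CARD('m)))"
    by (elim exE conjE)
  have C: "0 < C n" if "1 \<le> n" for n using C0 that by blast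
  show ?thesis
  proof (rule that[OF d(1,3) \<kappa> C C2])
    fix n and \<omega> \<tau> :: "nat \<Rightarrow> 'i" and r :: real
    assume \<omega>: "\<omega> \<in> inf_words I 1" and \<tau>: "\<tau> \<in> inf_words I 1" and eq: "\<And>j. j \<in> {1..n} \<Longrightarrow> \<omega> j = \<tau> j"
      and ne: "\<omega> (Suc n) \<noteq> \<tau> (Suc n)" and r: "0 < r"
    define a where "a t = conformal_sup (word_map \<phi> t 1 n \<omega>) X" for t
    have a: "a t > 0" if "t \<in> U" for t
      unfolding a_def by (intro conformal_sup_pos that admissible_inf_words[OF \<omega>]) auto
    have a_le: "a t0 \<le> exp (real n * \<eta>) * a t" if t: "t \<in> ?G" for t
    \<comment> \<open>Distortion continuity concerns prefixes of positive length; for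
      \<open>n = 0\<close> both maps are the identity.\<close>
    proof (cases "n = 0")
      case True
      then show ?thesis by (simp add: a_def)
    next
      case False
      have tU: "t \<in> U" using t d(3) by blast
      have "norm (t - t0) \<le> d1" using t d(2) by (simp add: dist_norm norm_minus_commute)
      then have "conformal_sup (prefix_map \<phi> t0 1 n \<omega>) X / conformal_sup (prefix_map \<phi> t 1 n \<omega>) X \<le> exp (real n * \<eta>)"
        using False by (intro dc tU \<omega>) auto
      then show ?thesis using a[OF tU] by (simp add: a_def prefix_map_def field_simps)
    qed
    let ?\<omega> = "restrict \<omega> {Suc n..}" and ?\<tau> = "restrict \<tau> {Suc n..}"
    define r' where "r' = \<kappa> * r * exp (real n * \<eta>) / a t0"
    have r': "r' > 0" using \<kappa> r a[OF t0] by (simp add: r'_def)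
    have r_inf: "?\<omega> \<in> inf_words I (Suc n)" "?\<tau> \<in> inf_words I (Suc n)"
      using \<omega> \<tau> by (auto intro: inf_words_restrict)
    define S where "S = {t\<in>?G. dist (address_map X \<phi> 1 t \<omega>) (address_map X \<phi> 1 t \<tau>) \<le> r}"
    define S' where "S' = {t\<in>?G. norm (address_map X \<phi> (Suc n) t ?\<omega> - address_map X \<phi> (Suc n) t ?\<tau>) \<le> r'}"
    have em: "emeasure lebesgue S' \<le> ennreal (C (Suc n) * r' ^ CARD('m))"
      unfolding S'_def using ne by (intro C3[rule_format] r_inf r') auto
    have sub: "S \<subseteq> S'"
    proof
      fix t assume tS: "t \<in> S"
      then have t: "t \<in> ?G" "dist (address_map X \<phi> 1 t \<omega>) (address_map X \<phi> 1 t \<tau>) \<le> r" by (auto simp: S_def)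
      have tU: "t \<in> U" using t d(3) by blast
      define D where "D = dist (address_map X \<phi> (Suc n) t ?\<omega>) (address_map X \<phi> (Suc n) t ?\<tau>)"
      have Kt: "K t > 0" using K(2)[OF tU] by simp
      have "a t / K t * b * D \<le> r"
        using b(2)[rule_format, OF tU \<omega> \<tau>, of n] eq t(2) unfolding a_def D_def by fastforce
      then have "a t * b * D \<le> r * K t" using Kt by (simp add: field_simps)
      also have "\<dots> \<le> r * K tm" using tm(2)[OF t(1)] r by simp
      finally have 1: "a t * (b * D) \<le> r * K tm" by (simp add: mult_ac)
      have "a t0 * (b * D) \<le> exp (real n * \<eta>) * a t * (b * D)"
        using a_le[OF t(1)] b(1) by (intro mult_right_mono) (auto simp: D_def)
      also have "\<dots> = exp (real n * \<eta>) * (a t * (b * D))" by (simp add: mult_ac)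
      also have "\<dots> \<le> exp (real n * \<eta>) * (r * K tm)" using 1 by (intro mult_left_mono) auto
      finally have "D \<le> r'" using a[OF t0] b(1) by (simp add: r'_def \<kappa>_def field_simps)
      then show "t \<in> S'" using t(1) by (simp add: S'_def D_def dist_norm)
    qed
    have S: "S \<in> lmeasurable"
      unfolding S_def by (intro lmeasurable_compact compact_coincidence_set d \<omega> \<tau>) auto
    \<comment> \<open>Needed because \<^const>\<open>emeasure\<close> is \<open>0\<close> on nonmeasurable sets, where transversality would say nothing.\<close>
    have S': "S' \<in> lmeasurable"
      unfolding S'_def using compact_coincidence_set[OF d(3) _ r_inf, of r']
      by (intro lmeasurable_compact) (simp add: dist_norm)
    have "measure lebesgue S \<le> measure lebesgue S'"
      using sub S S' by (intro measure_mono_fmeasurable) auto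
    also have "\<dots> \<le> C (Suc n) * r' ^ CARD('m)"
      using em S' C[of "Suc n"] r' by (simp add: emeasure_eq_measure2)
    finally show "measure lebesgue {t\<in>?G. dist (address_map X \<phi> 1 t \<omega>) (address_map X \<phi> 1 t \<tau>) \<le> r}
        \<le> C (Suc n) * (\<kappa> * r * exp (real n * \<eta>) / conformal_sup (word_map \<phi> t0 1 n \<omega>) X) ^ CARD('m)"
      by (simp add: S_def r'_def a_def)
  qed
qed

text \<open>Interpolation between a trivial bound \<open>L\<close> and a bound \<open>y\<close>.
  With \<open>\<theta> = s / m\<close> it turns the exponent \<open>m\<close> of transversality into
  \<open>s\<close>.\<close>

lemma le_max_mult_powr:
  fixes x y :: real
  assumes "0 \<le> x" "x \<le> L" "x \<le> y" "0 < \<theta>" "\<theta> \<le> 1"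
  shows "x \<le> max 1 L * y powr \<theta>"
proof (cases "y \<le> 1")
  case True
  have "x \<le> y powr 1" using assms by (cases "y = 0") auto
  also have "\<dots> \<le> y powr \<theta>" using assms True by (intro powr_mono') auto
  also have "\<dots> \<le> max 1 L * y powr \<theta>" by (simp add: mult_le_cancel_right1)
  finally show ?thesis .
next
  case False
  then have "1 \<le> y powr \<theta>" using assms by (intro ge_one_powr_ge_zero) auto
  then have "max 1 L * 1 \<le> max 1 L * y powr \<theta>" by (intro mult_left_mono) auto
  then show ?thesis using assms by simp
qed

section \<open>Partition sums and the weights of cylinders\<close>

lemma finite_fin_words: "1 \<le> n \<Longrightarrow> finite (fin_words I n k)"
  using finite_I unfolding fin_words_def by (intro finite_PiE) auto

lemma fin_words_nonempty: "1 \<le> n \<Longrightarrow> fin_words I n k \<noteq> {}"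
  using nonempty_I unfolding fin_words_def by (auto simp: PiE_eq_empty_iff)

lemma partition_sum_pos: "t \<in> U \<Longrightarrow> 0 < partition_sum X I \<phi> n t s"
  unfolding partition_sum_def
  by (intro sum_pos finite_fin_words fin_words_nonempty) (auto dest!: conformal_sup_pos[OF _ admissible_fin_words])

lemma sum_cylinder:
  assumes n: "n \<le> N" and u: "u \<in> fin_words I 1 n"
  shows "(\<Sum>v\<in>{v\<in>fin_words I 1 N. restrict v {1..n} = u}. g v) =
    (\<Sum>w\<in>fin_words I (Suc n) N. g (\<lambda>j. if j \<le> n then u j else w j))"
proof (rule sum.reindex_bij_witness[where i = "\<lambda>w j. if j \<le> n then u j else w j"
      and j = "\<lambda>v. restrict v {Suc n..N}"])
  fix v assume v: "v \<in> {v\<in>fin_words I 1 N. restrict v {1..n} = u}"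
  show eq: "(\<lambda>j. if j \<le> n then u j else restrict v {Suc n..N} j) = v"
  proof
    fix j
    have "v \<in> extensional {1..N}" using v by (auto simp: fin_words_def PiE_def)
    then show "(if j \<le> n then u j else restrict v {Suc n..N} j) = v j"
      using v n by (cases "j = 0") (auto simp: extensional_def)
  qed
  show "restrict v {Suc n..N} \<in> fin_words I (Suc n) N"
    using v by (auto simp: fin_words_def)
  show "g (\<lambda>j. if j \<le> n then u j else restrict v {Suc n..N} j) = g v" by (simp only: eq)
next
  fix w assume w: "w \<in> fin_words I (Suc n) N"
  have wu: "w \<in> extensional {Suc n..N}" "u \<in> extensional {1..n}"
    using w u by (auto simp: fin_words_def PiE_def)
  show "restrict (\<lambda>j. if j \<le> n then u j else w j) {Suc n..N} = w"
    using wu by (intro ext) (auto simp: extensional_def restrict_def)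
  have "restrict (\<lambda>j. if j \<le> n then u j else w j) {1..n} = u"
    using wu by (intro ext) (auto simp: extensional_def restrict_def)
  moreover have "(\<lambda>j. if j \<le> n then u j else w j) \<in> fin_words I 1 N"
    unfolding fin_words_def
  proof (rule PiE_I)
    fix j assume "j \<in> {1..N}"
    then show "(if j \<le> n then u j else w j) \<in> I j"
      using fin_words_mem[OF u] fin_words_mem[OF w] by auto
  next
    fix j assume "j \<notin> {1..N}"
    then show "(if j \<le> n then u j else w j) = undefined"
      using wu n by (cases "j = 0") (auto simp: extensional_def)
  qed
  ultimately show "(\<lambda>j. if j \<le> n then u j else w j) \<in> {v\<in>fin_words I 1 N. restrict v {1..n} = u}" by simp
qed

text \<open>A Gibbs-type upper bound obtained at finite level. The tail sum \<open>W\<close> does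
  not depend on the prefix, so submultiplicativity bounds the cylinder sum by \<open>W\<close> times
  the prefix norm to the power \<open>s\<close>, and supermultiplicativity bounds \<open>W\<close>
  itself.\<close>

lemma cylinder_weight_le:
  assumes t: "t \<in> U" and s: "0 \<le> s" and n: "n \<le> N" and u: "u \<in> fin_words I 1 n"
  shows "(\<Sum>v\<in>{v\<in>fin_words I 1 N. restrict v {1..n} = u}. conformal_sup (word_map \<phi> t 1 N v) X powr s)
    \<le> K t powr s * conformal_sup (word_map \<phi> t 1 n u) X powr s *
      (partition_sum X I \<phi> N t s / partition_sum X I \<phi> n t s)"
proof -
  let ?c = "\<lambda>k l w. conformal_sup (word_map \<phi> t k l w) X"
  let ?Z = "\<lambda>k. partition_sum X I \<phi> k t s"
  define W where "W = (\<Sum>w\<in>fin_words I (Suc n) N. ?c (Suc n) N w powr s)"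
  have Kt: "K t > 0" using K(2)[OF t] by simp
  have parts: "?c 1 n (\<lambda>j. if j \<le> n then u j else w j) = ?c 1 n u"
      "?c (Suc n) N (\<lambda>j. if j \<le> n then u j else w j) = ?c (Suc n) N w" for u w
    by (intro arg_cong2[where f = conformal_sup] word_map_cong refl; simp)+
  have adm: "admissible 1 N (\<lambda>j. if j \<le> n then u j else w j)"
    if "u \<in> fin_words I 1 n" "w \<in> fin_words I (Suc n) N" for u w
    using fin_words_mem[OF that(1)] fin_words_mem[OF that(2)] by (auto simp: admissible_def)
  have pos: "0 < ?c 1 n u" "0 < ?c (Suc n) N w"
    if "u \<in> fin_words I 1 n" "w \<in> fin_words I (Suc n) N" for u w
    using that n by (auto intro!: conformal_sup_pos t admissible_fin_words)
  have upper: "(\<Sum>v\<in>{v\<in>fin_words I 1 N. restrict v {1..n} = u}. ?c 1 N v powr s) \<le> ?c 1 n u powr s * W"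
    unfolding sum_cylinder[OF n u] W_def sum_distrib_left
  proof (rule sum_mono)
    fix w assume w: "w \<in> fin_words I (Suc n) N"
    let ?v = "\<lambda>j. if j \<le> n then u j else w j"
    have "?c 1 N ?v \<le> ?c 1 n u * ?c (Suc n) N w"
      using conformal_sup_submult[OF t adm[OF u w], of n] n unfolding parts by simp
    then have "?c 1 N ?v powr s \<le> (?c 1 n u * ?c (Suc n) N w) powr s"
      using s conformal_sup_pos[OF t adm[OF u w]] by (intro powr_mono2) auto
    then show "?c 1 N ?v powr s \<le> ?c 1 n u powr s * ?c (Suc n) N w powr s"
      using pos[OF u w] by (simp add: powr_mult)
  qed
  have lower: "?c 1 n u powr s * W \<le> K t powr s * (\<Sum>v\<in>{v\<in>fin_words I 1 N. restrict v {1..n} = u}. ?c 1 N v powr s)"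
    if u: "u \<in> fin_words I 1 n" for u
    unfolding sum_cylinder[OF n u] W_def sum_distrib_left
  proof (rule sum_mono)
    fix w assume w: "w \<in> fin_words I (Suc n) N"
    let ?v = "\<lambda>j. if j \<le> n then u j else w j"
    have "?c 1 n u * ?c (Suc n) N w \<le> K t * ?c 1 N ?v"
      using conformal_sup_supermult[OF t adm[OF u w], of n] n unfolding parts by simp
    then have "(?c 1 n u * ?c (Suc n) N w) powr s \<le> (K t * ?c 1 N ?v) powr s"
      using s pos[OF u w] by (intro powr_mono2) auto
    then show "?c 1 n u powr s * ?c (Suc n) N w powr s \<le> K t powr s * ?c 1 N ?v powr s"
      using pos[OF u w] Kt conformal_sup_pos[OF t adm[OF u w]] by (simp add: powr_mult)
  qed
  \<comment> \<open>Summing the lower estimate over all prefixes rebuilds \<open>?Z N\<close>, which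
    gives \<open>W \<le> K t powr s * (?Z N / ?Z n)\<close>.\<close>
  have "?Z n * W = (\<Sum>u\<in>fin_words I 1 n. ?c 1 n u powr s * W)"
    by (simp add: partition_sum_def sum_distrib_right)
  also have "\<dots> \<le> (\<Sum>u\<in>fin_words I 1 n. K t powr s *
      (\<Sum>v\<in>{v\<in>fin_words I 1 N. restrict v {1..n} = u}. ?c 1 N v powr s))"
    by (intro sum_mono lower)
  also have "\<dots> = K t powr s * ?Z N"
    unfolding sum_distrib_left[symmetric] partition_sum_def
    using n by (subst sum.group[OF finite_fin_words finite_fin_words]) (auto simp: fin_words_def)
  finally have "W \<le> K t powr s * (?Z N / ?Z n)"
    using partition_sum_pos[OF t, of n s] by (simp add: field_simps)
  then have "?c 1 n u powr s * W \<le> ?c 1 n u powr s * (K t powr s * (?Z N / ?Z n))"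
    by (intro mult_left_mono) auto
  with upper show ?thesis by (simp add: mult_ac)
qed

lemma lower_pressure_pos_growth:
  assumes t: "t \<in> U" and P: "0 < lower_pressure X I \<phi> t s"
  obtains \<epsilon> where "0 < \<epsilon>" "eventually (\<lambda>n. exp (real n * \<epsilon>) \<le> partition_sum X I \<phi> n t s) sequentially"
proof -
  obtain \<epsilon> where \<epsilon>: "0 < \<epsilon>" "ereal \<epsilon> < lower_pressure X I \<phi> t s"
    using ereal_dense2[OF P] by auto
  have "eventually (\<lambda>n. ereal \<epsilon> < ereal (1 / real n) * ext_ln (partition_sum X I \<phi> n t s)) sequentially"
    using \<epsilon>(2) unfolding lower_pressure_def by (rule less_LiminfD)
  then have "eventually (\<lambda>n. exp (real n * \<epsilon>) \<le> partition_sum X I \<phi> n t s) sequentially"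
    using eventually_gt_at_top[of 0]
  proof eventually_elim
    case (elim n)
    have Z: "partition_sum X I \<phi> n t s > 0" by (rule partition_sum_pos[OF t])
    then have "real n * \<epsilon> < ln (partition_sum X I \<phi> n t s)"
      using elim by (simp add: ext_ln_def field_simps)
    then have "exp (real n * \<epsilon>) \<le> exp (ln (partition_sum X I \<phi> n t s))" by simp
    then show ?case using Z by simp
  qed
  then show ?thesis using that \<epsilon>(1) by blast
qed

subsection \<open>The energy bound\<close>

definition weight :: "real^'d \<Rightarrow> real \<Rightarrow> nat \<Rightarrow> (nat \<Rightarrow> 'i) \<Rightarrow> real" where
  "weight t s N u = conformal_sup (word_map \<phi> t 1 N u) X powr s / partition_sum X I \<phi> N t s"

text \<open>One arbitrary point of the cylinder of \<open>u\<close>. It moves with \<open>t\<close>,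
  whereas the weights are later frozen at \<open>t0\<close>.\<close>

definition word_point :: "nat \<Rightarrow> real^'d \<Rightarrow> (nat \<Rightarrow> 'i) \<Rightarrow> real^'m" where
  "word_point N t u = address_map X \<phi> 1 t (extend 1 N u)"

lemma extend_fin_words: "u \<in> fin_words I 1 N \<Longrightarrow> extend 1 N u \<in> inf_words I 1"
  by (intro extend_inf_words admissible_fin_words) auto

lemma word_point_mem: "u \<in> fin_words I 1 N \<Longrightarrow> word_point N t u \<in> limit_set X I \<phi> t"
  unfolding word_point_def limit_set_def by (intro imageI extend_fin_words)

lemma weight_nonneg: "t \<in> U \<Longrightarrow> 0 \<le> weight t s N u"
  unfolding weight_def using partition_sum_pos[of t N s] by simp

lemma sum_weight: "t \<in> U \<Longrightarrow> (\<Sum>u\<in>fin_words I 1 N. weight t s N u) = 1"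
  using partition_sum_pos[of t N s] unfolding weight_def
  by (simp add: partition_sum_def flip: sum_divide_distrib)

lemma sum_weight_cylinder_le:
  assumes t: "t \<in> U" and s: "0 \<le> s" and n: "n \<le> N" and u: "u \<in> fin_words I 1 N"
  shows "(\<Sum>v\<in>{v\<in>fin_words I 1 N. restrict v {1..n} = restrict u {1..n}}. weight t s N v)
    \<le> K t powr s * conformal_sup (word_map \<phi> t 1 n u) X powr s / partition_sum X I \<phi> n t s"
proof -
  have r: "restrict u {1..n} \<in> fin_words I 1 n" using u n by (auto simp: fin_words_def)
  have eq: "word_map \<phi> t 1 n (restrict u {1..n}) = word_map \<phi> t 1 n u" by (rule word_map_cong) simp
  have Z: "partition_sum X I \<phi> N t s > 0" by (rule partition_sum_pos[OF t])
  show ?thesis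
    using divide_right_mono[OF cylinder_weight_le[OF t s n r], of "partition_sum X I \<phi> N t s"] Z
    unfolding eq weight_def by (simp add: sum_divide_distrib)
qed

lemma fin_words_first_difference:
  assumes "u \<in> fin_words I 1 N" "v \<in> fin_words I 1 N" "u \<noteq> v"
  obtains n where "n < N" "\<forall>j\<in>{1..n}. u j = v j" "u (Suc n) \<noteq> v (Suc n)"
proof -
  obtain j where j: "j \<in> {1..N}" "u j \<noteq> v j"
    using assms unfolding fin_words_def by (metis PiE_ext)
  then have ex: "u (Suc (j - 1)) \<noteq> v (Suc (j - 1))" by simp
  \<comment> \<open>The length of the common prefix; testing positions \<open>Suc k\<close> keeps
    index 0 out, which lies outside the domain of the words.\<close>
  define n where "n = (LEAST k. u (Suc k) \<noteq> v (Suc k))"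
  have "u (Suc n) \<noteq> v (Suc n)" unfolding n_def by (rule LeastI[of "\<lambda>k. u (Suc k) \<noteq> v (Suc k)", OF ex])
  moreover have "n < N"
  proof -
    have "n \<le> j - 1" unfolding n_def by (rule Least_le[of "\<lambda>k. u (Suc k) \<noteq> v (Suc k)", OF ex])
    with j(1) show ?thesis by auto
  qed
  moreover have "\<forall>j\<in>{1..n}. u j = v j"
  proof
    fix i assume i: "i \<in> {1..n}"
    then have "i - 1 < n" by auto
    from not_less_Least[OF this[unfolded n_def]] i show "u i = v i" by simp
  qed
  ultimately show ?thesis using that by blast
qed

lemma summable_geometric_bound:
  fixes f :: "nat \<Rightarrow> real"
  assumes "\<And>n. 0 \<le> f n" "eventually (\<lambda>n. f n \<le> c * exp (- e) ^ n) sequentially" "0 < e"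
  shows "summable f"
proof (rule summable_comparison_test_ev)
  show "summable (\<lambda>n. c * exp (- e) ^ n)" using assms(3) by (intro summable_mult summable_geometric) auto
  show "eventually (\<lambda>n. norm (f n) \<le> c * exp (- e) ^ n) sequentially" using assms(1,2) by simp
qed

text \<open>Pairs of words are sorted by the length \<open>n\<close> of their common prefix. The
  coincidence measure carries the prefix norm to the power \<open>- s\<close>, the weight of the
  words sharing the prefix carries it to the power \<open>s\<close>. The norms cancel and leave the
  summable sequence \<open>B n / ?Z n\<close>. Pairs of equal words are controlled by
  \<open>\<gamma> ^ N \<le> r\<close>.\<close>

lemma energy_bound:
  assumes t0: "t0 \<in> U" and s: "0 < s" "s \<le> real CARD('m)" and P: "0 < lower_pressure X I \<phi> t0 s"
  shows "\<exists>d>0. cball t0 d \<subseteq> U \<and> (\<exists>M>0. \<forall>N r. \<gamma> ^ N \<le> r \<longrightarrow>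
    (\<Sum>u\<in>fin_words I 1 N. \<Sum>v\<in>fin_words I 1 N. weight t0 s N u * weight t0 s N v *
      measure lebesgue {t\<in>cball t0 d. dist (word_point N t u) (word_point N t v) \<le> r}) \<le> M * r powr s)"
proof (rule lower_pressure_pos_growth[OF t0 P])
  fix \<epsilon> :: real
  assume \<epsilon>: "0 < \<epsilon>" and growth: "eventually (\<lambda>n. exp (real n * \<epsilon>) \<le> partition_sum X I \<phi> n t0 s) sequentially"
  \<comment> \<open>The distortion loss to the power \<open>s\<close> then grows at rate
    \<open>\<epsilon> / 4\<close>. The subexponential \<open>C n\<close> is allowed another
    \<open>\<epsilon> / 4\<close>, so half of the growth rate of the partition sums remains.\<close>
  define \<eta> where "\<eta> = \<epsilon> / (4 * s)"
  have \<eta>: "\<eta> > 0" "\<eta> * s = \<epsilon> / 4" using s \<epsilon> by (simp_all add: \<eta>_def)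
  show ?thesis
  proof (rule transversal_measure_bound[OF t0 \<eta>(1)])
    fix d \<kappa> :: real and C :: "nat \<Rightarrow> real"
    assume d: "0 < d" "cball t0 d \<subseteq> U" and \<kappa>: "0 < \<kappa>" and C: "\<And>n. 1 \<le> n \<Longrightarrow> 0 < C n"
      and Clim: "(\<lambda>n. ln (C n) / real n) \<longlonglongrightarrow> 0"
      and Cm: "\<And>n \<omega> \<tau> r. \<omega> \<in> inf_words I 1 \<Longrightarrow> \<tau> \<in> inf_words I 1 \<Longrightarrow> (\<And>j. j \<in> {1..n} \<Longrightarrow> \<omega> j = \<tau> j) \<Longrightarrow>
        \<omega> (Suc n) \<noteq> \<tau> (Suc n) \<Longrightarrow> 0 < r \<Longrightarrow>
        measure lebesgue {t\<in>cball t0 d. dist (address_map X \<phi> 1 t \<omega>) (address_map X \<phi> 1 t \<tau>) \<le> r}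
          \<le> C (Suc n) * (\<kappa> * r * exp (real n * \<eta>) / conformal_sup (word_map \<phi> t0 1 n \<omega>) X) ^ CARD('m)"
    let ?m = "CARD('m)"
    let ?Z = "\<lambda>n. partition_sum X I \<phi> n t0 s"
    let ?a = "\<lambda>n u. conformal_sup (word_map \<phi> t0 1 n u) X"
    define \<theta> where "\<theta> = s / real ?m"
    have \<theta>: "0 < \<theta>" "\<theta> \<le> 1" using s by (simp_all add: \<theta>_def)
    define A where "A = max 1 (measure lebesgue (cball t0 d))"
    have A: "A \<ge> 1" by (simp add: A_def)
    \<comment> \<open>The part of the interpolated transversality bound that remains after removing
      \<open>r powr s\<close> and the prefix norm.\<close>
    define B where "B n = A * (C (Suc n) powr \<theta> * (\<kappa> * exp (real n * \<eta>)) powr s)" for n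
    have B_nonneg: "0 \<le> B n" for n using A by (simp add: B_def)
    have Z: "?Z n > 0" for n by (rule partition_sum_pos[OF t0])
    define meas where "meas N r u v =
      measure lebesgue {t\<in>cball t0 d. dist (word_point N t u) (word_point N t v) \<le> r}" for N r u v
    have meas_le_G: "meas N r u v \<le> measure lebesgue (cball t0 d)" if "u \<in> fin_words I 1 N" "v \<in> fin_words I 1 N" for N r u v
    proof -
      have "{t\<in>cball t0 d. dist (word_point N t u) (word_point N t v) \<le> r} \<in> lmeasurable"
        unfolding word_point_def
        by (intro lmeasurable_compact compact_coincidence_set d(2) extend_fin_words that order_refl)
      then show ?thesis
        unfolding meas_def by (intro measure_mono_fmeasurable) auto
    qed
    have meas_le_A: "meas N r u v \<le> A" if "u \<in> fin_words I 1 N" "v \<in> fin_words I 1 N" for N r u v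
      using meas_le_G[OF that, of r] unfolding A_def by linarith
    have meas_le_B: "meas N r u v \<le> B n * r powr s / ?a n u powr s"
      if uv: "u \<in> fin_words I 1 N" "v \<in> fin_words I 1 N" and n: "n < N" "\<forall>j\<in>{1..n}. u j = v j"
        "u (Suc n) \<noteq> v (Suc n)" and r: "0 < r" for N r u v n
    proof -
      have eq: "word_map \<phi> t0 1 n (extend 1 N u) = word_map \<phi> t0 1 n u"
        using n by (intro word_map_cong extend_eq) auto
      have "admissible 1 n u" using uv(1) n(1) by (intro admissible_mono[OF admissible_fin_words]) auto
      then have a: "?a n u > 0" by (rule conformal_sup_pos[OF t0])
      define y where "y = C (Suc n) * (\<kappa> * r * exp (real n * \<eta>) / ?a n u) ^ ?m"
      have le_y: "meas N r u v \<le> y"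
        unfolding meas_def word_point_def y_def eq[symmetric]
        using n by (intro Cm extend_fin_words uv r) (auto simp: extend_eq)
      have "meas N r u v \<le> A * y powr \<theta>"
        unfolding A_def by (rule le_max_mult_powr[OF _ meas_le_G[OF uv] le_y \<theta>]) (simp add: meas_def)
      also have "y powr \<theta> = C (Suc n) powr \<theta> * (\<kappa> * r * exp (real n * \<eta>) / ?a n u) powr s"
      proof -
        have "0 < \<kappa> * r * exp (real n * \<eta>) / ?a n u" using \<kappa> r a by simp
        then have "((\<kappa> * r * exp (real n * \<eta>) / ?a n u) ^ ?m) powr \<theta> = (\<kappa> * r * exp (real n * \<eta>) / ?a n u) powr s"
          by (subst powr_realpow[symmetric]) (auto simp: powr_powr \<theta>_def)
        then show ?thesis
          using C[of "Suc n"] \<open>0 < \<kappa> * r * exp (real n * \<eta>) / ?a n u\<close> unfolding y_def by (subst powr_mult) auto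
      qed
      also have "A * (C (Suc n) powr \<theta> * (\<kappa> * r * exp (real n * \<eta>) / ?a n u) powr s) = B n * r powr s / ?a n u powr s"
        using \<kappa> r a by (simp add: B_def powr_mult powr_divide)
      finally show ?thesis .
    qed
    have sum1: "summable (\<lambda>n. 1 / ?Z n)"
    proof (rule summable_geometric_bound)
      show "eventually (\<lambda>n. 1 / ?Z n \<le> 1 * exp (- \<epsilon>) ^ n) sequentially"
        using growth
      proof eventually_elim
        case (elim n)
        have "1 / ?Z n \<le> 1 / exp (real n * \<epsilon>)" using elim by (intro divide_left_mono) (auto simp: Z)
        also have "\<dots> = 1 * exp (- \<epsilon>) ^ n" by (simp add: exp_minus exp_of_nat_mult power_one_over inverse_eq_divide)
        finally show ?case .
      qed
    qed (use Z \<epsilon> in \<open>auto intro: less_imp_le\<close>)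
    have sum2: "summable (\<lambda>n. B n / ?Z n)"
    proof (rule summable_geometric_bound)
      have "(\<lambda>n. ln (C (Suc n)) / real (Suc n)) \<longlonglongrightarrow> 0" using Clim by (rule LIMSEQ_Suc)
      then have "eventually (\<lambda>n. ln (C (Suc n)) / real (Suc n) < \<epsilon> / 4) sequentially"
        using \<epsilon> by (intro order_tendstoD(2)) auto
      then show "eventually (\<lambda>n. B n / ?Z n \<le> (A * \<kappa> powr s * exp (\<epsilon> / 4)) * exp (- (\<epsilon> / 2)) ^ n) sequentially"
        using growth
      proof eventually_elim
        case (elim n)
        have "ln (C (Suc n)) \<le> (\<epsilon> / 4) * real (Suc n)"
          using elim(1) by (simp add: pos_divide_less_eq del: of_nat_Suc)
        then have "exp (ln (C (Suc n))) \<le> exp ((\<epsilon> / 4) * real (Suc n))" by (simp only: exp_le_cancel_iff)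
        then have "C (Suc n) \<le> exp ((\<epsilon> / 4) * real (Suc n))" using C[of "Suc n"] by (subst (asm) exp_ln) auto
        then have "C (Suc n) powr \<theta> \<le> exp ((\<epsilon> / 4) * real (Suc n)) powr \<theta>"
          using C[of "Suc n"] \<theta> by (intro powr_mono2) (auto intro: less_imp_le)
        also have "\<dots> \<le> exp ((\<epsilon> / 4) * real (Suc n)) powr 1"
          using \<theta> \<epsilon> by (intro powr_mono) auto
        also have "\<dots> = exp (\<epsilon> / 4 + real n * (\<epsilon> / 4))"
        proof -
          have "(\<epsilon> / 4) * real (Suc n) = \<epsilon> / 4 + real n * (\<epsilon> / 4)" by (simp add: field_simps)
          then show ?thesis by simp
        qed
        finally have c1: "C (Suc n) powr \<theta> \<le> exp (\<epsilon> / 4 + real n * (\<epsilon> / 4))" .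
        have c2: "(\<kappa> * exp (real n * \<eta>)) powr s = \<kappa> powr s * exp (real n * (\<epsilon> / 4))"
          using \<kappa> \<eta>(2) by (simp add: powr_mult exp_powr_real mult.assoc)
        have "B n \<le> A * (exp (\<epsilon> / 4 + real n * (\<epsilon> / 4)) * (\<kappa> powr s * exp (real n * (\<epsilon> / 4))))"
          unfolding B_def c2 by (intro mult_left_mono mult_right_mono c1) (use A in auto)
        also have "\<dots> = (A * \<kappa> powr s * exp (\<epsilon> / 4)) * exp (real n * (\<epsilon> / 2))"
        proof -
          have "exp (\<epsilon> / 4 + real n * (\<epsilon> / 4)) * exp (real n * (\<epsilon> / 4)) = exp (\<epsilon> / 4) * exp (real n * (\<epsilon> / 2))"
            by (simp flip: exp_add)
          then show ?thesis by (metis mult.assoc mult.left_commute)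
        qed
        finally have "B n / ?Z n \<le> (A * \<kappa> powr s * exp (\<epsilon> / 4)) * exp (real n * (\<epsilon> / 2)) / exp (real n * \<epsilon>)"
          using elim(2) A by (intro frac_le) auto
        also have "\<dots> = (A * \<kappa> powr s * exp (\<epsilon> / 4)) * exp (- (\<epsilon> / 2)) ^ n"
        proof -
          have "exp (real n * (\<epsilon> / 2)) / exp (real n * \<epsilon>) = exp (- (\<epsilon> / 2)) ^ n"
            by (simp flip: exp_diff exp_of_nat_mult)
          then show ?thesis by (metis times_divide_eq_right)
        qed
        finally show ?case .
      qed
    qed (use Z B_nonneg \<epsilon> in \<open>auto intro: less_imp_le divide_nonneg_pos\<close>)
    \<comment> \<open>Full series, so that \<open>M\<close> depends on neither \<open>N\<close> nor
      \<open>r\<close>. The first term serves the diagonal, the second the pairs that split.\<close>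
    define M where "M = A * (\<Sum>n. 1 / ?Z n) + K t0 powr s * (\<Sum>n. B n / ?Z n)"
    have row: "(\<Sum>v\<in>fin_words I 1 N. weight t0 s N v * meas N r u v) \<le> M * r powr s"
      if r: "\<gamma> ^ N \<le> r" and u: "u \<in> fin_words I 1 N" for N r u
    proof -
      have r0: "r > 0" using r \<gamma> by (meson order_less_le_trans zero_less_power)
      let ?F = "fin_words I 1 N" and ?w = "weight t0 s N"
      define c where "c n = B n * r powr s / ?a n u powr s" for n
      have c: "0 \<le> c n" for n using B_nonneg by (simp add: c_def)
      have a: "?a n u > 0" if "n \<le> N" for n
        using u that by (intro conformal_sup_pos t0 admissible_mono[OF admissible_fin_words[OF u]]) auto
      let ?agree = "\<lambda>n v. restrict v {1..n} = restrict u {1..n}"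
      \<comment> \<open>Each \<open>v\<close> other than \<open>u\<close> needs only the term of its
        splitting level. Adding the nonnegative terms of all shorter common prefixes turns the inner
        sums into cylinder weights.\<close>
      have "(\<Sum>v\<in>?F. ?w v * meas N r u v)
          \<le> (\<Sum>v\<in>?F. of_bool (v = u) * (?w u * A) + (\<Sum>n<N. of_bool (?agree n v) * (?w v * c n)))"
      proof (rule sum_mono)
        fix v assume v: "v \<in> ?F"
        have terms: "0 \<le> of_bool (?agree n v) * (?w v * c n)" for n
          using c weight_nonneg[OF t0] by simp
        show "?w v * meas N r u v \<le> of_bool (v = u) * (?w u * A) + (\<Sum>n<N. of_bool (?agree n v) * (?w v * c n))"
        proof (cases "v = u")
          case True
          have "?w u * meas N r u u \<le> ?w u * A"
            by (intro mult_left_mono meas_le_A u weight_nonneg t0)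
          moreover have "0 \<le> (\<Sum>n<N. of_bool (?agree n v) * (?w v * c n))" by (intro sum_nonneg terms)
          ultimately show ?thesis using True by simp
        next
          case False
          then obtain n where n: "n < N" "\<forall>j\<in>{1..n}. u j = v j" "u (Suc n) \<noteq> v (Suc n)"
            using fin_words_first_difference[OF u v] by metis
          have ag: "?agree n v" using n(2) by (auto simp: restrict_def)
          have "?w v * meas N r u v \<le> ?w v * c n"
            unfolding c_def by (intro mult_left_mono meas_le_B u v n r0 weight_nonneg t0)
          also have "\<dots> = of_bool (?agree n v) * (?w v * c n)" using ag by simp
          also have "\<dots> \<le> (\<Sum>n<N. of_bool (?agree n v) * (?w v * c n))"
            by (rule member_le_sum[where f = "\<lambda>n. of_bool (?agree n v) * (?w v * c n)"]) (use n terms in auto)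
          finally show ?thesis using False by simp
        qed
      qed
      also have "\<dots> = ?w u * A + (\<Sum>n<N. \<Sum>v\<in>?F. of_bool (?agree n v) * (?w v * c n))"
      proof -
        have "(\<Sum>v\<in>?F. of_bool (v = u) * (?w u * A)) = (\<Sum>v\<in>?F. if v = u then ?w u * A else 0)"
          by (rule sum.cong) auto
        also have "\<dots> = ?w u * A" using u finite_fin_words[of 1 N] by (simp add: sum.delta)
        finally show ?thesis by (simp only: sum.distrib sum.swap[of _ "{..<N}" ?F])
      qed
      \<comment> \<open>On the diagonal the coincidence set has no decay in \<open>r\<close>; the
        decay comes from the weight, whose norm is at most
        \<open>\<gamma> ^ N \<le> r\<close>.\<close>
      also have "?w u * A \<le> (A * (\<Sum>n. 1 / ?Z n)) * r powr s"
      proof -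
        have "?a N u \<le> \<gamma> ^ N" using conformal_sup_le[OF t0 admissible_fin_words[OF u]] by simp
        then have "?a N u powr s \<le> r powr s" using r s a[of N] by (intro powr_mono2) auto
        then have "?w u \<le> r powr s * (1 / ?Z N)" unfolding weight_def using Z[of N] by (simp add: divide_right_mono)
        also have "1 / ?Z N \<le> (\<Sum>n. 1 / ?Z n)"
          using sum_le_suminf[OF sum1, of "{N}"] Z by (auto intro: less_imp_le)
        finally have "?w u \<le> r powr s * (\<Sum>n. 1 / ?Z n)" by (simp add: mult_left_mono)
        then have "A * ?w u \<le> A * (r powr s * (\<Sum>n. 1 / ?Z n))" using A by (intro mult_left_mono) auto
        then show ?thesis by (simp add: mult_ac)
      qed
      also have "(\<Sum>n<N. \<Sum>v\<in>?F. of_bool (?agree n v) * (?w v * c n)) \<le> (K t0 powr s * (\<Sum>n. B n / ?Z n)) * r powr s"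
      proof -
        have "(\<Sum>n<N. \<Sum>v\<in>?F. of_bool (?agree n v) * (?w v * c n)) \<le> (\<Sum>n<N. K t0 powr s * r powr s * (B n / ?Z n))"
        proof (rule sum_mono)
          fix n assume "n \<in> {..<N}"
          then have n: "n \<le> N" by simp
          have "(\<Sum>v\<in>?F. of_bool (?agree n v) * (?w v * c n)) = (\<Sum>v\<in>?F. if ?agree n v then ?w v else 0) * c n"
            unfolding sum_distrib_right by (rule sum.cong) auto
          also have "(\<Sum>v\<in>?F. if ?agree n v then ?w v else 0) = (\<Sum>v\<in>{v\<in>?F. ?agree n v}. ?w v)"
            using finite_fin_words[of 1 N] by (simp add: sum.inter_filter)
          also have "\<dots> * c n \<le> (K t0 powr s * ?a n u powr s / ?Z n) * c n"
            using s by (intro mult_right_mono c sum_weight_cylinder_le t0 n u) auto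
          also have "\<dots> = K t0 powr s * r powr s * (B n / ?Z n)"
            using a[OF n] by (simp add: c_def)
          finally show "(\<Sum>v\<in>?F. of_bool (?agree n v) * (?w v * c n)) \<le> K t0 powr s * r powr s * (B n / ?Z n)" .
        qed
        also have "\<dots> = K t0 powr s * r powr s * (\<Sum>n<N. B n / ?Z n)" by (simp add: sum_distrib_left)
        also have "\<dots> \<le> K t0 powr s * r powr s * (\<Sum>n. B n / ?Z n)"
          using sum2 B_nonneg Z by (intro mult_left_mono sum_le_suminf) (auto intro: less_imp_le divide_nonneg_pos)
        finally show ?thesis by (simp add: mult_ac)
      qed
      finally show ?thesis by (simp add: M_def distrib_right)
    qed
    have M: "0 < M"
    proof -
      have "0 < (\<Sum>n. 1 / ?Z n)" using sum1 Z by (intro suminf_pos) auto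
      moreover have "0 \<le> (\<Sum>n. B n / ?Z n)"
        using sum2 B_nonneg Z by (intro suminf_nonneg) (auto intro: less_imp_le divide_nonneg_pos)
      ultimately show ?thesis using A unfolding M_def by (intro add_pos_nonneg mult_pos_pos mult_nonneg_nonneg) auto
    qed
    have "(\<Sum>u\<in>fin_words I 1 N. \<Sum>v\<in>fin_words I 1 N. weight t0 s N u * weight t0 s N v * meas N r u v) \<le> M * r powr s"
      if r: "\<gamma> ^ N \<le> r" for N r
    proof -
      have "(\<Sum>u\<in>fin_words I 1 N. \<Sum>v\<in>fin_words I 1 N. weight t0 s N u * weight t0 s N v * meas N r u v)
        = (\<Sum>u\<in>fin_words I 1 N. weight t0 s N u * (\<Sum>v\<in>fin_words I 1 N. weight t0 s N v * meas N r u v))"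
        by (simp add: sum_distrib_left mult.assoc)
      also have "\<dots> \<le> (\<Sum>u\<in>fin_words I 1 N. weight t0 s N u * (M * r powr s))"
        by (intro sum_mono mult_left_mono row r weight_nonneg t0)
      also have "\<dots> = M * r powr s" using sum_weight[OF t0, of s N] by (simp flip: sum_distrib_right)
      finally show ?thesis .
    qed
    then show ?thesis using d M unfolding meas_def by blast
  qed
qed

subsection \<open>Dimension and measure of the limit set\<close>

text \<open>The supremum only yields some larger exponent with positive pressure. All norms are at
  most 1, so partition sums, and with them the pressure, decrease in the exponent.\<close>

lemma lower_pressure_pos:
  assumes t: "t \<in> U" and s: "0 \<le> s" "ennreal s < bowen_dim X I \<phi> t"
  shows "0 < lower_pressure X I \<phi> t s"
proof -
  obtain s1 where s1: "0 \<le> s1" "0 < lower_pressure X I \<phi> t s1" "ennreal s < ennreal s1"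
    using s(2) unfolding bowen_dim_def less_Sup_iff by blast
  have le: "s \<le> s1" using s1 s(1) by (simp add: ennreal_less_iff)
  have "ereal (1 / real n) * ext_ln (partition_sum X I \<phi> n t s1) \<le> ereal (1 / real n) * ext_ln (partition_sum X I \<phi> n t s)" for n
  proof -
    have "partition_sum X I \<phi> n t s1 \<le> partition_sum X I \<phi> n t s"
      unfolding partition_sum_def
    proof (rule sum_mono)
      fix u assume "u \<in> fin_words I 1 n"
      then have adm: "admissible 1 n u" by (intro admissible_fin_words) auto
      have "conformal_sup (word_map \<phi> t 1 n u) X \<le> 1"
        using conformal_sup_le[OF t adm] power_le_one[of \<gamma> n] \<gamma> by simp
      then show "conformal_sup (word_map \<phi> t 1 n u) X powr s1 \<le> conformal_sup (word_map \<phi> t 1 n u) X powr s"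
        using conformal_sup_pos[OF t adm] le by (intro powr_mono') auto
    qed
    moreover have "0 < partition_sum X I \<phi> n t s1" by (rule partition_sum_pos[OF t])
    ultimately have "ext_ln (partition_sum X I \<phi> n t s1) \<le> ext_ln (partition_sum X I \<phi> n t s)"
      by (simp add: ext_ln_def)
    then show ?thesis by (intro ereal_mult_left_mono) auto
  qed
  then have "lower_pressure X I \<phi> t s1 \<le> lower_pressure X I \<phi> t s"
    unfolding lower_pressure_def by (intro Liminf_mono always_eventually allI)
  with s1(2) show ?thesis by simp
qed

text \<open>At an exponent \<open>s1\<close> strictly between the Bowen dimension and
  \<open>s\<close> the pressure is at most 0. The spare exponent \<open>s - s1\<close> contributes
  the factor \<open>\<gamma> powr (n * (s - s1))\<close>, which defeats the slow growth of the
  partition sum along a subsequence.\<close>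

lemma hausdorff_measure_limit_set_eq_0:
  assumes t: "t \<in> U" and s: "0 < s" and b: "bowen_dim X I \<phi> t < ennreal s"
  shows "hausdorff_measure s (limit_set X I \<phi> t) = 0"
proof (rule hausdorff_measure_eq_0I[OF s])
  fix e :: real assume e: "0 < e"
  obtain x where x: "bowen_dim X I \<phi> t < x" "x < ennreal s" using dense[OF b] by blast
  then obtain s1 where s1: "x = ennreal s1" "0 \<le> s1" by (cases x) auto
  have s1s: "s1 < s" using x(2) s1 s by (simp add: ennreal_less_iff)
  have P: "lower_pressure X I \<phi> t s1 \<le> 0"
  proof (rule ccontr)
    assume "\<not> ?thesis"
    then have "ennreal s1 \<le> bowen_dim X I \<phi> t"
      unfolding bowen_dim_def using s1(2) by (intro Sup_upper) auto
    then show False using x(1) s1(1) by simp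
  qed
  \<comment> \<open>Half the decay rate from the spare exponent: growth
    \<open>exp (real n * c)\<close> against decay \<open>exp (- 2 * (real n * c))\<close> leaves
    \<open>exp (- c) ^ n\<close>.\<close>
  define c where "c = - ((s - s1) * ln \<gamma>) / 2"
  have c: "c > 0" using s1s \<gamma> by (simp add: c_def mult_less_0_iff)
  define D where "D = diameter X"
  have D: "D \<ge> 0" unfolding D_def by (intro diameter_ge_0 compact_imp_bounded X)
  \<comment> \<open>A lower limit controls only infinitely many lengths, which suffices because one
    good cover per \<open>e\<close> is needed.\<close>
  have freq: "frequently (\<lambda>n. ereal (1 / real n) * ext_ln (partition_sum X I \<phi> n t s1) < ereal c) sequentially"
  proof (rule ccontr)
    assume "\<not> ?thesis"
    then have "eventually (\<lambda>n. ereal c \<le> ereal (1 / real n) * ext_ln (partition_sum X I \<phi> n t s1)) sequentially"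
      by (simp add: not_frequently not_less)
    then have "ereal c \<le> lower_pressure X I \<phi> t s1" unfolding lower_pressure_def by (rule Liminf_bounded)
    then have "ereal c \<le> 0" using P by (rule order_trans)
    then show False using c by simp
  qed
  have "(\<lambda>n. D powr s * exp (- c) ^ n) \<longlonglongrightarrow> 0"
    using c by (intro tendsto_mult_right_zero LIMSEQ_realpow_zero) auto
  then have ev1: "eventually (\<lambda>n. D powr s * exp (- c) ^ n < e) sequentially"
    using e by (rule order_tendstoD(2))
  have "(\<lambda>n. \<gamma> ^ n * D) \<longlonglongrightarrow> 0"
    using \<gamma> by (intro tendsto_mult_left_zero LIMSEQ_realpow_zero) auto
  then have ev2: "eventually (\<lambda>n. \<gamma> ^ n * D < e) sequentially" using e by (rule order_tendstoD(2))
  have "frequently (\<lambda>n. ereal (1 / real n) * ext_ln (partition_sum X I \<phi> n t s1) < ereal c \<and>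
      (D powr s * exp (- c) ^ n < e \<and> \<gamma> ^ n * D < e \<and> 0 < n)) sequentially"
    by (rule frequently_eventually_frequently[OF freq]) (intro eventually_conj ev1 ev2 eventually_gt_at_top)
  from frequently_ex[OF this] obtain n where n: "ereal (1 / real n) * ext_ln (partition_sum X I \<phi> n t s1) < ereal c"
      "D powr s * exp (- c) ^ n < e" "\<gamma> ^ n * D < e" "0 < n"
    by (elim exE conjE)
  let ?c = "\<lambda>u. conformal_sup (word_map \<phi> t 1 n u) X"
  have Z: "partition_sum X I \<phi> n t s1 > 0" by (rule partition_sum_pos[OF t])
  then have "ln (partition_sum X I \<phi> n t s1) < real n * c" using n(1,4) by (simp add: ext_ln_def field_simps)
  then have Zlt: "partition_sum X I \<phi> n t s1 < exp (real n * c)" using Z by (metis exp_less_cancel_iff exp_ln)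
  have cu: "0 < ?c u" "?c u \<le> \<gamma> ^ n" if "u \<in> fin_words I 1 n" for u
    using conformal_sup_pos[OF t admissible_fin_words[OF that]] conformal_sup_le[OF t admissible_fin_words[OF that]] by auto
  have "(\<Sum>u\<in>fin_words I 1 n. (?c u * D) powr s) \<le> e"
  proof -
    have "(\<Sum>u\<in>fin_words I 1 n. (?c u * D) powr s) \<le> (\<Sum>u\<in>fin_words I 1 n. D powr s * (exp (- 2 * (real n * c)) * ?c u powr s1))"
    proof (rule sum_mono)
      fix u assume u: "u \<in> fin_words I 1 n"
      have "?c u powr s = ?c u powr (s - s1) * ?c u powr s1" by (simp flip: powr_add)
      also have "?c u powr (s - s1) \<le> (\<gamma> ^ n) powr (s - s1)"
        using cu[OF u] s1s by (intro powr_mono2) auto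
      also have "(\<gamma> ^ n) powr (s - s1) = exp (- 2 * (real n * c))"
        using \<gamma> by (simp add: powr_def ln_realpow c_def field_simps)
      finally have "?c u powr s \<le> exp (- 2 * (real n * c)) * ?c u powr s1" by (simp add: mult_right_mono)
      then have "D powr s * ?c u powr s \<le> D powr s * (exp (- 2 * (real n * c)) * ?c u powr s1)"
        by (intro mult_left_mono) auto
      then show "(?c u * D) powr s \<le> D powr s * (exp (- 2 * (real n * c)) * ?c u powr s1)"
        using cu[OF u] D by (simp add: powr_mult mult.commute)
    qed
    also have "\<dots> = D powr s * (exp (- 2 * (real n * c)) * partition_sum X I \<phi> n t s1)"
      by (simp add: partition_sum_def sum_distrib_left)
    also have "\<dots> \<le> D powr s * (exp (- 2 * (real n * c)) * exp (real n * c))"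
      using Zlt by (intro mult_left_mono) auto
    also have "exp (- 2 * (real n * c)) * exp (real n * c) = exp (- c) ^ n"
      by (simp flip: exp_add exp_of_nat_mult)
    finally show ?thesis using n(2) by simp
  qed
  moreover have "limit_set X I \<phi> t \<subseteq> (\<Union>u\<in>fin_words I 1 n. word_map \<phi> t 1 n u ` X)"
  proof
    fix x assume "x \<in> limit_set X I \<phi> t"
    then obtain \<omega> where \<omega>: "\<omega> \<in> inf_words I 1" "x = address_map X \<phi> 1 t \<omega>" by (auto simp: limit_set_def)
    have "x \<in> word_map \<phi> t 1 n \<omega> ` X" unfolding \<omega>(2) using n(4) by (intro address_map_mem t \<omega>) auto
    also have "word_map \<phi> t 1 n \<omega> = word_map \<phi> t 1 n (restrict \<omega> {1..n})" by (rule word_map_cong) simp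
    finally show "x \<in> (\<Union>u\<in>fin_words I 1 n. word_map \<phi> t 1 n u ` X)"
      using \<omega>(1) by (intro UN_I[of "restrict \<omega> {1..n}"]) (auto simp: fin_words_def inf_words_def)
  qed
  moreover have "bounded (word_map \<phi> t 1 n u ` X) \<and> diameter (word_map \<phi> t 1 n u ` X) \<le> ?c u * D \<and> ?c u * D \<le> e"
    if u: "u \<in> fin_words I 1 n" for u
  proof -
    have adm: "admissible 1 n u" using u by (intro admissible_fin_words) auto
    have "bounded (word_map \<phi> t 1 n u ` X)"
      by (rule bounded_subset[OF compact_imp_bounded[OF X(2)] word_map_conformal(1)[OF t adm]])
    moreover have "diameter (word_map \<phi> t 1 n u ` X) \<le> ?c u * D"
      using word_map_dist_le'[OF t adm] X(1) by (intro diameter_le) (auto simp: D_def dist_norm)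
    moreover have "?c u * D \<le> \<gamma> ^ n * D" using cu[OF u] D by (intro mult_right_mono) auto
    ultimately show ?thesis using n(3) by simp
  qed
  ultimately show "\<exists>(T::(nat \<Rightarrow> 'i) set) C d. finite T \<and> limit_set X I \<phi> t \<subseteq> (\<Union>i\<in>T. C i) \<and>
      (\<forall>i\<in>T. bounded (C i) \<and> diameter (C i) \<le> d i \<and> d i \<le> e) \<and> (\<Sum>i\<in>T. d i powr s) \<le> e"
    using finite_fin_words[of 1 n]
    by (intro exI[of _ "fin_words I 1 n"] exI[of _ "\<lambda>u. word_map \<phi> t 1 n u ` X"] exI[of _ "\<lambda>u. ?c u * D"]) auto
qed

lemma hausdorff_dim_limit_set_le:
  assumes t: "t \<in> U"
  shows "hausdorff_dim (limit_set X I \<phi> t) \<le> min (of_nat CARD('m)) (bowen_dim X I \<phi> t)"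
proof (rule hausdorff_dim_leI)
  fix s :: real assume s: "min (of_nat CARD('m)) (bowen_dim X I \<phi> t) < ennreal s" "0 < s"
  show "hausdorff_measure s (limit_set X I \<phi> t) = 0"
  proof (cases "bowen_dim X I \<phi> t < ennreal s")
    case True
    then show ?thesis by (rule hausdorff_measure_limit_set_eq_0[OF t s(2)])
  next
    case False
    then have "of_nat CARD('m) < ennreal s" using s(1) by (simp add: min_less_iff_disj)
    then have "ennreal (real CARD('m)) < ennreal s" by (simp only: ennreal_of_nat_eq_real_of_nat)
    then have "real CARD('m) < s" by (subst (asm) ennreal_less_iff) auto
    then show ?thesis by (intro hausdorff_measure_bounded_eq_0 compact_imp_bounded compact_limit_set t)
  qed
qed

section \<open>Correlation sums and the almost-everywhere lower bounds\<close>

text \<open>The ball is built into the indicator, so this is integrable over the whole space; on the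
  ball it is the correlation sum of the configuration at \<open>t\<close>.\<close>

definition correlation :: "real^'d \<Rightarrow> real \<Rightarrow> real \<Rightarrow> nat \<Rightarrow> real \<Rightarrow> real^'d \<Rightarrow> real" where
  "correlation t0 s d N r t = (\<Sum>u\<in>fin_words I 1 N. \<Sum>v\<in>fin_words I 1 N. weight t0 s N u * weight t0 s N v *
      indicat_real {t\<in>cball t0 d. dist (word_point N t u) (word_point N t v) \<le> r} t)"

lemma correlation_nonneg: "t0 \<in> U \<Longrightarrow> 0 \<le> correlation t0 s d N r t"
  unfolding correlation_def by (intro sum_nonneg mult_nonneg_nonneg weight_nonneg) auto

lemma correlation_eq: "t \<in> cball t0 d \<Longrightarrow> correlation t0 s d N r t =
    (\<Sum>u\<in>fin_words I 1 N. \<Sum>v\<in>fin_words I 1 N. weight t0 s N u * weight t0 s N v *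
      of_bool (dist (word_point N t u) (word_point N t v) \<le> r))"
  unfolding correlation_def by (intro sum.cong refl) (auto simp: indicator_def)

lemma has_integral_correlation:
  assumes "cball t0 d \<subseteq> U"
  shows "has_bochner_integral lebesgue (correlation t0 s d N r)
    (\<Sum>u\<in>fin_words I 1 N. \<Sum>v\<in>fin_words I 1 N. weight t0 s N u * weight t0 s N v *
      measure lebesgue {t\<in>cball t0 d. dist (word_point N t u) (word_point N t v) \<le> r})"
  unfolding correlation_def
proof (intro has_bochner_integral_sum has_bochner_integral_mult_right)
  fix u v assume uv: "u \<in> fin_words I 1 N" "v \<in> fin_words I 1 N"
  have "{t\<in>cball t0 d. dist (word_point N t u) (word_point N t v) \<le> r} \<in> lmeasurable"
    unfolding word_point_def
    by (intro lmeasurable_compact compact_coincidence_set assms extend_fin_words uv order_refl)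
  then show "has_bochner_integral lebesgue (indicat_real {t\<in>cball t0 d. dist (word_point N t u) (word_point N t v) \<le> r})
      (measure lebesgue {t\<in>cball t0 d. dist (word_point N t u) (word_point N t v) \<le> r})"
    unfolding fmeasurable_def by (blast intro: has_bochner_integral_real_indicator)
qed

text \<open>The energy bound is used at an exponent \<open>s\<close> strictly between
  \<open>q\<close> and the minimum. The surplus \<open>s - q\<close> makes the contributions of the
  scales \<open>\<gamma> ^ k\<close> a geometric series, so the truncated \<open>q\<close>-energies
  have integrals bounded uniformly in \<open>N\<close>.\<close>

lemma hausdorff_measure_pos_locally:
  assumes t0: "t0 \<in> U" and q: "0 < q" "ennreal q < min (of_nat CARD('m)) (bowen_dim X I \<phi> t0)"
  shows "\<exists>d>0. AE t in lebesgue. t \<in> ball t0 d \<longrightarrow> 0 < hausdorff_measure q (limit_set X I \<phi> t)"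
proof -
  obtain x where x: "ennreal q < x" "x < min (of_nat CARD('m)) (bowen_dim X I \<phi> t0)" using dense[OF q(2)] by blast
  then obtain s where s: "x = ennreal s" "0 \<le> s" by (cases x) auto
  have qs: "q < s" using x(1) s q(1) by (simp add: ennreal_less_iff)
  have sm: "s \<le> real CARD('m)"
    using x(2) s by (simp add: ennreal_less_iff ennreal_of_nat_eq_real_of_nat)
  have P: "0 < lower_pressure X I \<phi> t0 s" using x(2) s by (intro lower_pressure_pos t0) auto
  have s0: "0 < s" using q qs by simp
  from energy_bound[OF t0 s0 sm P] obtain d M where d: "0 < d" "cball t0 d \<subseteq> U" and M: "0 < M" and
    E: "\<And>N r. \<gamma> ^ N \<le> r \<Longrightarrow> (\<Sum>u\<in>fin_words I 1 N. \<Sum>v\<in>fin_words I 1 N. weight t0 s N u * weight t0 s N v *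
      measure lebesgue {t\<in>cball t0 d. dist (word_point N t u) (word_point N t v) \<le> r}) \<le> M * r powr s"
    by blast
  define f where "f N t = (\<Sum>k\<le>N. (\<gamma> ^ k) powr (- q) * correlation t0 s d N (\<gamma> ^ k) t)" for N t
  have hi: "has_bochner_integral lebesgue (f N) (\<Sum>k\<le>N. (\<gamma> ^ k) powr (- q) *
      (\<Sum>u\<in>fin_words I 1 N. \<Sum>v\<in>fin_words I 1 N. weight t0 s N u * weight t0 s N v *
      measure lebesgue {t\<in>cball t0 d. dist (word_point N t u) (word_point N t v) \<le> \<gamma> ^ k}))" for N
    unfolding f_def
    by (intro has_bochner_integral_sum has_bochner_integral_mult_right has_integral_correlation d(2))
  define z where "z = \<gamma> powr (s - q)"
  have z: "0 < z" "z < 1" using \<gamma> qs powr01_less_one[of \<gamma> "s - q"] by (simp_all add: z_def)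
  have bound: "integral\<^sup>L lebesgue (f N) \<le> M * (\<Sum>k. z ^ k)" for N
  proof -
    have "integral\<^sup>L lebesgue (f N) \<le> (\<Sum>k\<le>N. (\<gamma> ^ k) powr (- q) * (M * (\<gamma> ^ k) powr s))"
      unfolding has_bochner_integral_integral_eq[OF hi]
      using \<gamma> by (intro sum_mono mult_left_mono E power_decreasing) auto
    also have "\<dots> = M * (\<Sum>k\<le>N. z ^ k)"
      unfolding sum_distrib_left
    proof (rule sum.cong[OF refl])
      fix k
      have "(\<gamma> ^ k) powr (- q) * (\<gamma> ^ k) powr s = (\<gamma> ^ k) powr (s - q)" by (simp flip: powr_add)
      also have "\<dots> = z ^ k" unfolding z_def using \<gamma> by (metis powr_power powr_powr powr_realpow mult.commute zero_less_power order_less_imp_not_eq2 powr_gt_zero)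
      finally show "(\<gamma> ^ k) powr (- q) * (M * (\<gamma> ^ k) powr s) = M * z ^ k" by (simp add: mult_ac)
    qed
    also have "\<dots> \<le> M * (\<Sum>k. z ^ k)"
      using z M by (intro mult_left_mono sum_le_suminf) (auto intro: summable_geometric)
    finally show ?thesis .
  qed
  have "AE t in lebesgue. \<exists>C>0. \<forall>N0. \<exists>N\<ge>N0. f N t \<le> C"
  proof (rule AE_frequently_bounded[OF _ _ bound])
    show "integrable lebesgue (f N)" for N using hi has_bochner_integral_iff by blast
    show "0 \<le> f N t" for N t unfolding f_def by (intro sum_nonneg mult_nonneg_nonneg correlation_nonneg t0) auto
  qed
  then have "AE t in lebesgue. t \<in> ball t0 d \<longrightarrow> 0 < hausdorff_measure q (limit_set X I \<phi> t)"
  proof (rule AE_mp, intro AE_I2 impI)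
    fix t assume "\<exists>C>0. \<forall>N0. \<exists>N\<ge>N0. f N t \<le> C" and "t \<in> ball t0 d"
    then obtain C where C: "C > 0" "\<And>N0. \<exists>N\<ge>N0. f N t \<le> C" and t: "t \<in> cball t0 d" by auto
    have tU: "t \<in> U" using t d(2) by blast
    show "0 < hausdorff_measure q (limit_set X I \<phi> t)"
    proof (rule hausdorff_measure_pos_if_finite_energies[OF compact_limit_set[OF tU] q(1) \<gamma> C(1)])
      fix N0
      obtain N where N: "N \<ge> N0" "f N t \<le> C" using C(2) by blast
      show "\<exists>N\<ge>N0. \<exists>(W::(nat \<Rightarrow> 'i) set) \<mu> x. finite W \<and> (\<forall>u\<in>W. 0 \<le> \<mu> u) \<and> sum \<mu> W = 1 \<and> x ` W \<subseteq> limit_set X I \<phi> t \<and>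
        (\<Sum>k\<le>N. (\<gamma> ^ k) powr (- q) * (\<Sum>u\<in>W. \<Sum>v\<in>W. \<mu> u * \<mu> v * of_bool (dist (x u) (x v) \<le> \<gamma> ^ k))) \<le> C"
      proof (intro exI[of _ N] exI[of _ "fin_words I 1 N"] exI[of _ "weight t0 s N"] exI[of _ "word_point N t"] conjI)
        show "(\<Sum>k\<le>N. (\<gamma> ^ k) powr (- q) * (\<Sum>u\<in>fin_words I 1 N. \<Sum>v\<in>fin_words I 1 N.
            weight t0 s N u * weight t0 s N v * of_bool (dist (word_point N t u) (word_point N t v) \<le> \<gamma> ^ k))) \<le> C"
          using N(2) unfolding f_def correlation_eq[OF t] .
      qed (use N(1) finite_fin_words[of 1 N] weight_nonneg[OF t0] sum_weight[OF t0, of s N] word_point_mem in auto)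
    qed
  qed
  then show ?thesis using d(1) by blast
qed

text \<open>Here \<open>s\<close> equals the dimension and no surplus exponent is available. The
  single scale \<open>\<gamma> ^ N\<close> per configuration is enough, so no series over scales
  appears.\<close>

lemma emeasure_limit_set_pos_locally:
  assumes t0: "t0 \<in> U" and m: "of_nat CARD('m) < bowen_dim X I \<phi> t0"
  shows "\<exists>d>0. AE t in lebesgue. t \<in> ball t0 d \<longrightarrow> 0 < emeasure lebesgue (limit_set X I \<phi> t)"
proof -
  define s where "s = real CARD('m)"
  have s0: "0 < s" "s \<le> real CARD('m)" by (auto simp: s_def)
  have P: "0 < lower_pressure X I \<phi> t0 s"
    using m by (intro lower_pressure_pos t0) (auto simp: s_def ennreal_of_nat_eq_real_of_nat)
  from energy_bound[OF t0 s0 P] obtain d M where d: "0 < d" "cball t0 d \<subseteq> U" and M: "0 < M" and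
    E: "\<And>N r. \<gamma> ^ N \<le> r \<Longrightarrow> (\<Sum>u\<in>fin_words I 1 N. \<Sum>v\<in>fin_words I 1 N. weight t0 s N u * weight t0 s N v *
      measure lebesgue {t\<in>cball t0 d. dist (word_point N t u) (word_point N t v) \<le> r}) \<le> M * r powr s"
    by blast
  define f where "f N t = (\<gamma> ^ N) powr (- s) * correlation t0 s d N (\<gamma> ^ N) t" for N t
  have hi: "has_bochner_integral lebesgue (f N) ((\<gamma> ^ N) powr (- s) *
      (\<Sum>u\<in>fin_words I 1 N. \<Sum>v\<in>fin_words I 1 N. weight t0 s N u * weight t0 s N v *
      measure lebesgue {t\<in>cball t0 d. dist (word_point N t u) (word_point N t v) \<le> \<gamma> ^ N}))" for N
    unfolding f_def
    by (intro has_bochner_integral_mult_right has_integral_correlation d(2))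
  have bound: "integral\<^sup>L lebesgue (f N) \<le> M" for N
  proof -
    have "integral\<^sup>L lebesgue (f N) \<le> (\<gamma> ^ N) powr (- s) * (M * (\<gamma> ^ N) powr s)"
      unfolding has_bochner_integral_integral_eq[OF hi] by (intro mult_left_mono E) auto
    also have "\<dots> = M" using \<gamma> by (simp add: powr_minus)
    finally show ?thesis .
  qed
  have "AE t in lebesgue. \<exists>C>0. \<forall>N0. \<exists>N\<ge>N0. f N t \<le> C"
  proof (rule AE_frequently_bounded[OF _ _ bound])
    show "integrable lebesgue (f N)" for N using hi has_bochner_integral_iff by blast
    show "0 \<le> f N t" for N t unfolding f_def by (intro mult_nonneg_nonneg correlation_nonneg t0) auto
  qed
  then have "AE t in lebesgue. t \<in> ball t0 d \<longrightarrow> 0 < emeasure lebesgue (limit_set X I \<phi> t)"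
  proof (rule AE_mp, intro AE_I2 impI)
    fix t assume "\<exists>C>0. \<forall>N0. \<exists>N\<ge>N0. f N t \<le> C" and "t \<in> ball t0 d"
    then obtain C where C: "C > 0" "\<And>N0. \<exists>N\<ge>N0. f N t \<le> C" and t: "t \<in> cball t0 d" by auto
    have tU: "t \<in> U" using t d(2) by blast
    show "0 < emeasure lebesgue (limit_set X I \<phi> t)"
    proof (rule emeasure_pos_if_finite_energies[OF compact_limit_set[OF tU] C(1)])
      fix e :: real assume "0 < e"
      then obtain N0 where N0: "\<gamma> ^ N0 < e" using real_arch_pow_inv \<gamma> by blast
      obtain N where N: "N \<ge> N0" "f N t \<le> C" using C(2) by blast
      have "\<gamma> ^ N \<le> \<gamma> ^ N0" using \<gamma> by (intro power_decreasing N(1)) auto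
      then have "\<gamma> ^ N < e" using N0 by linarith
      then have r: "0 < \<gamma> ^ N" "\<gamma> ^ N < e" using \<gamma> by simp_all
      have "correlation t0 s d N (\<gamma> ^ N) t = (\<gamma> ^ N) powr s * f N t" using \<gamma> by (simp add: f_def powr_minus)
      also have "\<dots> \<le> (\<gamma> ^ N) powr s * C" using N(2) by (intro mult_left_mono) auto
      also have "\<dots> = C * (\<gamma> ^ N) ^ DIM(real^'m)" using r by (simp add: s_def powr_realpow)
      finally have en: "correlation t0 s d N (\<gamma> ^ N) t \<le> C * (\<gamma> ^ N) ^ DIM(real^'m)" .
      show "\<exists>r>0. r < e \<and> (\<exists>(W::(nat \<Rightarrow> 'i) set) \<mu> x. finite W \<and> (\<forall>u\<in>W. 0 \<le> \<mu> u) \<and> sum \<mu> W = 1 \<and> x ` W \<subseteq> limit_set X I \<phi> t \<and>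
        (\<Sum>u\<in>W. \<Sum>v\<in>W. \<mu> u * \<mu> v * of_bool (dist (x u) (x v) \<le> r)) \<le> C * r ^ DIM(real^'m))"
      proof (intro exI[of _ "\<gamma> ^ N"] exI[of _ "fin_words I 1 N"] exI[of _ "weight t0 s N"] exI[of _ "word_point N t"] conjI r)
        show "(\<Sum>u\<in>fin_words I 1 N. \<Sum>v\<in>fin_words I 1 N.
            weight t0 s N u * weight t0 s N v * of_bool (dist (word_point N t u) (word_point N t v) \<le> \<gamma> ^ N))
            \<le> C * (\<gamma> ^ N) ^ DIM(real^'m)"
          using en unfolding correlation_eq[OF t] .
      qed (use finite_fin_words[of 1 N] weight_nonneg[OF t0] sum_weight[OF t0, of s N] word_point_mem in auto)
    qed
  qed
  then show ?thesis using d(1) by blast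
qed

text \<open>For each rational \<open>q\<close> the local statement gives a null set of exceptions;
  their countable union serves all \<open>q\<close> at once.\<close>

lemma AE_hausdorff_dim_limit_set:
  "AE t in lebesgue. t \<in> U \<longrightarrow>
    hausdorff_dim (limit_set X I \<phi> t) = min (of_nat CARD('m)) (bowen_dim X I \<phi> t)"
proof -
  let ?b = "\<lambda>t. min (of_nat CARD('m)) (bowen_dim X I \<phi> t)"
  have "AE t in lebesgue. t \<in> {t\<in>U. ennreal q < ?b t} \<longrightarrow> 0 < hausdorff_measure q (limit_set X I \<phi> t)"
    if q: "q \<in> \<rat> \<inter> {0<..}" for q
    using q by (intro AE_lebesgue_locally hausdorff_measure_pos_locally) auto
  then have "AE t in lebesgue. \<forall>q\<in>\<rat> \<inter> {0<..}. t \<in> {t\<in>U. ennreal q < ?b t} \<longrightarrow>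
      0 < hausdorff_measure q (limit_set X I \<phi> t)"
    by (intro AE_ball_countable[THEN iffD2] ballI) (auto intro: countable_subset[OF _ countable_rat])
  then show ?thesis
  proof (rule AE_mp, intro AE_I2 impI)
    fix t assume *: "\<forall>q\<in>\<rat> \<inter> {0<..}. t \<in> {t\<in>U. ennreal q < ?b t} \<longrightarrow>
      0 < hausdorff_measure q (limit_set X I \<phi> t)" and t: "t \<in> U"
    show "hausdorff_dim (limit_set X I \<phi> t) = ?b t"
    proof (rule antisym[OF hausdorff_dim_limit_set_le[OF t]], rule le_hausdorff_dimI)
      fix q :: real assume "q \<in> \<rat>" "0 < q" "ennreal q < ?b t"
      then show "0 < hausdorff_measure q (limit_set X I \<phi> t)" using * t by simp
    qed
  qed
qed

lemma AE_emeasure_limit_set_pos: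
  "AE t in lebesgue. t \<in> U \<longrightarrow> of_nat CARD('m) < bowen_dim X I \<phi> t \<longrightarrow>
    0 < emeasure lebesgue (limit_set X I \<phi> t)"
proof -
  have "AE t in lebesgue. t \<in> {t\<in>U. of_nat CARD('m) < bowen_dim X I \<phi> t} \<longrightarrow>
      0 < emeasure lebesgue (limit_set X I \<phi> t)"
    by (intro AE_lebesgue_locally emeasure_limit_set_pos_locally) auto
  then show ?thesis by eventually_elim simp
qed

end

section \<open>Empty alphabets and the conclusion\<close>

lemma limit_set_empty_alphabet:
  assumes "1 \<le> j" "I j = {}"
  shows "limit_set X I \<phi> t = {}" "bowen_dim X I \<phi> t = 0"
proof -
  have "inf_words I 1 = {}" using assms by (auto simp: inf_words_def PiE_eq_empty_iff)
  then show "limit_set X I \<phi> t = {}" by (simp add: limit_set_def)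
  have "lower_pressure X I \<phi> t s \<le> 0" for s
  proof -
    \<comment> \<open>From level \<open>j\<close> on there are no words. As
      \<open>n \<ge> j \<ge> 1\<close>, the factor \<open>1 / n\<close> is positive and the product
      with \<open>-\<infinity>\<close> is \<open>-\<infinity>\<close>.\<close>
    have "eventually (\<lambda>n. ereal (1 / real n) * ext_ln (partition_sum X I \<phi> n t s) = -\<infinity>) sequentially"
      using eventually_ge_at_top[of j]
    proof eventually_elim
      case (elim n)
      then have "fin_words I 1 n = {}" using assms by (auto simp: fin_words_def PiE_eq_empty_iff)
      then show ?case using elim assms(1) by (simp add: partition_sum_def ext_ln_def)
    qed
    then have "lower_pressure X I \<phi> t s = liminf (\<lambda>n. -\<infinity>)"
      unfolding lower_pressure_def by (rule Liminf_eq)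
    then show ?thesis by (simp add: Liminf_const)
  qed
  then have "{s. 0 \<le> s \<and> 0 < lower_pressure X I \<phi> t s} = {}" by (auto simp: not_less)
  then show "bowen_dim X I \<phi> t = 0" by (simp only: bowen_dim_def image_empty Sup_empty bot_ennreal)
qed

lemma hausdorff_dim_empty: "hausdorff_dim {} = 0"
proof -
  have "hausdorff_dim ({} :: 'a::metric_space set) \<le> 0"
  proof (rule hausdorff_dim_leI)
    fix s :: real assume "0 < s"
    then show "hausdorff_measure s ({} :: 'a set) = 0"
      by (intro hausdorff_measure_eq_0I) (auto intro!: exI[of _ "{} :: nat set"])
  qed
  then show ?thesis by simp
qed

theorem theoremA:
  fixes X V :: "(real^'m) set" and U :: "(real^'d) set"
    and I :: "nat \<Rightarrow> 'i set"
    and \<phi> :: "nat \<Rightarrow> 'i \<Rightarrow> real^'d \<Rightarrow> real^'m \<Rightarrow> real^'m"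
  assumes "TNCIFS X U I V \<phi>"
  shows "(AE t in lebesgue_on U.
            hausdorff_dim (limit_set X I \<phi> t) = min (of_nat CARD('m)) (bowen_dim X I \<phi> t)) \<and>
         (AE t in lebesgue_on U.
            bowen_dim X I \<phi> t > of_nat CARD('m) \<longrightarrow> emeasure lebesgue (limit_set X I \<phi> t) > 0)"
proof (cases "\<exists>j\<ge>1. I j = {}")
  \<comment> \<open>Both sides of the dimension formula are 0, and the premise of the second claim
    is false.\<close>
  case True
  then obtain j where "1 \<le> j" "I j = {}" by blast
  then have "limit_set X I \<phi> t = {}" "bowen_dim X I \<phi> t = 0" for t
    by (rule limit_set_empty_alphabet)+
  then show ?thesis by (simp add: hausdorff_dim_empty)
next
  case False
  have conf: "conformality X U I V \<phi>" using assms by (simp add: TNCIFS_def)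
  obtain \<gamma> where \<gamma>: "0 < \<gamma>" "\<gamma> < 1" "\<forall>t\<in>U. \<forall>n\<ge>1. \<forall>j\<ge>1. \<forall>\<omega>\<in>inf_words I n. \<forall>x\<in>V.
           conformal_factor (prefix_map \<phi> t n j \<omega>) x \<le> \<gamma> ^ j"
    using assms unfolding TNCIFS_def uniform_contraction_def by blast
  obtain K where K: "continuous_on U K" "\<forall>t\<in>U. 1 \<le> K t" "\<forall>t\<in>U. \<forall>n\<ge>1. \<forall>j\<ge>1. \<forall>\<omega>\<in>inf_words I n. \<forall>x1\<in>V. \<forall>x2\<in>V.
           conformal_factor (prefix_map \<phi> t n j \<omega>) x1
             \<le> K t * conformal_factor (prefix_map \<phi> t n j \<omega>) x2"
    using assms unfolding TNCIFS_def bounded_distortion_def by blast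
  interpret tncifs X V U I \<phi> \<gamma> K
  proof
    show "X \<noteq> {}" "compact X" "convex X" "open U" "distortion_continuity X U I \<phi>"
      "address_continuity X U I \<phi>" "transversality X U I \<phi>"
      using assms by (simp_all add: TNCIFS_def)
    show "open V" "X \<subseteq> V" using conf by (simp_all add: conformality_def)
  qed (use assms conf False \<gamma> K in \<open>simp_all add: TNCIFS_def conformality_def\<close>)
  have U: "U \<inter> space lebesgue \<in> sets lebesgue" using assms by (auto simp: TNCIFS_def)
  show ?thesis
    using AE_hausdorff_dim_limit_set AE_emeasure_limit_set_pos
    by (simp add: AE_restrict_space_iff[OF U])
qed

end
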